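(* Let $H$ be a graph with $e(H)>0$, and let $\Theta=P(r_1,\ldots,r_s)$ be an arbitrary rooted theta pattern. (1) If $H$ is Sidorenko-good, then $H[\Theta]$ is Sidorenko-good. Moreover, if either $H$ is Sidorenko-good-forcing or $s\ge2$, then for a bounded doubly nonnegative kernel $K$ with $\|K\|_1>0$, equality $$t(H[\Theta],K)=\|K\|_1^{e(H[\Theta])}$$ holds if and only if $K=\|K\|_1$ almost everywhere (i.e. $K$ is a.e. equal to the constant $\|K\|_1$). (2) If $H$ is KNRS, then $H[\Theta]$ is regular-KNRS. Moreover, if $H$ is KNRS-forcing, then for $0<\rho<1$ and a graphon $W$ that is $\rho$-locally dense and $\rho$-regular, equality $$t(H[\Theta],W)=\rho^{e(H[\Theta])}$$ holds if and only if $W=\rho$ almost everywhere.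
   Context: Graphs are finite and loopless; parallel edges are allowed, and $e(H)$ counts edges with multiplicity. A graphon is a symmetric measurable function $W:[0,1]^2\to[0,1]$; a kernel is a bounded symmetric measurable function $K:[0,1]^2\to\mathbb{R}$. For a graph $H$ and a nonnegative kernel $K$, $$t(H,K)=\int_{[0,1]^{V(H)}}\prod_{ij\in E(H)}K(x_i,x_j)\prod_{i\in V(H)}dx_i,$$ with the product over edges taken with multiplicity, and $\|K\|_1=\int_{[0,1]^2}K\,dx\,dy$. A rooted theta pattern $\Theta=P(r_1,\ldots,r_s)$ ($s\ge1$, integers $r_i\ge1$) consists of two distinct root vertices joined by $s$ internally disjoint root-to-root paths (branches) of lengths $r_1,\ldots,r_s$ (length = number of edges); several $r_i$ may equal $1$, giving parallel edges between the roots. The uniform theta-subdivision $H[\Theta]$ is obtained from $H$ by replacing every edge of $H$ with a fresh copy of $\Theta$, identifying the two roots with the endpoints of the original edge. For $\rho\in[0,1]$, a graphon $W$ is $\rho$-locally dense if $\int_{S\times S}W\,dx\,dy\ge\rho\,\lambda(S)^2$ for every measurable $S\subseteq[0,1]$ ($\lambda$ is Lebesgue measure), and $\rho$-regular if $\int_0^1W(x,y)\,dy=\rho$ for a.e. $x$. A graph $H$ is KNRS if $t(H,W)\ge\rho^{e(H)}$ for every $\rho\in[0,1]$ and every $\rho$-locally dense graphon $W$; it is regular-KNRS if this inequality holds for every $\rho\in[0,1]$ and every graphon $W$ that is both $\rho$-locally dense and $\rho$-regular. A KNRS graph $H$ is KNRS-forcing if, for $\rho\in(0,1)$ and $W$ a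 $\rho$-locally dense graphon, $t(H,W)=\rho^{e(H)}$ implies $W=\rho$ a.e. A kernel $K$ is doubly nonnegative if $K\ge0$ a.e. and $\int_{[0,1]^2}f(x)K(x,y)f(y)\,dx\,dy\ge0$ for every bounded measurable $f:[0,1]\to\mathbb{R}$. $H$ is Sidorenko-good if $t(H,K)\ge\|K\|_1^{e(H)}$ for every (bounded) doubly nonnegative kernel $K$. A Sidorenko-good graph $H$ is Sidorenko-good-forcing if equality for a doubly nonnegative kernel $K$ with $\|K\|_1\in(0,\infty)$ implies $K=\|K\|_1$ a.e. *)

theory Defs
  imports "HOL-Analysis.Analysis"
begin

section \<open>Finite loopless multigraphs\<close>

record ('v, 'e) mgraph =
  verts :: "'v set"
  edges :: "'e set"
  ends :: "'e \<Rightarrow> 'v set"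

locale multigraph =
  fixes H :: "('v, 'e) mgraph"
  assumes finite_verts: "finite (verts H)"
    and finite_edges: "finite (edges H)"
    and ends_subset: "\<And>e. e \<in> edges H \<Longrightarrow> ends H e \<subseteq> verts H"
    and card_ends: "\<And>e. e \<in> edges H \<Longrightarrow> card (ends H e) = 2"

definition num_edges :: "('v, 'e) mgraph \<Rightarrow> nat" where
  "num_edges H = card (edges H)"

text \<open>An arbitrary ordering \<open>(u, v)\<close> of a two-element set \<open>{u, v}\<close>. It is only used where the
  choice is immaterial: to evaluate a symmetric kernel at an edge, and to glue the two roots of a
  theta pattern (which can be swapped by an automorphism) to the end-vertices of an edge.\<close>

definition ordered_ends :: "'v set \<Rightarrow> 'v \<times> 'v" where
  "ordered_ends A = (SOME p. A = {fst p, snd p})"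

section \<open>Theta patterns and theta-subdivisions\<close>

text \<open>A pattern \<open>P(r\<^sub>1, \<dots>, r\<^sub>s)\<close> is given by the list \<open>rs\<close> of its branch lengths. Branch \<open>i\<close>
  (counted from 0) is the path through \<open>branch_vertex rs i 0, \<dots>, branch_vertex rs i (rs ! i)\<close>.\<close>

datatype theta_vertex = Root1 | Root2 | Inner nat nat

definition theta_lengths :: "nat list \<Rightarrow> bool" where
  "theta_lengths rs \<longleftrightarrow> length rs \<ge> 1 \<and> (\<forall>r\<in>set rs. r \<ge> 1)"

definition branch_vertex :: "nat list \<Rightarrow> nat \<Rightarrow> nat \<Rightarrow> theta_vertex" where
  "branch_vertex rs i j = (if j = 0 then Root1 else if j = rs ! i then Root2 else Inner i j)"

definition theta_pattern :: "nat list \<Rightarrow> (theta_vertex, nat \<times> nat) mgraph" where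
  "theta_pattern rs =
    \<lparr> verts = {Root1, Root2} \<union> {Inner i j | i j. i < length rs \<and> 0 < j \<and> j < rs ! i},
      edges = {(i, j). i < length rs \<and> j < rs ! i},
      ends = (\<lambda>(i, j). {branch_vertex rs i j, branch_vertex rs i (Suc j)}) \<rparr>"

text \<open>The vertex of \<open>H[\<Theta>]\<close> corresponding to a vertex of the copy of \<open>\<Theta>\<close> that replaces the
  edge \<open>e\<close>: the roots are identified with the ends of \<open>e\<close>, inner vertices are tagged by \<open>e\<close>.\<close>

fun glue :: "('v, 'e) mgraph \<Rightarrow> 'e \<Rightarrow> theta_vertex \<Rightarrow> 'v + 'e \<times> nat \<times> nat" where
  "glue H e Root1 = Inl (fst (ordered_ends (ends H e)))"
| "glue H e Root2 = Inl (snd (ordered_ends (ends H e)))"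
| "glue H e (Inner i j) = Inr (e, i, j)"

definition theta_subdivision ::
    "('v, 'e) mgraph \<Rightarrow> nat list \<Rightarrow> ('v + 'e \<times> nat \<times> nat, 'e \<times> nat \<times> nat) mgraph" where
  "theta_subdivision H rs =
    \<lparr> verts = Inl ` verts H \<union> (\<Union>e\<in>edges H. glue H e ` verts (theta_pattern rs)),
      edges = edges H \<times> edges (theta_pattern rs),
      ends = (\<lambda>(e, f). glue H e ` ends (theta_pattern rs) f) \<rparr>"

section \<open>Kernels, graphons and homomorphism densities\<close>

text \<open>Functions on the unit square are total functions on \<open>real \<times> real\<close> whose values outside the
  square are irrelevant. Measurability is Lebesgue measurability.\<close>

abbreviation unit_square :: "(real \<times> real) set" where
  "unit_square \<equiv> {0..1} \<times> {0..1}"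

definition kernel :: "(real \<times> real \<Rightarrow> real) \<Rightarrow> bool" where
  "kernel K \<longleftrightarrow> K \<in> borel_measurable (lebesgue_on unit_square) \<and>
     bounded (K ` unit_square) \<and>
     (\<forall>x\<in>{0..1}. \<forall>y\<in>{0..1}. K (x, y) = K (y, x))"

definition graphon :: "(real \<times> real \<Rightarrow> real) \<Rightarrow> bool" where
  "graphon W \<longleftrightarrow> W \<in> borel_measurable (lebesgue_on unit_square) \<and>
     (\<forall>z\<in>unit_square. 0 \<le> W z \<and> W z \<le> 1) \<and>
     (\<forall>x\<in>{0..1}. \<forall>y\<in>{0..1}. W (x, y) = W (y, x))"

definition edge_value :: "(real \<times> real \<Rightarrow> real) \<Rightarrow> ('v \<Rightarrow> real) \<Rightarrow> 'v set \<Rightarrow> real" where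
  "edge_value K x A = (case ordered_ends A of (u, v) \<Rightarrow> K (x u, x v))"

text \<open>The product measure has to be completed: for Lebesgue measurable \<open>K\<close> the integrand need not be
  measurable with respect to the product of the Lebesgue \<open>\<sigma>\<close>-algebras.\<close>

definition hom_density :: "('v, 'e) mgraph \<Rightarrow> (real \<times> real \<Rightarrow> real) \<Rightarrow> real" where
  "hom_density H K =
     (\<integral>x. (\<Prod>e\<in>edges H. edge_value K x (ends H e))
        \<partial>completion (Pi\<^sub>M (verts H) (\<lambda>_. lebesgue_on {0..1})))"

text \<open>Only used for (almost everywhere) nonnegative kernels.\<close>

definition kernel_norm1 :: "(real \<times> real \<Rightarrow> real) \<Rightarrow> real" where
  "kernel_norm1 K = (\<integral>z. K z \<partial>lebesgue_on unit_square)"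

definition ae_const :: "(real \<times> real \<Rightarrow> real) \<Rightarrow> real \<Rightarrow> bool" where
  "ae_const K c \<longleftrightarrow> (AE z in lebesgue_on unit_square. K z = c)"

section \<open>KNRS graphs\<close>

definition locally_dense :: "real \<Rightarrow> (real \<times> real \<Rightarrow> real) \<Rightarrow> bool" where
  "locally_dense \<rho> W \<longleftrightarrow>
     (\<forall>S. S \<in> sets lebesgue \<and> S \<subseteq> {0..1} \<longrightarrow>
        (\<integral>z\<in>S \<times> S. W z \<partial>lebesgue) \<ge> \<rho> * (measure lebesgue S)\<^sup>2)"

definition regular_graphon :: "real \<Rightarrow> (real \<times> real \<Rightarrow> real) \<Rightarrow> bool" where
  "regular_graphon \<rho> W \<longleftrightarrow>
     (AE x in lebesgue_on {0..1}. (\<integral>y. W (x, y) \<partial>lebesgue_on {0..1}) = \<rho>)"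

definition KNRS :: "('v, 'e) mgraph \<Rightarrow> bool" where
  "KNRS H \<longleftrightarrow>
     (\<forall>\<rho> W. 0 \<le> \<rho> \<and> \<rho> \<le> 1 \<and> graphon W \<and> locally_dense \<rho> W \<longrightarrow>
        hom_density H W \<ge> \<rho> ^ num_edges H)"

definition regular_KNRS :: "('v, 'e) mgraph \<Rightarrow> bool" where
  "regular_KNRS H \<longleftrightarrow>
     (\<forall>\<rho> W. 0 \<le> \<rho> \<and> \<rho> \<le> 1 \<and> graphon W \<and> locally_dense \<rho> W \<and> regular_graphon \<rho> W \<longrightarrow>
        hom_density H W \<ge> \<rho> ^ num_edges H)"

definition KNRS_forcing :: "('v, 'e) mgraph \<Rightarrow> bool" where
  "KNRS_forcing H \<longleftrightarrow> KNRS H \<and>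
     (\<forall>\<rho> W. 0 < \<rho> \<and> \<rho> < 1 \<and> graphon W \<and> locally_dense \<rho> W \<and>
        hom_density H W = \<rho> ^ num_edges H \<longrightarrow> ae_const W \<rho>)"

section \<open>Sidorenko-good graphs\<close>

definition doubly_nonnegative :: "(real \<times> real \<Rightarrow> real) \<Rightarrow> bool" where
  "doubly_nonnegative K \<longleftrightarrow> kernel K \<and>
     (AE z in lebesgue_on unit_square. 0 \<le> K z) \<and>
     (\<forall>f. f \<in> borel_measurable (lebesgue_on {0..1}) \<and> bounded (f ` {0..1}) \<longrightarrow>
        0 \<le> (\<integral>(x, y). f x * K (x, y) * f y \<partial>lebesgue_on unit_square))"

definition Sidorenko_good :: "('v, 'e) mgraph \<Rightarrow> bool" where
  "Sidorenko_good H \<longleftrightarrow>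
     (\<forall>K. doubly_nonnegative K \<longrightarrow> hom_density H K \<ge> kernel_norm1 K ^ num_edges H)"

definition Sidorenko_good_forcing :: "('v, 'e) mgraph \<Rightarrow> bool" where
  "Sidorenko_good_forcing H \<longleftrightarrow> Sidorenko_good H \<and>
     (\<forall>K. doubly_nonnegative K \<and> kernel_norm1 K > 0 \<and>
        hom_density H K = kernel_norm1 K ^ num_edges H \<longrightarrow> ae_const K (kernel_norm1 K))"

section \<open>Basic facts\<close>

lemma ordered_ends:
  assumes "card A = 2"
  shows "A = {fst (ordered_ends A), snd (ordered_ends A)}"
proof -
  obtain u v where "A = {u, v}" using assms by (auto simp: card_2_iff)
  then have "A = {fst (u, v), snd (u, v)}" by simp
  then show ?thesis unfolding ordered_ends_def by (rule someI)
qed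

lemma multigraph_theta_pattern: "multigraph (theta_pattern rs)"
proof
  have *: "edges (theta_pattern rs) = (SIGMA i:{..<length rs}. {..<rs ! i})"
    by (auto simp: theta_pattern_def)
  then show "finite (edges (theta_pattern rs))" by simp
  have "verts (theta_pattern rs) \<subseteq> {Root1, Root2} \<union> (\<lambda>(i, j). Inner i j) ` edges (theta_pattern rs)"
    by (auto simp: theta_pattern_def)
  then show "finite (verts (theta_pattern rs))"
    by (rule finite_subset) (simp add: *)
next
  fix e assume "e \<in> edges (theta_pattern rs)"
  then obtain i j where e: "e = (i, j)" "i < length rs" "j < rs ! i"
    by (auto simp: theta_pattern_def)
  show "ends (theta_pattern rs) e \<subseteq> verts (theta_pattern rs)"
    using e by (simp add: theta_pattern_def branch_vertex_def)
  show "card (ends (theta_pattern rs) e) = 2"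
    using e by (simp add: theta_pattern_def branch_vertex_def card_insert_if)
qed

lemma (in multigraph) multigraph_theta_subdivision: "multigraph (theta_subdivision H rs)"
proof -
  interpret T: multigraph "theta_pattern rs"
    by (rule multigraph_theta_pattern)
  have inj: "inj (glue H e)" if "e \<in> edges H" for e
  proof -
    have "fst (ordered_ends (ends H e)) \<noteq> snd (ordered_ends (ends H e))"
      using ordered_ends[OF card_ends[OF that]] card_ends[OF that]
      by (metis card_2_iff doubleton_eq_iff insert_absorb2)
    then have "x = y" if "glue H e x = glue H e y" for x y
      using that by (cases x; cases y) auto
    then show ?thesis by (rule injI)
  qed
  show ?thesis
  proof
    show "finite (verts (theta_subdivision H rs))" "finite (edges (theta_subdivision H rs))"
      by (simp_all add: theta_subdivision_def finite_verts finite_edges T.finite_verts T.finite_edges)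
  next
    fix e assume "e \<in> edges (theta_subdivision H rs)"
    then obtain e' f where e: "e = (e', f)" "e' \<in> edges H" "f \<in> edges (theta_pattern rs)"
      by (auto simp: theta_subdivision_def)
    show "ends (theta_subdivision H rs) e \<subseteq> verts (theta_subdivision H rs)"
      using e T.ends_subset[OF e(3)] by (auto simp: theta_subdivision_def)
    show "card (ends (theta_subdivision H rs) e) = 2"
      using e T.card_ends[OF e(3)] card_image[OF inj_on_subset[OF inj[OF e(2)] subset_UNIV]]
      by (simp add: theta_subdivision_def)
  qed
qed

end

theory Submission imports Defs "HOL-Probability.Infinite_Product_Measure"
begin

text \<open>Write \<open>K\<^sup>r\<close> for the \<open>r\<close>-fold composition of a kernel with itself. Integrating out the inner vertices of all copies
of \<open>\<Theta>\<close> shows that the density of \<open>H[\<Theta>]\<close> in \<open>K\<close> is the density of \<open>H\<close> in the single kernel \<open>M = \<Prod>\<^sub>i K\<^sup>r\<^sup>i\<close>, a pointwise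
product over the branches (\<open>hom_density_theta_subdivision\<close>). The theorem is therefore about \<open>M\<close>.

Consider first a Sidorenko-good \<open>H\<close>. If \<open>K\<close> is positive semidefinite, so are its powers, and so is \<open>M\<close> by the Schur product theorem
for kernels (\<open>psd_mult\<close>). By the hypothesis on \<open>H\<close>, it remains to bound the integral of \<open>M\<close> below by \<open>p\<close> to the power
\<open>\<Sum>\<^sub>i r\<^sub>i\<close>, where \<open>p\<close> is the integral of \<open>K\<close>. The moments \<open>a\<^sub>m = \<langle>1, K\<^sup>m 1\<rangle>\<close> are log-convex with \<open>a\<^sub>0 = 1\<close>, which settles a single
branch. For \<open>s \<ge> 2\<close> branches put \<open>d = K\<^sup>n 1\<close> with \<open>n\<close> at least every \<open>r\<^sub>i\<close>. By Cauchy--Schwarz, \<open>K\<^sup>r\<close> minus the rank-one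
kernel \<open>d(x) d(y) / a\<^bsub>2n-r\<^esub>\<close> is positive semidefinite, for every branch with the same \<open>d\<close> (\<open>kpow_dominates\<close>). Such
domination survives pointwise products (\<open>dominates_mult\<close>), so the integral of \<open>M\<close> is at least
\<open>(\<integral> d\<^sup>s)\<^sup>2 / \<Prod>\<^sub>i a\<^bsub>2n-r_i\<^esub>\<close>. The power mean inequality bounds the numerator below by \<open>(\<integral> d\<^sup>2)\<^sup>s = a\<^bsub>2n\<^esub>\<^sup>s\<close>, and by
log-convexity each ratio \<open>a\<^bsub>2n\<^esub> / a\<^bsub>2n-r\<^esub>\<close> is at least \<open>(a\<^sub>2 / a\<^sub>1)\<^sup>r\<close>, hence at least \<open>p\<^sup>r\<close>.

In the equality case with at least two branches, the last bound forces \<open>a\<^sub>2 = a\<^sub>1\<^sup>2\<close>, so the degree function \<open>K 1\<close> is the constant \<open>p\<close>. Then \<open>K\<^sup>r - p\<^sup>r\<close> dominates a multiple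
of the rank-one kernel of \<open>K\<^sup>n u\<close> for every mean-zero \<open>u\<close>. With two branches the product of two such terms adds a strictly
positive amount to the integral of \<open>M\<close> unless \<open>K\<^sup>n u = 0\<close> (\<open>regular_integral_theta_kernel_strict\<close>). So \<open>K\<^sup>n u = 0\<close>, hence
\<open>K u = 0\<close>, for all mean-zero \<open>u\<close>, and \<open>K\<close> is constant. If there is just one branch, forcing of \<open>H\<close> makes \<open>M\<close>, which is a power
\<open>K\<^sup>r\<close>, constant; for \<open>r \<ge> 2\<close> this again gives \<open>a\<^sub>2 = a\<^sub>1\<^sup>2\<close>, and the same descent applies.

Now let \<open>H\<close> be KNRS. Local density passes from sets to weight functions (\<open>locally_dense_functions\<close>). If moreover \<open>W\<close> is
\<open>\<rho>\<close>-regular, then adding a constant to a test function does not change its form under \<open>W - \<rho>\<close>, and the test function may be assumed nonnegative; so \<open>W - \<rho>\<close>, and with it \<open>W\<close>, is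
positive semidefinite. Each \<open>W\<^sup>r\<close> then dominates the constant \<open>\<rho>\<^sup>r\<close>, so \<open>M\<close> is locally dense for the product of these constants,
and the hypothesis on \<open>H\<close> can be applied to \<open>M\<close>. The equality case is reduced to the one above.

All analysis uses Borel functions on the line under the uniform measure on the unit interval; Lebesgue measurable kernels are replaced
by Borel versions.\<close>

section \<open>Bounded Borel functions and kernel operators\<close>

text \<open>The uniform distribution on the unit interval, carried by all Borel sets of the line: with the whole line as space,
measurability is plain Borel measurability, also on products.\<close>

definition unif :: "real measure" where
  "unif = density lborel (indicator {0..1})"

lemma prob_space_unif: "prob_space unif"
  by (rule prob_spaceI) (simp add: unif_def emeasure_density)

abbreviation unif2 :: "(real \<times> real) measure" where
  "unif2 \<equiv> unif \<Otimes>\<^sub>M unif"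

interpretation unif: prob_space unif by (rule prob_space_unif)
interpretation unif2: pair_prob_space unif unif ..

lemma sets_unif [measurable_cong, simp]: "sets unif = sets borel"
  by (simp add: unif_def)

lemma space_unif [simp]: "space unif = UNIV"
  by (simp add: unif_def)

lemma sets_unif2 [measurable_cong, simp]: "sets unif2 = sets (borel :: (real \<times> real) measure)"
  by (metis borel_prod sets_pair_measure_cong sets_unif)

lemma space_unif2 [simp]: "space unif2 = UNIV"
  by (simp add: space_pair_measure)

text \<open>Bounds are required everywhere, not just on the unit square, so that all integrability conditions become trivial.\<close>

definition bdd_borel :: "('a::topological_space \<Rightarrow> real) \<Rightarrow> bool" where
  "bdd_borel f \<longleftrightarrow> f \<in> borel_measurable borel \<and> (\<exists>C. \<forall>x. \<bar>f x\<bar> \<le> C)"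

lemma bdd_borel_measurable [measurable_dest]: "bdd_borel f \<Longrightarrow> f \<in> borel_measurable borel"
  by (simp add: bdd_borel_def)

lemma bdd_borelI: "f \<in> borel_measurable borel \<Longrightarrow> (\<And>x. \<bar>f x\<bar> \<le> C) \<Longrightarrow> bdd_borel f"
  by (auto simp: bdd_borel_def)

lemma bdd_borel_bound:
  assumes "bdd_borel f" obtains C where "C > 0" "\<And>x. \<bar>f x\<bar> \<le> C"
  using assms unfolding bdd_borel_def by (metis abs_ge_zero le_less_trans less_add_one order_less_imp_le)

lemma bdd_borel_const [simp, intro]: "bdd_borel (\<lambda>_. c)"
  by (auto simp: bdd_borel_def)

lemma bdd_borel_add [intro]: assumes "bdd_borel f" "bdd_borel g" shows "bdd_borel (\<lambda>x. f x + g x)"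
proof -
  obtain C D where "\<And>x. \<bar>f x\<bar> \<le> C" "\<And>x. \<bar>g x\<bar> \<le> D" using assms by (auto simp: bdd_borel_def)
  then have "\<bar>f x + g x\<bar> \<le> C + D" for x by (meson abs_triangle_ineq add_mono order_trans)
  then show ?thesis using assms by (intro bdd_borelI) (auto simp: bdd_borel_def)
qed

lemma bdd_borel_mult [intro]: assumes "bdd_borel f" "bdd_borel g" shows "bdd_borel (\<lambda>x. f x * g x)"
proof -
  obtain C D where *: "\<And>x. \<bar>f x\<bar> \<le> C" "\<And>x. \<bar>g x\<bar> \<le> D" using assms by (auto simp: bdd_borel_def)
  have "\<bar>f x * g x\<bar> \<le> C * D" for x
    unfolding abs_mult using *[of x] by (intro mult_mono) auto
  then show ?thesis using assms by (intro bdd_borelI) (auto simp: bdd_borel_def)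
qed

lemma bdd_borel_diff [intro]: assumes "bdd_borel f" "bdd_borel g" shows "bdd_borel (\<lambda>x. f x - g x)"
  using bdd_borel_add[OF assms(1) bdd_borel_mult[OF bdd_borel_const[of "-1"] assms(2)]] by simp

lemma bdd_borel_divide [intro]: assumes "bdd_borel f" shows "bdd_borel (\<lambda>x. f x / c)"
  using bdd_borel_mult[OF assms bdd_borel_const[of "inverse c"]] by (simp add: divide_inverse)

lemma bdd_borel_sum [intro]: "(\<And>i. i \<in> I \<Longrightarrow> bdd_borel (f i)) \<Longrightarrow> bdd_borel (\<lambda>x. \<Sum>i\<in>I. f i x)"
  by (induction I rule: infinite_finite_induct) auto

lemma bdd_borel_prod [intro]: "(\<And>i. i \<in> I \<Longrightarrow> bdd_borel (f i)) \<Longrightarrow> bdd_borel (\<lambda>x. \<Prod>i\<in>I. f i x)"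
  by (induction I rule: infinite_finite_induct) auto

lemma bdd_borel_power [intro]: "bdd_borel f \<Longrightarrow> bdd_borel (\<lambda>x. f x ^ n)"
  by (induction n) auto

lemma bdd_borel_indicator [intro]: "A \<in> sets borel \<Longrightarrow> bdd_borel (indicator A :: _ \<Rightarrow> real)"
  by (rule bdd_borelI[where C=1]) (auto simp: indicator_def)

lemma bdd_borel_comp: assumes "bdd_borel f" "g \<in> borel_measurable borel" shows "bdd_borel (\<lambda>x. f (g x))"
  using assms by (auto simp: bdd_borel_def)

lemma bdd_borel_fst [intro]: "bdd_borel f \<Longrightarrow> bdd_borel (\<lambda>z::real\<times>real. f (fst z))"
  using bdd_borel_comp[of f fst] by (simp add: borel_measurable_continuous_onI continuous_intros)

lemma bdd_borel_snd [intro]: "bdd_borel f \<Longrightarrow> bdd_borel (\<lambda>z::real\<times>real. f (snd z))"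
  using bdd_borel_comp[of f snd] by (simp add: borel_measurable_continuous_onI continuous_intros)

lemma bdd_borel_tensor [intro]: "bdd_borel f \<Longrightarrow> bdd_borel g \<Longrightarrow> bdd_borel (\<lambda>z::real\<times>real. f (fst z) * g (snd z))"
  by (intro bdd_borel_mult bdd_borel_fst bdd_borel_snd)

lemma bdd_borel_section [intro]: assumes "bdd_borel K" shows "bdd_borel (\<lambda>y::real. K (x::real, y))"
  by (rule bdd_borel_comp[OF assms]) simp

lemma bdd_borel_section' [intro]: assumes "bdd_borel K" shows "bdd_borel (\<lambda>x::real. K (x, y::real))"
  by (rule bdd_borel_comp[OF assms]) simp

lemmas bdd_borel_intros = bdd_borel_const bdd_borel_add bdd_borel_diff bdd_borel_mult bdd_borel_divide bdd_borel_sum bdd_borel_prod bdd_borel_power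
  bdd_borel_fst bdd_borel_snd bdd_borel_indicator

lemma integrable_bdd_borel [intro, simp]: assumes "bdd_borel f" shows "integrable unif f"
proof -
  obtain C where "\<And>x. \<bar>f x\<bar> \<le> C" using assms by (auto simp: bdd_borel_def)
  then show ?thesis using assms by (intro unif.integrable_const_bound[where B=C]) (auto simp: bdd_borel_def)
qed

lemma integrable_bdd_borel2 [intro, simp]: assumes "bdd_borel f" shows "integrable unif2 f"
proof -
  obtain C where "\<And>x. \<bar>f x\<bar> \<le> C" using assms by (auto simp: bdd_borel_def)
  then show ?thesis using assms by (intro unif2.P.integrable_const_bound[where B=C]) (auto simp: bdd_borel_def)
qed

lemma integral_abs_le:
  assumes "bdd_borel f" "\<And>x. \<bar>f x\<bar> \<le> C" shows "\<bar>\<integral>x. f x \<partial>unif\<bar> \<le> C"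
proof -
  have "\<bar>\<integral>x. f x \<partial>unif\<bar> \<le> (\<integral>x. \<bar>f x\<bar> \<partial>unif)" by (rule integral_abs_bound)
  also have "\<dots> \<le> (\<integral>x. C \<partial>unif)" using assms by (intro integral_mono integrable_abs) auto
  finally show ?thesis using unif.prob_space by simp
qed

lemma bdd_borel_integral [intro]:
  fixes F :: "real \<times> real \<Rightarrow> real"
  assumes "bdd_borel F" shows "bdd_borel (\<lambda>x. \<integral>y. F (x, y) \<partial>unif)"
proof -
  obtain C where C: "\<And>x. \<bar>F x\<bar> \<le> C" using assms by (auto simp: bdd_borel_def)
  have [measurable]: "F \<in> borel_measurable (borel \<Otimes>\<^sub>M borel)" unfolding borel_prod using assms by (rule bdd_borel_measurable)
  show ?thesis
  proof (rule bdd_borelI)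
    show "(\<lambda>x. \<integral>y. F (x, y) \<partial>unif) \<in> borel_measurable borel" by measurable
    show "\<bar>\<integral>y. F (x, y) \<partial>unif\<bar> \<le> C" for x by (rule integral_abs_le) (use assms C in auto)
  qed
qed

lemma integral2_fst: assumes "bdd_borel F"
  shows "(\<integral>x. \<integral>y. F (x, y) \<partial>unif \<partial>unif) = (\<integral>z. F z \<partial>unif2)"
  by (rule unif2.integral_fst') (use assms in auto)

lemma integral2_snd: assumes "bdd_borel F"
  shows "(\<integral>y. \<integral>x. F (x, y) \<partial>unif \<partial>unif) = (\<integral>z. F z \<partial>unif2)"
  using unif2.integral_snd[of "\<lambda>x y. F (x, y)"] assms by simp

lemma integral_swap: assumes "bdd_borel F"
  shows "(\<integral>x. \<integral>y. F (x, y) \<partial>unif \<partial>unif) = (\<integral>y. \<integral>x. F (x, y) \<partial>unif \<partial>unif)"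
  using assms by (simp add: integral2_fst integral2_snd)

definition ip :: "(real \<Rightarrow> real) \<Rightarrow> (real \<Rightarrow> real) \<Rightarrow> real" where
  "ip f g = (\<integral>x. f x * g x \<partial>unif)"

definition kop :: "(real \<times> real \<Rightarrow> real) \<Rightarrow> (real \<Rightarrow> real) \<Rightarrow> real \<Rightarrow> real" where
  "kop K f x = (\<integral>y. K (x, y) * f y \<partial>unif)"

definition sym_kernel :: "(real \<times> real \<Rightarrow> real) \<Rightarrow> bool" where
  "sym_kernel K \<longleftrightarrow> (\<forall>x y. K (x, y) = K (y, x))"

lemma bdd_borel_kop [intro]: assumes "bdd_borel K" "bdd_borel f" shows "bdd_borel (kop K f)"
proof -
  have "bdd_borel (\<lambda>z. K z * f (snd z))" using assms by auto
  from bdd_borel_integral[OF this] show ?thesis by (simp add: kop_def[abs_def])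
qed

lemma ip_commute: "ip f g = ip g f"
  by (simp add: ip_def mult.commute)

lemma ip_kop: assumes "bdd_borel K" "bdd_borel f" "bdd_borel g"
  shows "ip f (kop K g) = (\<integral>z. f (fst z) * K z * g (snd z) \<partial>unif2)"
proof -
  have "(\<integral>z. f (fst z) * K z * g (snd z) \<partial>unif2) = (\<integral>x. \<integral>y. f x * K (x, y) * g y \<partial>unif \<partial>unif)"
    by (subst integral2_fst[symmetric]) (use assms in \<open>auto intro!: bdd_borel_intros\<close>)
  then show ?thesis by (simp add: ip_def kop_def mult.assoc)
qed

lemma ip_kop_sym: assumes "bdd_borel K" "sym_kernel K" "bdd_borel f" "bdd_borel g"
  shows "ip f (kop K g) = ip (kop K f) g"
proof -
  have "ip f (kop K g) = (\<integral>x. \<integral>y. f x * K (x, y) * g y \<partial>unif \<partial>unif)"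
    by (simp add: ip_def kop_def mult.assoc)
  also have "\<dots> = (\<integral>y. \<integral>x. f x * K (x, y) * g y \<partial>unif \<partial>unif)"
    using integral_swap[of "\<lambda>z. f (fst z) * K z * g (snd z)"] assms by (simp add: bdd_borel_mult bdd_borel_fst bdd_borel_snd)
  also have "\<dots> = (\<integral>y. (\<integral>x. K (y, x) * f x \<partial>unif) * g y \<partial>unif)"
    using assms(2) by (simp add: sym_kernel_def mult.commute)
  finally show ?thesis by (simp add: ip_def kop_def)
qed

lemma ip_add_left: "bdd_borel f \<Longrightarrow> bdd_borel g \<Longrightarrow> bdd_borel h \<Longrightarrow> ip (\<lambda>x. f x + g x) h = ip f h + ip g h"
  by (simp add: ip_def distrib_right bdd_borel_mult)
lemma ip_add_right: "bdd_borel f \<Longrightarrow> bdd_borel g \<Longrightarrow> bdd_borel h \<Longrightarrow> ip h (\<lambda>x. f x + g x) = ip h f + ip h g"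
  by (simp add: ip_def distrib_left bdd_borel_mult)
lemma ip_scale_left: "ip (\<lambda>x. c * f x) h = c * ip f h"
  by (simp add: ip_def mult.assoc)
lemma ip_scale_right: "ip h (\<lambda>x. c * f x) = c * ip h f"
  by (simp add: ip_def mult.left_commute)
lemma kop_add: "bdd_borel K \<Longrightarrow> bdd_borel f \<Longrightarrow> bdd_borel g \<Longrightarrow> kop K (\<lambda>x. f x + g x) = (\<lambda>x. kop K f x + kop K g x)"
  by (simp add: kop_def distrib_left bdd_borel_mult bdd_borel_section fun_eq_iff)
lemma kop_scale: "kop K (\<lambda>x. c * f x) = (\<lambda>x. c * kop K f x)"
  by (simp add: kop_def mult.left_commute fun_eq_iff)

lemmas ip_simps = ip_add_left ip_add_right ip_scale_left ip_scale_right kop_add kop_scale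

lemma ip_cong_AE:
  assumes "AE x in unif. f x = f' x" "bdd_borel f" "bdd_borel f'" "bdd_borel g" shows "ip f g = ip f' g"
  unfolding ip_def by (rule integral_cong_AE) (use assms in auto)

lemma ip_self_nonneg: "0 \<le> ip f f" by (simp add: ip_def)

lemma ip_self_zero: assumes "bdd_borel f" "ip f f = 0" shows "AE x in unif. f x = 0"
proof -
  have "AE x in unif. f x * f x = 0"
    using integral_nonneg_eq_0_iff_AE[of unif "\<lambda>x. f x * f x"] assms by (auto simp: ip_def)
  then show ?thesis by simp
qed

text \<open>Positive semidefinite symmetric kernels. Unlike doubly nonnegative kernels they may take negative values.\<close>

definition psd :: "(real \<times> real \<Rightarrow> real) \<Rightarrow> bool" where
  "psd K \<longleftrightarrow> bdd_borel K \<and> sym_kernel K \<and> (\<forall>f. bdd_borel f \<longrightarrow> 0 \<le> ip f (kop K f))"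

lemma quadratic_nonneg_discriminant:
  fixes a b c :: real
  assumes "c \<ge> 0" and nonneg: "\<And>t. 0 \<le> a + 2 * t * b + t\<^sup>2 * c"
  shows "b\<^sup>2 \<le> a * c"
proof (cases "c = 0")
  case True
  have "b = 0"
  proof (rule ccontr)
    assume "b \<noteq> 0"
    with nonneg[of "-(a+1)/(2*b)"] True show False by (simp add: field_simps)
  qed
  then show ?thesis using True by simp
next
  case False
  then have c: "c > 0" using assms(1) by simp
  have "0 \<le> a + 2 * (-b/c) * b + (-b/c)\<^sup>2 * c" by (rule nonneg)
  also have "\<dots> = a - b\<^sup>2 / c" using c by (simp add: field_simps power2_eq_square)
  finally show ?thesis using c by (simp add: field_simps)
qed

lemma psd_Cauchy_Schwarz:
  assumes "psd K" "bdd_borel f" "bdd_borel g"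
  shows "(ip f (kop K g))\<^sup>2 \<le> ip f (kop K f) * ip g (kop K g)"
proof (rule quadratic_nonneg_discriminant)
  show "0 \<le> ip g (kop K g)" using assms by (auto simp: psd_def)
  fix t :: real
  have K: "bdd_borel K" "sym_kernel K" using assms by (auto simp: psd_def)
  have "0 \<le> ip (\<lambda>x. f x + t * g x) (kop K (\<lambda>x. f x + t * g x))"
    using assms(1)[unfolded psd_def] bdd_borel_add[OF assms(2) bdd_borel_mult[OF bdd_borel_const assms(3)]] by blast
  also have "\<dots> = ip f (kop K f) + 2 * t * ip f (kop K g) + t\<^sup>2 * ip g (kop K g)"
    using assms K ip_kop_sym[OF K assms(3,2)]
    by (simp add: ip_simps bdd_borel_add bdd_borel_mult bdd_borel_kop ip_commute[of "kop K g" f] algebra_simps power2_eq_square)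
  finally show "0 \<le> \<dots>" .
qed

lemma psd_bdd_borel: "psd K \<Longrightarrow> bdd_borel K"
  and psd_nonneg: "psd K \<Longrightarrow> bdd_borel f \<Longrightarrow> 0 \<le> ip f (kop K f)"
  by (auto simp: psd_def)

section \<open>Approximating kernels by grid step functions\<close>

lemma unif2_eq_density:
  "unif2 = density lborel (indicator unit_square)"
proof -
  have "unif2 = density (lborel \<Otimes>\<^sub>M lborel) (\<lambda>(x, y). indicator {0..1::real} x * indicator {0..1::real} y)"
    unfolding unif_def
    by (rule pair_measure_density)
       (auto simp: unif_def[symmetric] lborel.sigma_finite_measure_axioms unif.sigma_finite_measure_axioms)
  also have "(\<lambda>(x, y). indicator {0..1::real} x * indicator {0..1::real} y :: ennreal) = indicator unit_square"
    by (auto simp: fun_eq_iff indicator_def)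
  finally show ?thesis by (simp add: lborel_prod)
qed

lemma AE_unif_iff: "(AE x in unif. P x) \<longleftrightarrow> (AE x in lborel. x \<in> {0..1} \<longrightarrow> P x)"
  unfolding unif_def by (subst AE_density) (auto simp: indicator_def)

lemma AE_unif2_iff: "(AE z in unif2. P z) \<longleftrightarrow> (AE z in lborel. z \<in> unit_square \<longrightarrow> P z)"
  unfolding unif2_eq_density
  by (subst AE_density) (auto simp: indicator_def intro!: borel_measurable_indicator borel_closed closed_Times)

lemma AE_unif_in: "AE x in unif. x \<in> {0..1}"
  by (simp add: AE_unif_iff)

lemma AE_unif2_in: "AE z in unif2. z \<in> unit_square"
  by (simp add: AE_unif2_iff)

text \<open>A measurable function is an almost everywhere limit of continuous functions; clipping them at the bound of
\<open>K\<close> makes dominated convergence applicable.\<close>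

lemma continuous_approx:
  fixes K :: "real \<times> real \<Rightarrow> real"
  assumes "bdd_borel K" "\<And>z. \<bar>K z\<bar> \<le> C" "\<delta> > 0"
  obtains g where "continuous_on UNIV g" "\<And>z. \<bar>g z\<bar> \<le> C" "(\<integral>z. \<bar>K z - g z\<bar> \<partial>unif2) < \<delta>"
proof -
  have "K \<in> borel_measurable lebesgue"
    by (rule measurable_completion) (use assms(1) in \<open>simp add: bdd_borel_def\<close>)
  then have "K \<in> borel_measurable (lebesgue_on UNIV)"
    by (simp add: lebesgue_on_UNIV_eq)
  then have "K measurable_on UNIV"
    by (subst measurable_on_iff_borel_measurable) auto
  then obtain N g where N: "negligible N" and cont: "\<And>n. continuous_on UNIV (g n)"
    and lim: "\<And>x. x \<notin> N \<Longrightarrow> (\<lambda>n. g n x) \<longlonglongrightarrow> K x"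
    by (auto simp: measurable_on_def)
  \<comment> \<open>clipped at the bound of \<open>K\<close>, so that \<open>2 * C\<close> is an integrable majorant of the differences\<close>
  define h where "h = (\<lambda>n z. max (-C) (min C (g n z)))"
  have C0: "C \<ge> 0" using assms(2)[of undefined] by linarith
  have hC: "\<bar>h n z\<bar> \<le> C" for n z using C0 by (auto simp: h_def)
  have hcont: "continuous_on UNIV (h n)" for n
    unfolding h_def by (intro continuous_intros cont)
  have [measurable]: "h n \<in> borel_measurable borel" for n
    by (rule borel_measurable_continuous_onI[OF hcont])
  have [measurable]: "K \<in> borel_measurable borel" using assms(1) by (rule bdd_borel_measurable)
  have hlim: "(\<lambda>n. h n z) \<longlonglongrightarrow> K z" if "z \<notin> N" for z
  proof -
    have "(\<lambda>n. h n z) \<longlonglongrightarrow> max (-C) (min C (K z))"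
      unfolding h_def by (intro tendsto_intros lim that)
    moreover have "max (-C) (min C (K z)) = K z" using assms(2)[of z] by auto
    ultimately show ?thesis by simp
  qed
  have "N \<in> null_sets lebesgue" using N by (simp add: negligible_iff_null_sets)
  then have "AE z in lebesgue. z \<notin> N" by (rule AE_not_in)
  then have "AE z in lborel. z \<notin> N" by (simp add: AE_completion_iff)
  then have "AE z in unif2. z \<notin> N"
    unfolding AE_unif2_iff by eventually_elim auto
  then have AE: "AE z in unif2. (\<lambda>n. \<bar>K z - h n z\<bar>) \<longlonglongrightarrow> 0"
  proof eventually_elim
    case (elim z)
    have "(\<lambda>n. \<bar>K z - h n z\<bar>) \<longlonglongrightarrow> \<bar>K z - K z\<bar>" by (intro tendsto_intros hlim elim)
    then show ?case by simp
  qed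
  have "(\<lambda>n. \<integral>z. \<bar>K z - h n z\<bar> \<partial>unif2) \<longlonglongrightarrow> (\<integral>z. 0 \<partial>unif2)"
  proof (rule integral_dominated_convergence[where w="\<lambda>_. 2 * C"])
    show "AE z in unif2. norm \<bar>K z - h n z\<bar> \<le> 2 * C" for n
    proof (rule AE_I2)
      fix z show "norm \<bar>K z - h n z\<bar> \<le> 2 * C" using assms(2)[of z] hC[of n z] by simp
    qed
  qed (use AE in auto)
  then have "eventually (\<lambda>n. (\<integral>z. \<bar>K z - h n z\<bar> \<partial>unif2) < \<delta>) sequentially"
    using assms(3) by (intro order_tendstoD) auto
  then obtain n where "(\<integral>z. \<bar>K z - h n z\<bar> \<partial>unif2) < \<delta>"
    by (auto simp: eventually_sequentially)
  with that[OF hcont hC] show ?thesis by blast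
qed

text \<open>The interval \<open>[0, 1]\<close> is cut into the \<open>N\<close> half-open cells of length \<open>1 / N\<close>; the point \<open>1\<close> forms a null cell with index
\<open>N\<close>.\<close>

definition cell :: "nat \<Rightarrow> real \<Rightarrow> int" where
  "cell N x = \<lfloor>real N * x\<rfloor>"

lemma cell_measurable [measurable]: "cell N \<in> borel \<rightarrow>\<^sub>M count_space UNIV"
  unfolding cell_def[abs_def] by measurable

lemma cell_in: "x \<in> {0..1} \<Longrightarrow> cell N x \<in> {0..int N}"
  using mult_left_le[of x "real N"] unfolding cell_def by (auto simp: floor_le_iff)

lemma cell_near: assumes "N > 0" shows "\<bar>x - real_of_int (cell N x) / real N\<bar> \<le> 1 / real N"
proof -
  have "real_of_int (cell N x) \<le> real N * x" "real N * x \<le> real_of_int (cell N x) + 1"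
    unfolding cell_def by linarith+
  then have "\<bar>real N * x - real_of_int (cell N x)\<bar> / real N \<le> 1 / real N"
    by (intro divide_right_mono) auto
  also have "\<bar>real N * x - real_of_int (cell N x)\<bar> / real N = \<bar>(real N * x - real_of_int (cell N x)) / real N\<bar>"
    using assms by simp
  also have "(real N * x - real_of_int (cell N x)) / real N = x - real_of_int (cell N x) / real N"
    using assms by (simp add: field_simps)
  finally show ?thesis .
qed

text \<open>Uniform continuity on the square lets a continuous approximant be replaced by its values at the corners of
small cells.\<close>

lemma step_approx:
  fixes K :: "real \<times> real \<Rightarrow> real"
  assumes "bdd_borel K" "\<And>z. \<bar>K z\<bar> \<le> C" "\<delta> > 0"
  obtains N c where "N > 0" "\<And>i j. \<bar>c i j\<bar> \<le> C"
    "(\<integral>z. \<bar>K z - c (cell N (fst z)) (cell N (snd z))\<bar> \<partial>unif2) < \<delta>"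
proof -
  obtain g where g: "continuous_on UNIV g" "\<And>z. \<bar>g z\<bar> \<le> C"
      and gK: "(\<integral>z. \<bar>K z - g z\<bar> \<partial>unif2) < \<delta> / 2"
    using continuous_approx[OF assms(1,2), of "\<delta>/2"] assms(3) by (metis half_gt_zero)
  have "uniformly_continuous_on unit_square g"
    using g(1) by (intro compact_uniformly_continuous compact_Times) (auto intro: continuous_on_subset)
  then obtain d where d: "d > 0" "\<And>z z'. z \<in> unit_square \<Longrightarrow> z' \<in> unit_square \<Longrightarrow> dist z' z < d \<Longrightarrow> dist (g z') (g z) < \<delta>/2"
    unfolding uniformly_continuous_on_def using assms(3) by (metis half_gt_zero)
  obtain N :: nat where N: "real N > 2 / d" using reals_Archimedean2 by blast
  then have N0: "N > 0" using d(1) by (metis divide_pos_pos gr0I less_numeral_extra(1) not_less_iff_gr_or_eq of_nat_0 order_less_trans zero_less_numeral)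
  define c where "c = (\<lambda>i j. g (real_of_int i / real N, real_of_int j / real N))"
  have near: "dist (c (cell N (fst z)) (cell N (snd z))) (g z) < \<delta>/2" if "z \<in> unit_square" for z
  proof -
    obtain x y where z: "z = (x, y)" by force
    with that have xy: "x \<in> {0..1}" "y \<in> {0..1}" by auto
    let ?x = "real_of_int (cell N x) / real N" and ?y = "real_of_int (cell N y) / real N"
    have "?x \<in> {0..1}" "?y \<in> {0..1}" using cell_in[OF xy(1), of N] cell_in[OF xy(2), of N] N0
      by (auto simp: divide_le_eq_1)
    moreover have "dist (?x, ?y) (x, y) < d"
    proof -
      have "dist (?x, ?y) (x, y) \<le> \<bar>?x - x\<bar> + \<bar>?y - y\<bar>"
        unfolding dist_Pair_Pair dist_real_def by (rule order_trans[OF sqrt_sum_squares_le_sum_abs]) simp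
      also have "\<dots> \<le> 2 / real N" using cell_near[OF N0, of x] cell_near[OF N0, of y] by (simp add: abs_minus_commute)
      also have "\<dots> < d" using N N0 d(1) by (simp add: field_simps)
      finally show ?thesis .
    qed
    ultimately show ?thesis using d(2)[of z "(?x, ?y)"] that z by (simp add: c_def)
  qed
  have [measurable]: "K \<in> borel_measurable borel" using assms(1) by (rule bdd_borel_measurable)
  have [measurable]: "g \<in> borel_measurable borel" by (rule borel_measurable_continuous_onI[OF g(1)])
  have bmg: "bdd_borel g" using g(2) by (intro bdd_borelI) auto
  let ?h = "\<lambda>z::real\<times>real. c (cell N (fst z)) (cell N (snd z))"
  have [measurable]: "?h \<in> borel_measurable borel"
    unfolding borel_prod[symmetric] by measurable
  have hC: "\<bar>c i j\<bar> \<le> C" for i j using g(2) by (simp add: c_def)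
  have bmh: "bdd_borel ?h" using hC by (intro bdd_borelI) auto
  have "AE z in unif2. \<bar>K z - ?h z\<bar> \<le> \<bar>K z - g z\<bar> + \<delta>/2"
    using AE_unif2_in
  proof eventually_elim
    case (elim z)
    show ?case using near[OF elim] unfolding dist_real_def by linarith
  qed
  then have "(\<integral>z. \<bar>K z - ?h z\<bar> \<partial>unif2) \<le> (\<integral>z. \<bar>K z - g z\<bar> + \<delta>/2 \<partial>unif2)"
    by (intro integral_mono_AE Bochner_Integration.integrable_add integrable_abs integrable_bdd_borel2 bdd_borel_intros assms(1) bmh bmg)
  also have "\<dots> = (\<integral>z. \<bar>K z - g z\<bar> \<partial>unif2) + \<delta>/2"
    using bdd_borel_diff[OF assms(1) bmg] unif2.P.prob_space by (subst Bochner_Integration.integral_add) (auto intro!: integrable_abs)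
  also have "\<dots> < \<delta>" using gK by simp
  finally show ?thesis using that[OF N0, of c] hC by blast
qed

abbreviation cell_ind :: "nat \<Rightarrow> int \<Rightarrow> real \<Rightarrow> real" where
  "cell_ind N i x \<equiv> indicator (cell N -` {i}) x"

abbreviation cell_pair :: "nat \<Rightarrow> int \<Rightarrow> int \<Rightarrow> real \<times> real \<Rightarrow> real" where
  "cell_pair N i j z \<equiv> cell_ind N i (fst z) * cell_ind N j (snd z)"

lemma cell_sets [measurable]: "cell N -` {i} \<in> sets borel"
  using measurable_sets_borel[OF cell_measurable] by auto

lemma bdd_borel_cell_ind [intro]: "bdd_borel (cell_ind N i)" by (rule bdd_borel_indicator) simp

lemma cell_ind_sum: "x \<in> {0..1} \<Longrightarrow> (\<Sum>i\<in>{0..int N}. c i * cell_ind N i x) = c (cell N x)"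
  using cell_in[of x N] by (subst sum.remove[of _ "cell N x"]) (auto intro!: sum.neutral)

lemma integral_step:
  assumes "bdd_borel G"
  shows "(\<integral>z. G z * c (cell N (fst z)) (cell N (snd z)) \<partial>unif2) =
    (\<Sum>i\<in>{0..int N}. \<Sum>j\<in>{0..int N}. c i j * (\<integral>z. G z * cell_pair N i j z \<partial>unif2))"
proof -
  have [measurable]: "G \<in> borel_measurable borel" using assms by (rule bdd_borel_measurable)
  have [measurable]: "(\<lambda>z::real\<times>real. c (cell N (fst z)) (cell N (snd z))) \<in> borel_measurable borel"
    unfolding borel_prod[symmetric] by measurable
  have algebra: "(\<Sum>i\<in>I. \<Sum>j\<in>J. c i j * (g * (a i * b j))) = g * (\<Sum>i\<in>I. (\<Sum>j\<in>J. c i j * b j) * a i)"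
    for I J :: "int set" and a b :: "int \<Rightarrow> real" and g :: real
    by (simp add: sum_distrib_left sum_distrib_right mult_ac)
  have "(\<integral>z. G z * c (cell N (fst z)) (cell N (snd z)) \<partial>unif2) =
    (\<integral>z. (\<Sum>i\<in>{0..int N}. \<Sum>j\<in>{0..int N}. c i j * (G z * cell_pair N i j z)) \<partial>unif2)"
  proof (rule integral_cong_AE)
    show "AE z in unif2. G z * c (cell N (fst z)) (cell N (snd z)) =
       (\<Sum>i\<in>{0..int N}. \<Sum>j\<in>{0..int N}. c i j * (G z * cell_pair N i j z))"
      using AE_unif2_in
    proof eventually_elim
      case (elim z)
      then have *: "fst z \<in> {0..1}" "snd z \<in> {0..1}" by auto
      have "(\<Sum>i\<in>{0..int N}. \<Sum>j\<in>{0..int N}. c i j * (G z * cell_pair N i j z))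
         = G z * (\<Sum>i\<in>{0..int N}. (\<Sum>j\<in>{0..int N}. c i j * cell_ind N j (snd z)) * cell_ind N i (fst z))"
        by (rule algebra)
      also have "\<dots> = G z * c (cell N (fst z)) (cell N (snd z))"
        unfolding cell_ind_sum[OF *(2)] using cell_ind_sum[OF *(1), of "\<lambda>i. c i (cell N (snd z))"] by simp
      finally show ?case by simp
    qed
    show "(\<lambda>z. \<Sum>i\<in>{0..int N}. \<Sum>j\<in>{0..int N}. c i j * (G z * cell_pair N i j z))
        \<in> borel_measurable unif2"
    proof -
      have "bdd_borel (\<lambda>z. \<Sum>i\<in>{0..int N}. \<Sum>j\<in>{0..int N}. c i j * (G z * cell_pair N i j z))"
        by (intro bdd_borel_intros assms cell_sets)
      from bdd_borel_measurable[OF this] show ?thesis by simp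
    qed
  qed auto
  also have "\<dots> = (\<Sum>i\<in>{0..int N}. \<Sum>j\<in>{0..int N}. c i j * (\<integral>z. G z * cell_pair N i j z \<partial>unif2))"
  proof -
    have i: "integrable unif2 (\<lambda>z. c i j * (G z * cell_pair N i j z))" for i j
      by (intro integrable_bdd_borel2 bdd_borel_intros assms cell_sets)
    show ?thesis
      by (subst Bochner_Integration.integral_sum, intro Bochner_Integration.integrable_sum i,
          subst Bochner_Integration.integral_sum, rule i, simp only: integral_mult_right_zero)
  qed
  finally show ?thesis .
qed

lemma integral_bdd_borel2_mult_bound:
  assumes "bdd_borel G" "\<And>z. \<bar>G z\<bar> \<le> D" "bdd_borel (K :: real \<times> real \<Rightarrow> real)"
  shows "\<bar>\<integral>z. G z * K z \<partial>unif2\<bar> \<le> D * (\<integral>z. \<bar>K z\<bar> \<partial>unif2)"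
proof -
  have "\<bar>\<integral>z. G z * K z \<partial>unif2\<bar> \<le> (\<integral>z. \<bar>G z * K z\<bar> \<partial>unif2)"
    by (rule integral_abs_bound)
  also have "\<dots> \<le> (\<integral>z. D * \<bar>K z\<bar> \<partial>unif2)"
  proof (rule integral_mono)
    show "integrable unif2 (\<lambda>z. \<bar>G z * K z\<bar>)" "integrable unif2 (\<lambda>z. D * \<bar>K z\<bar>)"
      using bdd_borel_mult[OF assms(1,3)] assms(3) by (auto intro!: integrable_abs)
    show "\<bar>G z * K z\<bar> \<le> D * \<bar>K z\<bar>" for z
      using assms(2)[of z] by (simp add: abs_mult mult_right_mono)
  qed
  finally show ?thesis by simp
qed

definition same_cell_masses :: "nat \<Rightarrow> (real \<times> real \<Rightarrow> real) \<Rightarrow> (real \<times> real \<Rightarrow> real) \<Rightarrow> bool" where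
  "same_cell_masses N G G' \<longleftrightarrow> (\<forall>i j.
     (\<integral>z. G z * cell_pair N i j z \<partial>unif2)
     = (\<integral>z. G' z * cell_pair N i j z \<partial>unif2))"

text \<open>On a fine grid, integrals against \<open>K\<close> see only the masses that a bounded test function gives to the cells. This is
the form in which step functions are used: a test function may be replaced by any other one with the same cell masses.\<close>

lemma cell_test:
  fixes K :: "real \<times> real \<Rightarrow> real"
  assumes "bdd_borel K" "\<delta> > 0" "D \<ge> 0"
  obtains N where "N > 0"
    "\<And>G G'. bdd_borel G \<Longrightarrow> bdd_borel G' \<Longrightarrow> (\<And>z. \<bar>G z\<bar> \<le> D) \<Longrightarrow> (\<And>z. \<bar>G' z\<bar> \<le> D) \<Longrightarrow>
      same_cell_masses N G G' \<Longrightarrow>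
      \<bar>(\<integral>z. G z * K z \<partial>unif2) - (\<integral>z. G' z * K z \<partial>unif2)\<bar> \<le> \<delta>"
proof -
  obtain C where C: "\<And>x. \<bar>K x\<bar> \<le> C" using assms(1) by (auto simp: bdd_borel_def)
  have e0: "\<delta> / (2 * D + 1) > 0" using assms by simp
  obtain N c where N: "N > 0" and c: "\<And>i j. \<bar>c i j\<bar> \<le> C"
    and close: "(\<integral>z. \<bar>K z - c (cell N (fst z)) (cell N (snd z))\<bar> \<partial>unif2) < \<delta> / (2 * D + 1)" (is "?I < _")
    by (rule step_approx[OF assms(1) C e0], rule that)
  let ?h = "\<lambda>z::real\<times>real. c (cell N (fst z)) (cell N (snd z))"
  have "?h \<in> borel_measurable borel"
    unfolding borel_prod[symmetric] by measurable
  then have bmh: "bdd_borel ?h" using c by (intro bdd_borelI) auto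
  show ?thesis
  proof (rule that[OF N])
    fix G G' assume G: "bdd_borel G" "bdd_borel G'" "\<And>z. \<bar>G z\<bar> \<le> D" "\<And>z. \<bar>G' z\<bar> \<le> D"
      and same: "same_cell_masses N G G'"
    have eq: "(\<integral>z. G z * cell_pair N i j z \<partial>unif2)
           = (\<integral>z. G' z * cell_pair N i j z \<partial>unif2)" for i j
      using same unfolding same_cell_masses_def by blast
    have h: "(\<integral>z. G z * ?h z \<partial>unif2) = (\<integral>z. G' z * ?h z \<partial>unif2)"
      unfolding integral_step[OF G(1)] integral_step[OF G(2)] eq ..
    have *: "\<bar>(\<integral>z. F z * K z \<partial>unif2) - (\<integral>z. F z * ?h z \<partial>unif2)\<bar> \<le> D * ?I"
      if "bdd_borel F" "\<And>z. \<bar>F z\<bar> \<le> D" for F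
    proof -
      have "(\<integral>z. F z * K z \<partial>unif2) - (\<integral>z. F z * ?h z \<partial>unif2) = (\<integral>z. F z * (K z - ?h z) \<partial>unif2)"
        using bdd_borel_mult[OF that(1) assms(1)] bdd_borel_mult[OF that(1) bmh]
        by (simp add: right_diff_distrib)
      then show ?thesis using integral_bdd_borel2_mult_bound[OF that bdd_borel_diff[OF assms(1) bmh]] by simp
    qed
    have I0: "?I \<ge> 0" by simp
    have "\<bar>(\<integral>z. G z * K z \<partial>unif2) - (\<integral>z. G' z * K z \<partial>unif2)\<bar> \<le> 2 * D * ?I"
      using *[OF G(1,3)] *[OF G(2,4)] h by linarith
    also have "\<dots> \<le> (2 * D + 1) * ?I" using I0 by (simp add: distrib_right)
    also have "\<dots> \<le> \<delta>" using close assms(3) by (simp add: field_simps)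
    finally show "\<bar>(\<integral>z. G z * K z \<partial>unif2) - (\<integral>z. G' z * K z \<partial>unif2)\<bar> \<le> \<delta>" .
  qed
qed

section \<open>The Schur product theorem for kernels\<close>

lemma quadratic_form_insert:
  fixes b :: "'i \<Rightarrow> 'i \<Rightarrow> real"
  assumes "finite I" "k \<notin> I" "\<And>i. i \<in> I \<Longrightarrow> b i k = b k i"
  shows "(\<Sum>i\<in>insert k I. \<Sum>j\<in>insert k I. u i * u j * b i j)
    = (u k)\<^sup>2 * b k k + 2 * u k * (\<Sum>i\<in>I. u i * b i k) + (\<Sum>i\<in>I. \<Sum>j\<in>I. u i * u j * b i j)"
proof -
  have "(\<Sum>j\<in>I. u k * u j * b k j) = u k * (\<Sum>i\<in>I. u i * b i k)"
    using assms(3) by (simp add: sum_distrib_left mult_ac)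
  moreover have "(\<Sum>i\<in>I. u i * u k * b i k) = u k * (\<Sum>i\<in>I. u i * b i k)"
    by (simp add: sum_distrib_left mult_ac)
  ultimately show ?thesis using assms(1,2) by (simp add: sum.distrib power2_eq_square)
qed

text \<open>Gaussian elimination instead of a spectral decomposition: \<open>b\<close> is the sum of a positive semidefinite rank-one
matrix, built from its column \<open>k\<close>, and the Schur complement, which vanishes in row and column \<open>k\<close>.\<close>

lemma Schur_product_matrix:
  fixes a b :: "'i \<Rightarrow> 'i \<Rightarrow> real"
  assumes "finite I"
    and "\<And>u. 0 \<le> (\<Sum>i\<in>I. \<Sum>j\<in>I. u i * u j * a i j)"
    and "\<And>u. 0 \<le> (\<Sum>i\<in>I. \<Sum>j\<in>I. u i * u j * b i j)"
    and "\<And>i j. b i j = b j i"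
  shows "0 \<le> (\<Sum>i\<in>I. \<Sum>j\<in>I. a i j * b i j)"
  using assms
proof (induction I arbitrary: b rule: finite_induct)
  case empty
  then show ?case by simp
next
  case (insert k I b)
  note ins = quadratic_form_insert[OF insert.hyps(1,2), of b, OF insert.prems(3)]
  \<comment> \<open>The Schur complement. If \<open>b k k = 0\<close>, the quotient is \<open>0\<close>, and the whole row \<open>k\<close> vanishes by \<open>zero\<close> below.\<close>
  define b' where "b' = (\<lambda>i j. b i j - b i k * b j k / b k k)"
  have zero: "b i k = 0" if "b k k = 0" "i \<in> I" for i
  proof -
    have ik: "i \<noteq> k" using that insert.hyps by auto
    have "(b i k)\<^sup>2 \<le> b i i * b k k"
    proof (rule quadratic_nonneg_discriminant)
      show "b k k \<ge> 0" using that(1) by simp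
      fix t :: real
      let ?u = "\<lambda>j. (if j = i then 1 else 0) + (if j = k then t else 0)"
      have 1: "(\<Sum>j\<in>I. ?u j * g j) = g i" for g :: "'i \<Rightarrow> real"
        using that(2) insert.hyps by (simp add: distrib_right sum.distrib if_distrib[of "\<lambda>x. x * _"] cong: if_cong)
      have "(\<Sum>i\<in>I. \<Sum>j\<in>I. ?u i * ?u j * b i j) = (\<Sum>i\<in>I. ?u i * (\<Sum>j\<in>I. ?u j * b i j))"
        by (simp only: sum_distrib_left mult.assoc)
      also have "\<dots> = b i i" unfolding 1 ..
      finally show "0 \<le> b i i + 2 * t * b i k + t\<^sup>2 * b k k"
        using insert.prems(2)[of ?u] ik unfolding ins 1 by simp
    qed
    then show ?thesis using that(1) by simp
  qed
  have split: "b i j = b i k * b j k / b k k + b' i j" for i j by (simp add: b'_def)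
  have b'0: "b' k j = 0" "b' j k = 0" if "j \<in> insert k I" for j
    using zero[of j] insert.prems(3)[of j k] that by (auto simp: b'_def)
  have IH: "0 \<le> (\<Sum>i\<in>I. \<Sum>j\<in>I. a i j * b' i j)"
  proof (rule insert.IH)
    fix u :: "'i \<Rightarrow> real"
    have "(\<Sum>i\<in>insert k I. \<Sum>j\<in>insert k I. (u(k:=0)) i * (u(k:=0)) j * a i j)
        = (\<Sum>i\<in>I. \<Sum>j\<in>I. u i * u j * a i j)"
      using insert.hyps by (auto intro!: sum.cong)
    then show "0 \<le> (\<Sum>i\<in>I. \<Sum>j\<in>I. u i * u j * a i j)"
      using insert.prems(1)[of "u(k:=0)"] by simp
  next
    fix u :: "'i \<Rightarrow> real"
    define S where "S = (\<Sum>i\<in>I. u i * b i k)"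
    \<comment> \<open>the value at \<open>k\<close> that minimises the form of \<open>b\<close>; the minimum is the form of \<open>b'\<close> at \<open>u\<close>\<close>
    define v where "v = u(k := - S / b k k)"
    have v: "(\<Sum>i\<in>I. v i * b i k) = S" "(\<Sum>i\<in>I. \<Sum>j\<in>I. v i * v j * b i j) = (\<Sum>i\<in>I. \<Sum>j\<in>I. u i * u j * b i j)"
      using insert.hyps by (auto simp: S_def v_def intro!: sum.cong)
    have "S\<^sup>2 / b k k = (\<Sum>i\<in>I. \<Sum>j\<in>I. u i * u j * (b i k * b j k / b k k))"
      by (simp add: S_def power2_eq_square sum_product sum_divide_distrib mult_ac)
    then have "(\<Sum>i\<in>I. \<Sum>j\<in>I. u i * u j * b' i j) = (\<Sum>i\<in>I. \<Sum>j\<in>I. u i * u j * b i j) - S\<^sup>2 / b k k"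
      by (simp add: b'_def right_diff_distrib sum_subtractf)
    also have "\<dots> = (\<Sum>i\<in>insert k I. \<Sum>j\<in>insert k I. v i * v j * b i j)"
      unfolding ins v by (cases "b k k = 0") (auto simp: v_def power2_eq_square field_simps)
    finally show "0 \<le> (\<Sum>i\<in>I. \<Sum>j\<in>I. u i * u j * b' i j)" using insert.prems(2)[of v] by simp
  next
    show "b' i j = b' j i" for i j using insert.prems(3)[of i j] by (simp add: b'_def mult.commute)
  qed
  have bkk: "0 \<le> b k k"
  proof -
    let ?u = "\<lambda>i. if i = k then 1 else 0 :: real"
    have "(\<Sum>i\<in>I. ?u i * b i k) = 0" "(\<Sum>i\<in>I. \<Sum>j\<in>I. ?u i * ?u j * b i j) = 0"
      using insert.hyps by (auto intro!: sum.neutral)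
    then show ?thesis using insert.prems(2)[of ?u] unfolding ins by simp
  qed
  have "(\<Sum>i\<in>insert k I. \<Sum>j\<in>insert k I. a i j * b i j)
      = (\<Sum>i\<in>insert k I. \<Sum>j\<in>insert k I. b i k * b j k * a i j) / b k k + (\<Sum>i\<in>insert k I. \<Sum>j\<in>insert k I. a i j * b' i j)"
    by (subst split) (simp only: distrib_left sum.distrib sum_divide_distrib times_divide_eq_right mult_ac)
  also have "(\<Sum>i\<in>insert k I. \<Sum>j\<in>insert k I. a i j * b' i j) = (\<Sum>i\<in>I. \<Sum>j\<in>I. a i j * b' i j)"
    using insert.hyps b'0 by simp
  finally show ?case using IH bkk insert.prems(1)[of "\<lambda>i. b i k"] by simp
qed

lemma integral_tensor:
  assumes "bdd_borel f" "bdd_borel g"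
  shows "(\<integral>z. f (fst z) * g (snd z) \<partial>unif2) = (\<integral>x. f x \<partial>unif) * (\<integral>x. g x \<partial>unif)"
  by (subst integral2_fst[symmetric]) (use assms in auto)

text \<open>The matrix of cell masses of a positive semidefinite kernel, weighted by \<open>f\<close>, is positive semidefinite, because
a combination of cell indicators is again a test function.\<close>

lemma psd_cell_form_nonneg:
  assumes "psd A" "bdd_borel f"
  shows "0 \<le> (\<Sum>i\<in>{0..int N}. \<Sum>j\<in>{0..int N}. u i * u j *
     (\<integral>z. (f (fst z) * A z * f (snd z)) * cell_pair N i j z \<partial>unif2))"
proof -
  define h where "h = (\<lambda>x. f x * (if cell N x \<in> {0..int N} then u (cell N x) else 0))"
  have [measurable]: "f \<in> borel_measurable borel" using assms(2) by (rule bdd_borel_measurable)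
  have [measurable]: "(\<lambda>x. if cell N x \<in> {0..int N} then u (cell N x) else 0) \<in> borel_measurable borel"
    by (rule measurable_compose[OF cell_measurable, where g="\<lambda>i. if i \<in> {0..int N} then u i else 0"]) simp
  have "bdd_borel h"
  proof -
    obtain C where C: "\<And>x. \<bar>f x\<bar> \<le> C" using assms(2) by (auto simp: bdd_borel_def)
    have "\<bar>h x\<bar> \<le> C * (\<Sum>i\<in>{0..int N}. \<bar>u i\<bar>)" for x
    proof (cases "cell N x \<in> {0..int N}")
      case True
      then have "\<bar>u (cell N x)\<bar> \<le> (\<Sum>i\<in>{0..int N}. \<bar>u i\<bar>)" by (intro member_le_sum) auto
      then show ?thesis using C[of x] by (simp add: h_def abs_mult mult_mono)
    next
      case False
      have "C \<ge> 0" using C[of 0] by linarith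
      then show ?thesis using False by (auto simp: h_def intro!: mult_nonneg_nonneg sum_nonneg)
    qed
    moreover have "h \<in> borel_measurable borel" unfolding h_def by measurable
    ultimately show ?thesis by (intro bdd_borelI) auto
  qed
  then have "0 \<le> ip h (kop A h)" using assms(1) by (simp add: psd_def)
  also have "\<dots> = (\<integral>z. h (fst z) * A z * h (snd z) \<partial>unif2)"
    by (rule ip_kop) (use assms \<open>bdd_borel h\<close> in \<open>auto simp: psd_def\<close>)
  also have "\<dots> = (\<integral>z. (f (fst z) * A z * f (snd z)) * (u (cell N (fst z)) * u (cell N (snd z))) \<partial>unif2)"
  proof (rule integral_cong_AE)
    have "bdd_borel (\<lambda>z. h (fst z) * A z * h (snd z))" using psd_bdd_borel[OF assms(1)] \<open>bdd_borel h\<close> by (intro bdd_borel_intros)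
    from bdd_borel_measurable[OF this] show "(\<lambda>z. h (fst z) * A z * h (snd z)) \<in> borel_measurable unif2" by simp
    have [measurable]: "A \<in> borel_measurable (borel \<Otimes>\<^sub>M borel)" using bdd_borel_measurable[OF psd_bdd_borel[OF assms(1)]] by (simp add: borel_prod)
    show "(\<lambda>z. (f (fst z) * A z * f (snd z)) * (u (cell N (fst z)) * u (cell N (snd z)))) \<in> borel_measurable unif2"
    proof -
      have "(\<lambda>z. (f (fst z) * A z * f (snd z)) * (u (cell N (fst z)) * u (cell N (snd z)))) \<in> borel_measurable (borel \<Otimes>\<^sub>M borel)"
        by measurable
      then show ?thesis unfolding borel_prod by simp
    qed
    show "AE z in unif2. h (fst z) * A z * h (snd z) = (f (fst z) * A z * f (snd z)) * (u (cell N (fst z)) * u (cell N (snd z)))"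
      using AE_unif2_in
    proof eventually_elim
      case (elim z)
      then have "cell N (fst z) \<in> {0..int N}" "cell N (snd z) \<in> {0..int N}" by (auto intro!: cell_in simp del: atLeastAtMost_iff)
      then show ?case by (simp add: h_def)
    qed
  qed
  also have "\<dots> = (\<Sum>i\<in>{0..int N}. \<Sum>j\<in>{0..int N}. u i * u j *
     (\<integral>z. (f (fst z) * A z * f (snd z)) * cell_pair N i j z \<partial>unif2))"
    by (rule integral_step[where c="\<lambda>i j. u i * u j"]) (intro bdd_borel_intros assms psd_bdd_borel)
  finally show ?thesis .
qed

text \<open>The form of \<open>A B\<close> at \<open>f\<close> is the integral of \<open>G B\<close> with \<open>G(x, y) = f(x) A(x, y) f(y)\<close>. Averaging \<open>G\<close> over the cells of a
fine grid changes this integral by little and turns it into the Schur product form of two positive semidefinite matrices.\<close>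

lemma psd_mult:
  assumes "psd A" "psd B" shows "psd (\<lambda>z. A z * B z)"
  unfolding psd_def
proof (intro conjI allI impI)
  have bdd_borel: "bdd_borel A" "bdd_borel B" and sym: "sym_kernel A" "sym_kernel B" using assms by (auto simp: psd_def)
  show bmAB: "bdd_borel (\<lambda>z. A z * B z)" using bdd_borel by (rule bdd_borel_mult)
  show "sym_kernel (\<lambda>z. A z * B z)" using sym by (simp add: sym_kernel_def)
  fix f :: "real \<Rightarrow> real" assume f: "bdd_borel f"
  define G where "G = (\<lambda>z. f (fst z) * A z * f (snd z))"
  have bmG: "bdd_borel G" unfolding G_def using bdd_borel f by (intro bdd_borel_intros)
  have eq: "ip f (kop (\<lambda>z. A z * B z) f) = (\<integral>z. G z * B z \<partial>unif2)"
    unfolding ip_kop[OF bmAB f f] G_def by (simp add: mult_ac)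
  obtain D where D: "D > 0" "\<And>z. \<bar>G z\<bar> \<le> D" by (rule bdd_borel_bound[OF bmG], rule that)
  show "0 \<le> ip f (kop (\<lambda>z. A z * B z) f)"
  proof (rule field_le_epsilon)
    fix \<delta> :: real assume "\<delta> > 0"
    obtain N where N: "N > 0" and test:
    "\<And>G G'. bdd_borel G \<Longrightarrow> bdd_borel G' \<Longrightarrow> (\<And>z. \<bar>G z\<bar> \<le> D) \<Longrightarrow> (\<And>z. \<bar>G' z\<bar> \<le> D) \<Longrightarrow>
      same_cell_masses N G G' \<Longrightarrow>
      \<bar>(\<integral>z. G z * B z \<partial>unif2) - (\<integral>z. G' z * B z \<partial>unif2)\<bar> \<le> \<delta>"
      by (rule cell_test[OF bdd_borel(2) \<open>\<delta> > 0\<close>, of D]) (use D in auto)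
    define m where "m = (\<lambda>i. \<integral>x. cell_ind N i x \<partial>unif)"
    define \<alpha> where "\<alpha> = (\<lambda>i j. \<integral>z. G z * cell_pair N i j z \<partial>unif2)"
    \<comment> \<open>The averages of \<open>G\<close> over the cells; on a null cell both \<open>\<alpha> i j\<close> and this quotient are \<open>0\<close>.\<close>
    define a where "a = (\<lambda>i j. \<alpha> i j / (m i * m j))"
    define G' where "G' = (\<lambda>z::real\<times>real. a (cell N (fst z)) (cell N (snd z)))"
    have bmc: "bdd_borel (\<lambda>z::real\<times>real. cell_pair N i j z)" for i j by (intro bdd_borel_intros cell_sets)
    have m0: "m i \<ge> 0" for i by (simp add: m_def)
    have mm: "(\<integral>z. cell_pair N i j z \<partial>unif2) = m i * m j" for i j
      unfolding m_def by (rule integral_tensor) auto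
    have \<alpha>: "\<bar>\<alpha> i j\<bar> \<le> D * (m i * m j)" for i j
      using integral_bdd_borel2_mult_bound[OF bmG D(2) bmc, of i j] mm[of i j] by (simp add: \<alpha>_def)
    have aD: "\<bar>a i j\<bar> \<le> D" for i j
    proof (cases "m i * m j = 0")
      case False
      then have "m i * m j > 0" using m0[of i] m0[of j] by (simp add: less_le)
      then show ?thesis using \<alpha>[of i j] by (simp add: a_def abs_divide divide_le_eq del: mult_eq_0_iff)
    qed (use D(1) in \<open>auto simp: a_def\<close>)
    have "G' \<in> borel_measurable borel" unfolding G'_def borel_prod[symmetric] by measurable
    then have bmG': "bdd_borel G'" using aD by (intro bdd_borelI[where C=D]) (auto simp: G'_def)
    have same: "(\<integral>z. G z * cell_pair N i j z \<partial>unif2)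
           = (\<integral>z. G' z * cell_pair N i j z \<partial>unif2)" for i j
    proof -
      have "(\<integral>z. G' z * cell_pair N i j z \<partial>unif2)
         = (\<integral>z. a i j * cell_pair N i j z \<partial>unif2)"
        by (rule Bochner_Integration.integral_cong) (auto simp: G'_def indicator_def)
      also have "\<dots> = a i j * (m i * m j)" by (simp add: mm)
      also have "\<dots> = \<alpha> i j" using \<alpha>[of i j] by (auto simp: a_def)
      finally show ?thesis by (simp add: \<alpha>_def)
    qed
    have same': "same_cell_masses N G G'" unfolding same_cell_masses_def using same by blast
    have "(\<integral>z. G' z * B z \<partial>unif2) = (\<integral>z. B z * a (cell N (fst z)) (cell N (snd z)) \<partial>unif2)"
      by (simp add: G'_def mult.commute)
    also have "\<dots> = (\<Sum>i\<in>{0..int N}. \<Sum>j\<in>{0..int N}. a i j * (\<integral>z. B z * cell_pair N i j z \<partial>unif2))"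
      by (rule integral_step[OF bdd_borel(2)])
    also have "\<dots> \<ge> 0"
    proof (rule Schur_product_matrix)
      fix u :: "int \<Rightarrow> real"
      show "0 \<le> (\<Sum>i = 0..int N. \<Sum>j = 0..int N. u i * u j * a i j)"
        using psd_cell_form_nonneg[OF assms(1) f, where u="\<lambda>i. u i / m i" and N=N] by (simp add: a_def \<alpha>_def G_def)
      show "0 \<le> (\<Sum>i = 0..int N. \<Sum>j = 0..int N. u i * u j * (\<integral>z. B z * cell_pair N i j z \<partial>unif2))"
        using psd_cell_form_nonneg[OF assms(2) bdd_borel_const[of 1], where u=u and N=N] by simp
      fix i j
      have "(\<integral>z. B z * cell_pair N i j z \<partial>unif2) = (\<integral>x. \<integral>y. B (x, y) * (cell_ind N i x * cell_ind N j y) \<partial>unif \<partial>unif)"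
        using integral2_fst[OF bdd_borel_mult[OF bdd_borel(2) bmc]] by simp
      also have "\<dots> = (\<integral>y. \<integral>x. B (x, y) * (cell_ind N i x * cell_ind N j y) \<partial>unif \<partial>unif)"
        using integral_swap[OF bdd_borel_mult[OF bdd_borel(2) bmc]] by simp
      also have "\<dots> = (\<integral>y. \<integral>x. B (y, x) * (cell_ind N j y * cell_ind N i x) \<partial>unif \<partial>unif)"
        using sym(2) by (simp add: sym_kernel_def mult.commute)
      also have "\<dots> = (\<integral>z. B z * cell_pair N j i z \<partial>unif2)"
        using integral2_fst[OF bdd_borel_mult[OF bdd_borel(2) bmc]] by simp
      finally show "(\<integral>z. B z * cell_pair N i j z \<partial>unif2) = (\<integral>z. B z * cell_pair N j i z \<partial>unif2)" .
    qed simp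
    finally show "0 \<le> ip f (kop (\<lambda>z. A z * B z) f) + \<delta>"
      using test[OF bmG bmG' D(2) _ same'] aD unfolding eq by (simp add: G'_def abs_le_iff)
  qed
qed

section \<open>Local density for weight functions\<close>

lemma integral_unif_indicator_interval:
  assumes "0 \<le> a" "a \<le> b" "b \<le> 1"
  shows "(\<integral>x. indicator {a..<b} x \<partial>unif) = b - a"
proof -
  have "emeasure unif {a..<b} = emeasure lborel {a..<b}"
  proof -
    have "emeasure unif {a..<b} = (\<integral>\<^sup>+x. indicator ({0..1} \<inter> {a..<b}) x \<partial>lborel)"
      unfolding unif_def by (simp add: emeasure_density indicator_inter_arith)
    also have "\<dots> = emeasure lborel ({0..1} \<inter> {a..<b})" by (rule nn_integral_indicator) simp
    also have "{0..1} \<inter> {a..<b} = {a..<b}" using assms by auto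
    finally show ?thesis .
  qed
  then show ?thesis using assms by (simp add: measure_def)
qed

lemma cell_vimage: "N > 0 \<Longrightarrow> cell N -` {i} = {real_of_int i / real N ..< (real_of_int i + 1) / real N}"
  unfolding cell_def vimage_def by (simp add: floor_eq_iff set_eq_iff pos_divide_le_eq pos_less_divide_eq mult.commute)

text \<open>A weight \<open>f\<close> with values in \<open>[0, 1]\<close> can be imitated by a set: fill each cell of a fine grid from the left up
to the mass that \<open>f\<close> has in it. This set and \<open>f\<close> have the same cell masses, so their forms under \<open>W\<close> almost agree.\<close>

lemma locally_dense_functions:
  fixes W :: "real \<times> real \<Rightarrow> real"
  assumes W: "bdd_borel W"
    and dense: "\<And>S. S \<in> sets borel \<Longrightarrow> \<rho> * (\<integral>x. indicator S x \<partial>unif)\<^sup>2 \<le> (\<integral>z. indicator S (fst z) * W z * indicator S (snd z) \<partial>unif2)"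
    and f: "bdd_borel f" "\<And>x. 0 \<le> f x" "\<And>x. f x \<le> 1"
  shows "\<rho> * (\<integral>x. f x \<partial>unif)\<^sup>2 \<le> ip f (kop W f)"
proof (rule field_le_epsilon)
  fix \<delta> :: real assume "\<delta> > 0"
  obtain N where N: "N > 0" and test:
    "\<And>G G'. bdd_borel G \<Longrightarrow> bdd_borel G' \<Longrightarrow> (\<And>z. \<bar>G z\<bar> \<le> 1) \<Longrightarrow> (\<And>z. \<bar>G' z\<bar> \<le> 1) \<Longrightarrow>
      same_cell_masses N G G' \<Longrightarrow>
      \<bar>(\<integral>z. G z * W z \<partial>unif2) - (\<integral>z. G' z * W z \<partial>unif2)\<bar> \<le> \<delta>"
    by (rule cell_test[OF W \<open>\<delta> > 0\<close>, of 1]) auto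
  define m where "m = (\<lambda>i. \<integral>x. f x * cell_ind N i x \<partial>unif)"
  define S where "S = {x. x < real_of_int (cell N x) / real N + m (cell N x)}"
  have S [measurable]: "S \<in> sets borel" unfolding S_def by measurable
  have m0: "m i \<ge> 0" for i by (simp add: m_def f)
  have mle: "m i \<le> (\<integral>x. cell_ind N i x \<partial>unif)" for i
    unfolding m_def by (intro integral_mono integrable_bdd_borel bdd_borel_intros f(1) cell_sets) (simp add: f mult_left_le_one_le)
  have mS: "(\<integral>x. indicator S x * cell_ind N i x \<partial>unif) = m i" for i
  proof (cases "0 \<le> i \<and> i < int N")
    case True
    then have i: "0 \<le> real_of_int i / real N" "(real_of_int i + 1) / real N \<le> 1"
      using N by (auto simp: divide_le_eq_1)
    have "m i \<le> (real_of_int i + 1) / real N - real_of_int i / real N"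
      using mle[of i] integral_unif_indicator_interval[OF i(1) _ i(2)] N
      unfolding cell_vimage[OF N] by (simp add: divide_right_mono)
    then have mN: "real_of_int i / real N + m i \<le> (real_of_int i + 1) / real N" by simp
    have "indicator S x * cell_ind N i x = (indicator {real_of_int i / real N ..< real_of_int i / real N + m i} x :: real)" for x
    proof (cases "x \<in> cell N -` {i}")
      case True
      then have "x \<in> {real_of_int i / real N ..< (real_of_int i + 1) / real N}" unfolding cell_vimage[OF N] .
      then show ?thesis using True by (simp add: S_def indicator_def)
    next
      case False
      then have "x \<notin> {real_of_int i / real N ..< (real_of_int i + 1) / real N}" unfolding cell_vimage[OF N] .
      then show ?thesis using False mN by (auto simp: indicator_def)
    qed
    then show ?thesis using integral_unif_indicator_interval[OF i(1), of "real_of_int i / real N + m i"] m0[of i] mN i(2) by simp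
  next
    case False
    \<comment> \<open>these cells miss \<open>[0, 1)\<close>, so \<open>f\<close> and \<open>S\<close> have no mass in them\<close>
    have "AE x in unif. cell_ind N i x = 0"
    proof -
      have "AE x in unif. x \<noteq> 1"
        unfolding AE_unif_iff using AE_lborel_singleton[of 1] by eventually_elim simp
      with AE_unif_in show ?thesis
      proof eventually_elim
        case (elim x)
        then have "0 \<le> real N * x" "real N * x < real N" using N by auto
        then have "0 \<le> cell N x" "cell N x < int N" by (auto simp: cell_def floor_less_iff)
        then show ?case using False by (auto simp: indicator_def)
      qed
    qed
    then have "(\<integral>x. cell_ind N i x \<partial>unif) = 0" by (intro integral_eq_zero_AE)
    then have "m i = 0" using m0[of i] mle[of i] by simp
    moreover have "(\<integral>x. indicator S x * cell_ind N i x \<partial>unif) = 0"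
      by (rule integral_eq_zero_AE) (use \<open>AE x in unif. cell_ind N i x = 0\<close> in \<open>auto elim: eventually_mono\<close>)
    ultimately show ?thesis by simp
  qed
  have bmS: "bdd_borel (indicator S :: real \<Rightarrow> real)" by (intro bdd_borel_intros S)
  let ?G = "\<lambda>z. f (fst z) * f (snd z)" and ?G' = "\<lambda>z. indicator S (fst z) * indicator S (snd z) :: real"
  have bmG: "bdd_borel ?G" "bdd_borel ?G'" by (intro bdd_borel_intros f S)+
  have cells: "(\<integral>z. (g (fst z) * g (snd z)) * cell_pair N i j z \<partial>unif2)
     = (\<integral>x. g x * cell_ind N i x \<partial>unif) * (\<integral>x. g x * cell_ind N j x \<partial>unif)" if "bdd_borel g" for g i j
  proof -
    have "(\<integral>z. (g (fst z) * cell_ind N i (fst z)) * (g (snd z) * cell_ind N j (snd z)) \<partial>unif2)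
       = (\<integral>x. g x * cell_ind N i x \<partial>unif) * (\<integral>x. g x * cell_ind N j x \<partial>unif)"
      by (rule integral_tensor) (intro bdd_borel_intros that cell_sets)+
    then show ?thesis by (simp add: mult_ac)
  qed
  have same: "(\<integral>z. ?G z * cell_pair N i j z \<partial>unif2)
      = (\<integral>z. ?G' z * cell_pair N i j z \<partial>unif2)" for i j
    unfolding cells[OF f(1)] cells[OF bmS] mS by (simp add: m_def)
  have same': "same_cell_masses N ?G ?G'" unfolding same_cell_masses_def using same by blast
  have "(\<integral>z. ?G z * 1 \<partial>unif2) = (\<integral>z. ?G' z * 1 \<partial>unif2)"
    unfolding integral_step[OF bmG(1), where c="\<lambda>_ _. 1" and N=N] integral_step[OF bmG(2), where c="\<lambda>_ _. 1" and N=N] same ..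
  then have eq: "(\<integral>x. f x \<partial>unif)\<^sup>2 = (\<integral>x. indicator S x \<partial>unif)\<^sup>2"
    using integral_tensor[OF f(1) f(1)] integral_tensor[OF bmS bmS] by (simp add: power2_eq_square)
  have "\<bar>(\<integral>z. ?G z * W z \<partial>unif2) - (\<integral>z. ?G' z * W z \<partial>unif2)\<bar> \<le> \<delta>"
    by (rule test[OF bmG _ _ same']) (auto simp: abs_mult f indicator_def mult_le_one)
  moreover have "(\<integral>z. ?G z * W z \<partial>unif2) = ip f (kop W f)"
    by (simp add: ip_kop[OF W f(1) f(1)] mult_ac)
  moreover have "(\<integral>z. ?G' z * W z \<partial>unif2) \<ge> \<rho> * (\<integral>x. f x \<partial>unif)\<^sup>2"
    using dense[OF S] unfolding eq by (simp add: mult_ac)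
  ultimately show "\<rho> * (\<integral>x. f x \<partial>unif)\<^sup>2 \<le> ip f (kop W f) + \<delta>" by linarith
qed

section \<open>Kernel powers and their moments\<close>

definition kcomp :: "(real \<times> real \<Rightarrow> real) \<Rightarrow> (real \<times> real \<Rightarrow> real) \<Rightarrow> real \<times> real \<Rightarrow> real" where
  "kcomp K L p = kop K (\<lambda>z. L (z, snd p)) (fst p)"

text \<open>Only positive exponents are meaningful; the zeroth power would be the identity operator, which has no kernel.\<close>

fun kpow :: "(real \<times> real \<Rightarrow> real) \<Rightarrow> nat \<Rightarrow> real \<times> real \<Rightarrow> real" where
  "kpow K 0 = (\<lambda>_. 0)"
| "kpow K (Suc 0) = K"
| "kpow K (Suc (Suc n)) = kcomp K (kpow K (Suc n))"

lemma bdd_borel_swap: "bdd_borel L \<Longrightarrow> bdd_borel (\<lambda>z::real\<times>real. L (snd z, fst z))"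
  by (rule bdd_borel_comp) (auto intro!: borel_measurable_continuous_onI continuous_intros)

lemma bdd_borel_kcomp: assumes "bdd_borel K" "bdd_borel L" shows "bdd_borel (kcomp K L)"
proof -
  obtain C D where *: "\<And>x. \<bar>K x\<bar> \<le> C" "\<And>x. \<bar>L x\<bar> \<le> D" using assms by (auto simp: bdd_borel_def)
  have [measurable]: "K \<in> borel_measurable (borel \<Otimes>\<^sub>M borel)" "L \<in> borel_measurable (borel \<Otimes>\<^sub>M borel)"
    unfolding borel_prod using assms by (auto intro: bdd_borel_measurable)
  show ?thesis
  proof (rule bdd_borelI)
    have "(\<lambda>p::real\<times>real. \<integral>z. K (fst p, z) * L (z, snd p) \<partial>unif) \<in> borel_measurable (borel \<Otimes>\<^sub>M borel)"
      by measurable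
    then show "kcomp K L \<in> borel_measurable borel"
      by (simp add: kcomp_def[abs_def] kop_def borel_prod)
    fix p
    have "\<bar>K (fst p, z) * L (z, snd p)\<bar> \<le> C * D" for z
      unfolding abs_mult using *(1)[of "(fst p, z)"] *(2)[of "(z, snd p)"] by (intro mult_mono) auto
    then show "\<bar>kcomp K L p\<bar> \<le> C * D"
      unfolding kcomp_def kop_def
      by (rule integral_abs_le[OF bdd_borel_mult[OF bdd_borel_section[OF assms(1)] bdd_borel_section'[OF assms(2)]]])
  qed
qed

lemma kop_kcomp:
  assumes "bdd_borel K" "bdd_borel L" "bdd_borel f" shows "kop (kcomp K L) f = kop K (kop L f)"
proof
  fix x
  have "kop (kcomp K L) f x = (\<integral>y. \<integral>z. K (x, z) * L (z, y) * f y \<partial>unif \<partial>unif)"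
    by (simp add: kop_def kcomp_def)
  also have "\<dots> = (\<integral>z. \<integral>y. K (x, z) * L (z, y) * f y \<partial>unif \<partial>unif)"
  proof -
    have "bdd_borel (\<lambda>p. K (x, snd p) * L (snd p, fst p) * f (fst p))"
      using bdd_borel_snd[OF bdd_borel_section[OF assms(1), of x]] bdd_borel_swap[OF assms(2)] bdd_borel_fst[OF assms(3)]
      by (intro bdd_borel_mult)
    from integral_swap[OF this] show ?thesis by simp
  qed
  also have "\<dots> = kop K (kop L f) x"
    by (simp add: kop_def mult.assoc)
  finally show "kop (kcomp K L) f x = kop K (kop L f) x" .
qed

lemma kcomp_assoc: assumes "bdd_borel K" "bdd_borel L" "bdd_borel P" shows "kcomp K (kcomp L P) = kcomp (kcomp K L) P"
proof
  fix p :: "real \<times> real"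
  have "bdd_borel (\<lambda>w. P (w, snd p))" using assms(3) by (rule bdd_borel_section')
  from kop_kcomp[OF assms(1,2) this] show "kcomp K (kcomp L P) p = kcomp (kcomp K L) P p"
    by (simp add: kcomp_def[abs_def])
qed

lemma bdd_borel_kpow: "bdd_borel K \<Longrightarrow> bdd_borel (kpow K r)"
  by (induction K r rule: kpow.induct) (auto intro: bdd_borel_kcomp)

lemma kop_kpow:
  assumes "bdd_borel K" "bdd_borel f" shows "r \<ge> 1 \<Longrightarrow> kop (kpow K r) f = (kop K ^^ r) f"
  using assms by (induction K r rule: kpow.induct) (auto simp: kop_kcomp bdd_borel_kpow)

lemma kcomp_kpow_commute: "bdd_borel K \<Longrightarrow> r \<ge> 1 \<Longrightarrow> kcomp K (kpow K r) = kcomp (kpow K r) K"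
proof (induction K r rule: kpow.induct)
  case (3 K n)
  then have "kcomp K (kcomp K (kpow K (Suc n))) = kcomp K (kcomp (kpow K (Suc n)) K)" by simp
  also have "\<dots> = kcomp (kcomp K (kpow K (Suc n))) K" by (rule kcomp_assoc) (auto intro: bdd_borel_kpow 3)
  finally show ?case by simp
qed auto

lemma sym_kernel_kpow: assumes "bdd_borel K" "sym_kernel K" shows "sym_kernel (kpow K r)"
  using assms
proof (induction K r rule: kpow.induct)
  case (3 K n)
  let ?P = "kpow K (Suc n)"
  have P: "?P (x, y) = ?P (y, x)" and K: "K (x, y) = K (y, x)" for x y
    using 3 unfolding sym_kernel_def by blast+
  have swap: "kcomp K ?P (x, y) = kcomp ?P K (y, x)" for x y
  proof -
    have "K (x, z) * ?P (z, y) = ?P (y, z) * K (z, x)" for z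
      by (subst K[of x z], subst P[of z y], rule mult.commute)
    then show ?thesis by (simp only: kcomp_def kop_def fst_conv snd_conv)
  qed
  have "kcomp K ?P = kcomp ?P K" by (rule kcomp_kpow_commute) (use 3 in auto)
  with swap show ?case unfolding sym_kernel_def kpow.simps by metis
qed (auto simp: sym_kernel_def)

lemma kpow_nonneg:
  fixes K :: "real \<times> real \<Rightarrow> real"
  shows "(\<And>z. 0 \<le> K z) \<Longrightarrow> 0 \<le> kpow K r z"
  by (induction K r arbitrary: z rule: kpow.induct) (auto simp: kcomp_def kop_def)

lemma kpow_le_1:
  fixes K :: "real \<times> real \<Rightarrow> real"
  assumes "bdd_borel K" "\<And>z. 0 \<le> K z" "\<And>z. K z \<le> 1" shows "kpow K r z \<le> 1"
  using assms
proof (induction K r arbitrary: z rule: kpow.induct)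
  case (3 K n)
  have "kcomp K (kpow K (Suc n)) z \<le> (\<integral>x. 1 \<partial>unif)"
    unfolding kcomp_def kop_def
    using 3 bdd_borel_mult[OF bdd_borel_section[OF "3.prems"(1)] bdd_borel_section'[OF bdd_borel_kpow[OF "3.prems"(1), of "Suc n"]]]
    by (intro integral_mono mult_le_one kpow_nonneg) auto
  then show ?case using unif.prob_space by simp
qed auto

lemma bdd_borel_kop_iter: "bdd_borel K \<Longrightarrow> bdd_borel f \<Longrightarrow> bdd_borel ((kop K ^^ n) f)"
  by (induction n) auto

lemma ip_kop_iter: assumes "bdd_borel K" "sym_kernel K" "bdd_borel f" "bdd_borel g"
  shows "ip f ((kop K ^^ n) g) = ip ((kop K ^^ n) f) g"
  using assms(3,4)
proof (induction n arbitrary: f)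
  case (Suc n)
  have "ip f ((kop K ^^ Suc n) g) = ip (kop K f) ((kop K ^^ n) g)"
    using ip_kop_sym[OF assms(1,2)] Suc.prems assms(1) by (simp add: bdd_borel_kop_iter)
  also have "\<dots> = ip ((kop K ^^ n) (kop K f)) g" using Suc assms(1) by (intro Suc.IH) auto
  finally show ?case by (simp add: funpow_Suc_right del: funpow.simps)
qed simp

lemma ip_kop_iter2: assumes "bdd_borel K" "sym_kernel K" "bdd_borel f" "bdd_borel g"
  shows "ip ((kop K ^^ m) f) ((kop K ^^ n) g) = ip f ((kop K ^^ (m + n)) g)"
  using ip_kop_iter[OF assms(1,2,3), of "(kop K ^^ n) g" m] assms by (simp add: bdd_borel_kop_iter funpow_add)

text \<open>An even power gives \<open>\<langle>K\<^sup>m f, K\<^sup>m f\<rangle>\<close> and an odd one \<open>\<langle>K\<^sup>m f, K (K\<^sup>m f)\<rangle>\<close>.\<close>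

lemma psd_kpow: assumes "psd K" "r \<ge> 1" shows "psd (kpow K r)"
  unfolding psd_def
proof (intro conjI allI impI)
  have K: "bdd_borel K" "sym_kernel K" using assms by (auto simp: psd_def)
  show "bdd_borel (kpow K r)" "sym_kernel (kpow K r)" using K by (auto intro: bdd_borel_kpow sym_kernel_kpow)
  fix f :: "real \<Rightarrow> real" assume f: "bdd_borel f"
  let ?g = "(kop K ^^ (r div 2)) f"
  have g: "bdd_borel ?g" using K f by (intro bdd_borel_kop_iter)
  show "0 \<le> ip f (kop (kpow K r) f)"
  proof (cases "even r")
    case True
    then have "ip f (kop (kpow K r) f) = ip ?g ?g"
      using assms(2) K f by (simp add: kop_kpow ip_kop_iter2 flip: mult_2)
    then show ?thesis by (simp add: ip_self_nonneg)
  next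
    case False
    then have r: "r div 2 + Suc (r div 2) = r" by presburger
    have "ip f (kop (kpow K r) f) = ip ?g ((kop K ^^ Suc (r div 2)) f)"
      using assms(2) K f by (simp only: kop_kpow ip_kop_iter2 r)
    then show ?thesis using psd_nonneg[OF assms(1) g] by simp
  qed
qed

lemma ip_Cauchy_Schwarz: assumes "bdd_borel f" "bdd_borel g" shows "(ip f g)\<^sup>2 \<le> ip f f * ip g g"
proof (rule quadratic_nonneg_discriminant)
  show "0 \<le> ip g g" by (rule ip_self_nonneg)
  fix t :: real
  have "0 \<le> ip (\<lambda>x. f x + t * g x) (\<lambda>x. f x + t * g x)" by (rule ip_self_nonneg)
  also have "\<dots> = ip f f + 2 * t * ip f g + t\<^sup>2 * ip g g"
    using assms by (simp add: ip_simps bdd_borel_add bdd_borel_mult ip_commute[of g f] algebra_simps power2_eq_square)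
  finally show "0 \<le> \<dots>" .
qed

lemma kop_iter_Cauchy_Schwarz: assumes "psd K" "bdd_borel f" "bdd_borel g"
  shows "(ip f ((kop K ^^ r) g))\<^sup>2 \<le> ip f ((kop K ^^ r) f) * ip g ((kop K ^^ r) g)"
proof (cases "r = 0")
  case True
  then show ?thesis using ip_Cauchy_Schwarz[OF assms(2,3)] by simp
next
  case False
  then show ?thesis using psd_Cauchy_Schwarz[OF psd_kpow[OF assms(1)] assms(2,3), of r] assms psd_bdd_borel[OF assms(1)]
    by (simp add: kop_kpow)
qed

definition moment :: "(real \<times> real \<Rightarrow> real) \<Rightarrow> (real \<Rightarrow> real) \<Rightarrow> nat \<Rightarrow> real" where
  "moment K u m = ip u ((kop K ^^ m) u)"

lemma ip_iter_moment: "psd K \<Longrightarrow> bdd_borel u \<Longrightarrow> ip ((kop K ^^ i) u) ((kop K ^^ j) u) = moment K u (i + j)"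
  by (simp add: moment_def ip_kop_iter2 psd_def)

lemma moment_nonneg: assumes "psd K" "bdd_borel u" shows "0 \<le> moment K u m"
proof (cases "m = 0")
  case True then show ?thesis by (simp add: moment_def ip_self_nonneg)
next
  case False
  then show ?thesis using psd_nonneg[OF psd_kpow[OF assms(1)] assms(2), of m] assms psd_bdd_borel[OF assms(1)]
    by (simp add: moment_def kop_kpow)
qed

text \<open>Cauchy--Schwarz for the form of \<open>K\<^sup>m\<close>, applied to \<open>u\<close> and \<open>K u\<close>.\<close>

lemma moment_log_convex: assumes "psd K" "bdd_borel u"
  shows "(moment K u (Suc m))\<^sup>2 \<le> moment K u m * moment K u (Suc (Suc m))"
proof -
  have K: "bdd_borel K" "sym_kernel K" using assms by (auto simp: psd_def)
  have "bdd_borel (kop K u)" using K assms by auto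
  from kop_iter_Cauchy_Schwarz[OF assms this, of m]
  have "(ip u ((kop K ^^ m) (kop K u)))\<^sup>2 \<le> moment K u m * ip (kop K u) ((kop K ^^ m) (kop K u))"
    by (simp add: moment_def)
  moreover have "(kop K ^^ m) (kop K u) = (kop K ^^ Suc m) u" by (simp add: funpow_swap1)
  ultimately show ?thesis
    using ip_iter_moment[OF assms, of 1 "Suc m"] by (simp add: moment_def)
qed

text \<open>The ratios of consecutive terms of a log-convex sequence increase.\<close>

lemma log_convex_growth:
  fixes a :: "nat \<Rightarrow> real"
  assumes "\<And>m. 0 \<le> a m" "\<And>m. (a (Suc m))\<^sup>2 \<le> a m * a (Suc (Suc m))" "a 1 > 0"
  shows "m \<ge> 1 \<Longrightarrow> a m > 0 \<and> a 2 / a 1 * a m \<le> a (Suc m)"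
proof -
  define \<beta> where "\<beta> = a 2 / a 1"
  have two: "a 2 = a (Suc (Suc 0))" by (simp add: numeral_2_eq_2)
  have "0 < (a 1)\<^sup>2" using assms(3) by simp
  also have "\<dots> \<le> a 0 * a 2" using assms(2)[of 0] unfolding two by simp
  finally have "a 2 \<noteq> 0" by auto
  then have "a 2 > 0" using assms(1)[of 2] by (simp add: less_le)
  then have \<beta>: "\<beta> > 0" using assms(3) by (simp add: \<beta>_def)
  have "m \<ge> 1 \<Longrightarrow> a m > 0 \<and> \<beta> * a m \<le> a (Suc m)"
  proof (induction m rule: dec_induct)
    case base
    then show ?case using assms(3) by (simp add: \<beta>_def two)
  next
    case (step m)
    then have pos: "a m > 0" and le: "\<beta> * a m \<le> a (Suc m)" by auto
    have pos': "a (Suc m) > 0" using mult_pos_pos[OF \<beta> pos] le by linarith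
    have "\<beta> * a (Suc m) * a m = (\<beta> * a m) * a (Suc m)" by (simp only: mult_ac)
    also have "\<dots> \<le> a (Suc m) * a (Suc m)" using le pos' by (intro mult_right_mono) auto
    also have "\<dots> \<le> a (Suc (Suc m)) * a m" using assms(2)[of m] by (simp only: power2_eq_square mult.commute)
    finally show ?case using pos pos' by (simp add: mult_le_cancel_right)
  qed
  then show "m \<ge> 1 \<Longrightarrow> a m > 0 \<and> a 2 / a 1 * a m \<le> a (Suc m)" unfolding \<beta>_def .
qed

lemma log_convex_power:
  fixes a :: "nat \<Rightarrow> real"
  assumes "\<And>m. 0 \<le> a m" "\<And>m. (a (Suc m))\<^sup>2 \<le> a m * a (Suc (Suc m))" "a 1 > 0" "m \<ge> 1"
  shows "(a 2 / a 1) ^ k * a m \<le> a (m + k)"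
proof (induction k)
  case (Suc k)
  have b: "a 2 / a 1 \<ge> 0" using assms by simp
  have "(a 2 / a 1) ^ Suc k * a m = a 2 / a 1 * ((a 2 / a 1) ^ k * a m)" by (simp add: mult_ac)
  also have "\<dots> \<le> a 2 / a 1 * a (m + k)" using Suc b by (rule mult_left_mono)
  also have "\<dots> \<le> a (m + Suc k)"
    using log_convex_growth[of a, OF assms(1-3), of "m + k"] assms(4) by simp
  finally show ?case .
qed simp

section \<open>Rank-one minorants of positive semidefinite kernels\<close>

text \<open>The kernel \<open>A\<close> lies above the rank-one kernel of \<open>v\<close> in the positive semidefinite order.\<close>

definition dominates :: "(real \<times> real \<Rightarrow> real) \<Rightarrow> (real \<Rightarrow> real) \<Rightarrow> bool" where
  "dominates A v \<longleftrightarrow> bdd_borel v \<and> psd (\<lambda>z. A z - v (fst z) * v (snd z))"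

lemma ip_kop_rank_one: "ip f (kop (\<lambda>z. v (fst z) * v (snd z)) g) = ip f v * ip v g"
proof -
  have "kop (\<lambda>z. v (fst z) * v (snd z)) g x = ip v g * v x" for x
    unfolding kop_def ip_def fst_conv snd_conv mult.assoc integral_mult_right_zero by (rule mult.commute)
  then have "kop (\<lambda>z. v (fst z) * v (snd z)) g = (\<lambda>x. ip v g * v x)" by blast
  then show ?thesis by (simp only: ip_scale_right) (rule mult.commute)
qed

lemma psd_rank_one: assumes "bdd_borel v" shows "psd (\<lambda>z. v (fst z) * v (snd z))"
  unfolding psd_def using assms
  by (auto simp: ip_kop_rank_one ip_commute[of _ v] sym_kernel_def mult.commute intro!: bdd_borel_intros)

lemma kop_diff: "bdd_borel A \<Longrightarrow> bdd_borel B \<Longrightarrow> bdd_borel f \<Longrightarrow> kop (\<lambda>z. A z - B z) f = (\<lambda>x. kop A f x - kop B f x)"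
  by (simp add: kop_def left_diff_distrib bdd_borel_mult bdd_borel_section fun_eq_iff)
lemma kop_plus: "bdd_borel A \<Longrightarrow> bdd_borel B \<Longrightarrow> bdd_borel f \<Longrightarrow> kop (\<lambda>z. A z + B z) f = (\<lambda>x. kop A f x + kop B f x)"
  by (simp add: kop_def distrib_right bdd_borel_mult bdd_borel_section fun_eq_iff)
lemma ip_diff_right: "bdd_borel f \<Longrightarrow> bdd_borel g \<Longrightarrow> bdd_borel h \<Longrightarrow> ip h (\<lambda>x. f x - g x) = ip h f - ip h g"
  by (simp add: ip_def right_diff_distrib bdd_borel_mult)

lemma psd_add: assumes "psd A" "psd B" shows "psd (\<lambda>z. A z + B z)"
  using assms unfolding psd_def
  by (auto simp: kop_plus ip_add_right bdd_borel_kop sym_kernel_def intro!: bdd_borel_intros)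

lemma dominatesI:
  assumes "bdd_borel A" "sym_kernel A" "bdd_borel v" "\<And>f. bdd_borel f \<Longrightarrow> (ip f v)\<^sup>2 \<le> ip f (kop A f)"
  shows "dominates A v"
proof -
  have bmr: "bdd_borel (\<lambda>z::real\<times>real. v (fst z) * v (snd z))" using assms(3) by auto
  show ?thesis
    unfolding dominates_def psd_def
  proof (intro conjI allI impI)
    show "bdd_borel v" by fact
    show "bdd_borel (\<lambda>z. A z - v (fst z) * v (snd z))" using assms(1) bmr by (rule bdd_borel_diff)
    show "sym_kernel (\<lambda>z. A z - v (fst z) * v (snd z))" using assms(2) by (simp add: sym_kernel_def mult.commute)
    fix f :: "real \<Rightarrow> real" assume f: "bdd_borel f"
    show "0 \<le> ip f (kop (\<lambda>z. A z - v (fst z) * v (snd z)) f)"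
      using assms(4)[OF f] f assms(1) bmr
      by (simp add: kop_diff ip_diff_right bdd_borel_kop ip_kop_rank_one ip_commute[of v f] power2_eq_square)
  qed
qed

lemma dominates_psd: assumes "dominates A v" shows "psd A"
  using psd_add[of "\<lambda>z. A z - v (fst z) * v (snd z)", OF _ psd_rank_one[of v]] assms by (simp add: dominates_def)

text \<open>With \<open>V\<close> and \<open>W\<close> for the two rank-one kernels, \<open>A B - V W = (A - V) B + V (B - W)\<close>, and both terms are positive
semidefinite by the Schur product theorem.\<close>

lemma dominates_mult: assumes "dominates A v" "dominates B w"
  shows "dominates (\<lambda>z. A z * B z) (\<lambda>x. v x * w x)"
proof -
  have "psd (\<lambda>z. (A z - v (fst z) * v (snd z)) * B z + v (fst z) * v (snd z) * (B z - w (fst z) * w (snd z)))"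
    using assms dominates_psd[OF assms(2)] unfolding dominates_def
    by (intro psd_add psd_mult psd_rank_one) auto
  also have "(\<lambda>z. (A z - v (fst z) * v (snd z)) * B z + v (fst z) * v (snd z) * (B z - w (fst z) * w (snd z)))
     = (\<lambda>z. A z * B z - (v (fst z) * w (fst z)) * (v (snd z) * w (snd z)))"
    by (simp add: fun_eq_iff algebra_simps)
  finally show ?thesis using assms by (auto simp: dominates_def)
qed

lemma dominates_prod_list:
  assumes "\<And>r. r \<in> set rs \<Longrightarrow> dominates (A r) (v r)"
  shows "dominates (\<lambda>z. prod_list (map (\<lambda>r. A r z) rs)) (\<lambda>x. prod_list (map (\<lambda>r. v r x) rs))"
  using assms
proof (induction rs)
  case Nil
  show ?case by (simp add: dominates_def psd_def sym_kernel_def ip_def kop_def)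
next
  case (Cons r rs)
  then show ?case using dominates_mult[of "A r" "v r"] by simp
qed

lemma integral2_eq_ip: assumes "bdd_borel A" shows "(\<integral>z. A z \<partial>unif2) = ip (\<lambda>_. 1) (kop A (\<lambda>_. 1))"
  using ip_kop[OF assms bdd_borel_const bdd_borel_const, of 1 1] by simp

lemma psd_integral_nonneg: "psd A \<Longrightarrow> 0 \<le> (\<integral>z. A z \<partial>unif2)"
  by (simp add: integral2_eq_ip psd_def)

lemma dominates_integral: assumes "dominates A v"
  shows "(\<integral>x. v x \<partial>unif)\<^sup>2 \<le> (\<integral>z. A z \<partial>unif2)"
proof -
  have v: "bdd_borel v" and A: "bdd_borel A" using assms dominates_psd[OF assms] by (auto simp: dominates_def psd_def)
  have "0 \<le> (\<integral>z. A z - v (fst z) * v (snd z) \<partial>unif2)"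
    using assms by (intro psd_integral_nonneg) (simp add: dominates_def)
  also have "\<dots> = (\<integral>z. A z \<partial>unif2) - (\<integral>x. v x \<partial>unif)\<^sup>2"
    using A v by (simp add: integral_tensor power2_eq_square bdd_borel_tensor)
  finally show ?thesis by simp
qed

text \<open>With \<open>w = K\<^bsup>n-r\<^esup> u\<close>, Cauchy--Schwarz for the form of \<open>K\<^sup>r\<close> gives
\<open>\<langle>f, K\<^sup>n u\<rangle>\<^sup>2 = \<langle>f, K\<^sup>r w\<rangle>\<^sup>2 \<le> \<langle>f, K\<^sup>r f\<rangle> \<langle>w, K\<^sup>r w\<rangle>\<close>, and the last factor is a moment of \<open>u\<close>. What matters is that the function
\<open>K\<^sup>n u\<close> does not depend on \<open>r\<close>: different branches dominate multiples of one and the same rank-one kernel.\<close>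

lemma kpow_dominates:
  assumes "psd K" "bdd_borel u" "1 \<le> r" "r \<le> n" "moment K u (2 * n - r) > 0"
  shows "dominates (kpow K r) (\<lambda>x. (kop K ^^ n) u x / sqrt (moment K u (2 * n - r)))"
proof (rule dominatesI)
  have K: "bdd_borel K" "sym_kernel K" using assms by (auto simp: psd_def)
  show "bdd_borel (kpow K r)" "sym_kernel (kpow K r)" using K by (auto intro: bdd_borel_kpow sym_kernel_kpow)
  show "bdd_borel (\<lambda>x. (kop K ^^ n) u x / sqrt (moment K u (2 * n - r)))"
    using K assms by (intro bdd_borel_intros bdd_borel_kop_iter)
  fix f :: "real \<Rightarrow> real" assume f: "bdd_borel f"
  let ?w = "(kop K ^^ (n - r)) u" and ?c = "moment K u (2 * n - r)"
  have w: "bdd_borel ?w" using K assms by (intro bdd_borel_kop_iter)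
  have Kr: "(kop K ^^ r) ?w = (kop K ^^ n) u"
    using assms by (metis funpow_add le_add_diff_inverse comp_apply)
  have c: "ip ?w ((kop K ^^ r) ?w) = ?c"
    unfolding Kr using ip_iter_moment[OF assms(1,2), of "n - r" n] assms by (simp add: mult_2)
  have "(ip f ((kop K ^^ n) u))\<^sup>2 \<le> ip f ((kop K ^^ r) f) * ?c"
    using kop_iter_Cauchy_Schwarz[OF assms(1) f w, of r] unfolding c unfolding Kr .
  then have "(ip f ((kop K ^^ n) u))\<^sup>2 / ?c \<le> ip f ((kop K ^^ r) f)"
    using assms(5) by (simp add: divide_le_eq)
  moreover have "ip f (\<lambda>x. (kop K ^^ n) u x / sqrt ?c) = ip f ((kop K ^^ n) u) / sqrt ?c"
    using ip_scale_right[of f "inverse (sqrt ?c)"] by (simp add: divide_inverse mult.commute)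
  ultimately show "(ip f (\<lambda>x. (kop K ^^ n) u x / sqrt ?c))\<^sup>2 \<le> ip f (kop (kpow K r) f)"
    using assms(3,5) K f by (simp add: power_divide kop_kpow)
qed

section \<open>The integral of the theta kernel\<close>

text \<open>The density of \<open>\<Theta>\<close> in \<open>K\<close> with the two roots held fixed.\<close>

definition theta_kernel :: "nat list \<Rightarrow> (real \<times> real \<Rightarrow> real) \<Rightarrow> real \<times> real \<Rightarrow> real" where
  "theta_kernel rs K z = prod_list (map (\<lambda>r. kpow K r z) rs)"

lemma bdd_borel_theta_kernel: "bdd_borel K \<Longrightarrow> bdd_borel (theta_kernel rs K)"
  unfolding theta_kernel_def by (induction rs) (auto intro: bdd_borel_kpow)

lemma sym_kernel_theta_kernel: assumes "bdd_borel K" "sym_kernel K" shows "sym_kernel (theta_kernel rs K)"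
proof -
  have "(\<lambda>r. kpow K r (x, y)) = (\<lambda>r. kpow K r (y, x))" for x y
    using sym_kernel_kpow[OF assms] unfolding sym_kernel_def by blast
  then show ?thesis unfolding sym_kernel_def theta_kernel_def by (intro allI arg_cong[where f="\<lambda>h. prod_list (map h rs)"])
qed

lemma theta_kernel_nonneg:
  fixes K :: "real \<times> real \<Rightarrow> real"
  assumes "\<And>z. 0 \<le> K z" shows "0 \<le> theta_kernel rs K z"
  unfolding theta_kernel_def using kpow_nonneg[of K, OF assms] by (induction rs) auto

lemma theta_kernel_le_1:
  fixes K :: "real \<times> real \<Rightarrow> real"
  assumes "bdd_borel K" "\<And>z. 0 \<le> K z" "\<And>z. K z \<le> 1" shows "theta_kernel rs K z \<le> 1"
  unfolding theta_kernel_def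
proof (induction rs)
  case (Cons r rs)
  have "kpow K r z \<le> 1" using assms by (rule kpow_le_1)
  moreover have "0 \<le> (\<Prod>r\<leftarrow>rs. kpow K r z)"
    using theta_kernel_nonneg[of K rs z] assms(2) by (simp add: theta_kernel_def)
  ultimately show ?case using Cons by (simp add: mult_le_one)
qed simp

lemma psd_theta_kernel:
  assumes "psd K" "\<forall>r\<in>set rs. r \<ge> 1" shows "psd (theta_kernel rs K)"
proof -
  have "dominates (kpow K r) (\<lambda>_. 0)" if "r \<in> set rs" for r
    using psd_kpow[OF assms(1)] assms(2) that by (simp add: dominates_def)
  from dominates_prod_list[OF this] show ?thesis
    unfolding theta_kernel_def by (rule dominates_psd)
qed

text \<open>The graph of \<open>t \<mapsto> 2 t\<^bsup>s/2\<^esup>\<close> lies above its tangent at \<open>t = 1\<close>, written with \<open>t = y\<^sup>2\<close>.\<close>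

lemma power_mean_tangent:
  fixes y :: real assumes "y \<ge> 0"
  shows "s \<ge> 2 \<Longrightarrow> real s * y\<^sup>2 - real s + 2 \<le> 2 * y ^ s"
proof (induction s rule: dec_induct)
  case base
  then show ?case by simp
next
  case (step s)
  have "0 \<le> (y - 1) * (2 * y ^ s - y - 1)"
  proof (cases "y \<ge> 1")
    case True
    then have "y \<le> y ^ s" using step by (intro self_le_power) auto
    with True show ?thesis by (intro mult_nonneg_nonneg) auto
  next
    case False
    then have "y ^ s \<le> y ^ 1" using step assms by (intro power_decreasing) auto
    with False show ?thesis by (intro mult_nonpos_nonpos) auto
  qed
  then have "y\<^sup>2 - 1 \<le> 2 * y ^ Suc s - 2 * y ^ s" by (simp add: algebra_simps power2_eq_square)
  with step show ?case by (simp add: algebra_simps)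
qed

text \<open>Integrate the tangent inequality for \<open>d\<close> scaled to have second moment \<open>1\<close>.\<close>

lemma power_mean_integral:
  assumes d: "bdd_borel d" "\<And>x. 0 \<le> d x" and "s \<ge> 2"
  shows "(\<integral>x. (d x)\<^sup>2 \<partial>unif) ^ s \<le> (\<integral>x. d x ^ s \<partial>unif)\<^sup>2"
proof (cases "(\<integral>x. (d x)\<^sup>2 \<partial>unif) = 0")
  case True
  then show ?thesis using assms(3) by (simp add: zero_power)
next
  case False
  define c where "c = (\<integral>x. (d x)\<^sup>2 \<partial>unif)"
  have c: "c > 0" using False unfolding c_def by (simp add: less_le)
  have bmp: "bdd_borel (\<lambda>x. (d x / sqrt c) ^ n)" for n using d by (intro bdd_borel_intros)
  have "2 = (\<integral>x. real s * (d x / sqrt c)\<^sup>2 - real s + 2 \<partial>unif)"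
  proof -
    have "(\<integral>x. real s * (d x / sqrt c)\<^sup>2 - real s + 2 \<partial>unif) = real s * (\<integral>x. (d x / sqrt c)\<^sup>2 \<partial>unif) - real s + 2"
      using bmp[of 2] unif.prob_space by simp
    also have "(\<integral>x. (d x / sqrt c)\<^sup>2 \<partial>unif) = 1" using c by (simp add: power_divide flip: c_def)
    finally show ?thesis by simp
  qed
  also have "\<dots> \<le> (\<integral>x. 2 * (d x / sqrt c) ^ s \<partial>unif)"
  proof (rule integral_mono)
    show "integrable unif (\<lambda>x. real s * (d x / sqrt c)\<^sup>2 - real s + 2)" "integrable unif (\<lambda>x. 2 * (d x / sqrt c) ^ s)"
      using bmp[of 2] bmp[of s] by (auto intro!: Bochner_Integration.integrable_add Bochner_Integration.integrable_diff)
    show "real s * (d x / sqrt c)\<^sup>2 - real s + 2 \<le> 2 * (d x / sqrt c) ^ s" for x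
      using d c assms(3) by (intro power_mean_tangent) auto
  qed
  finally have "1 \<le> (\<integral>x. d x ^ s \<partial>unif) / sqrt c ^ s"
    by (simp add: power_divide)
  then have "sqrt c ^ s \<le> (\<integral>x. d x ^ s \<partial>unif)" using c by (simp add: le_divide_eq)
  then have "(sqrt c ^ s)\<^sup>2 \<le> (\<integral>x. d x ^ s \<partial>unif)\<^sup>2" using c by (intro power_mono) auto
  also have "(sqrt c ^ s)\<^sup>2 = ((sqrt c)\<^sup>2) ^ s" by (simp only: power_mult[symmetric] mult.commute)
  also have "\<dots> = c ^ s" using c by simp
  finally show ?thesis by (simp add: c_def)
qed

lemma moment_1: "moment K (\<lambda>_. 1) 0 = 1"
  using unif.prob_space by (simp add: moment_def ip_def)

lemma integral_kpow: "bdd_borel K \<Longrightarrow> r \<ge> 1 \<Longrightarrow> (\<integral>z. kpow K r z \<partial>unif2) = moment K (\<lambda>_. 1) r"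
  by (simp add: integral2_eq_ip bdd_borel_kpow kop_kpow moment_def)

lemma integral_kernel: "bdd_borel K \<Longrightarrow> (\<integral>z. K z \<partial>unif2) = moment K (\<lambda>_. 1) 1"
  using integral_kpow[of K 1] by simp

lemma kop_iter_nonneg:
  fixes K :: "real \<times> real \<Rightarrow> real"
  shows "(\<And>z. 0 \<le> K z) \<Longrightarrow> 0 \<le> (kop K ^^ n) (\<lambda>_. 1) x"
  by (induction n arbitrary: x) (auto simp: kop_def)

lemma prod_list_divide: fixes c :: "'a \<Rightarrow> real"
  shows "prod_list (map (\<lambda>r. d / c r) rs) = d ^ length rs / prod_list (map c rs)"
  by (induction rs) auto

lemma prod_list_sqrt: "prod_list (map (\<lambda>r. sqrt (c r)) rs) = sqrt (prod_list (map c rs))"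
  by (induction rs) (auto simp: real_sqrt_mult)

lemma prod_list_power: fixes b :: real shows "prod_list (map (\<lambda>r. b ^ r) rs) = b ^ sum_list rs"
  by (induction rs) (auto simp: power_add)

lemma prod_list_mono_real: fixes c d :: "'a \<Rightarrow> real"
  shows "(\<And>r. r \<in> set rs \<Longrightarrow> 0 \<le> c r \<and> c r \<le> d r) \<Longrightarrow> 0 \<le> prod_list (map c rs) \<and> prod_list (map c rs) \<le> prod_list (map d rs)"
  by (induction rs) (auto intro!: mult_mono order_trans[of 0 "c _" "d _"])

lemma prod_list_pos_real: fixes c :: "'a \<Rightarrow> real"
  shows "(\<And>r. r \<in> set rs \<Longrightarrow> 0 < c r) \<Longrightarrow> 0 < prod_list (map c rs)"
  by (induction rs) auto

text \<open>This is the main lower bound. The ratio \<open>a\<^sub>2 / a\<^sub>1\<close> of moments is kept instead of the smaller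
\<open>a\<^sub>1\<close>, because equality then yields \<open>a\<^sub>2 = a\<^sub>1\<^sup>2\<close> at once.\<close>

lemma integral_theta_kernel_ge_ratio:
  fixes K :: "real \<times> real \<Rightarrow> real"
  assumes K: "psd K" "\<And>z. 0 \<le> K z" and p: "moment K (\<lambda>_. 1) 1 > 0"
    and rs: "\<forall>r\<in>set rs. r \<ge> 1" "length rs \<ge> 2"
  shows "(moment K (\<lambda>_. 1) 2 / moment K (\<lambda>_. 1) 1) ^ sum_list rs \<le> (\<integral>z. theta_kernel rs K z \<partial>unif2)"
proof -
  let ?a = "moment K (\<lambda>_. 1)"
  note lc = moment_nonneg[OF K(1) bdd_borel_const, of 1] moment_log_convex[OF K(1) bdd_borel_const, of 1] p
  \<comment> \<open>any exponent that is at least every branch length would do\<close>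
  define n where "n = sum_list rs"
  define d where "d = (kop K ^^ n) (\<lambda>_. 1)"
  define c where "c = (\<lambda>r. ?a (2 * n - r))"
  have rn: "r \<le> n" "1 \<le> 2 * n - r" if "r \<in> set rs" for r
    using member_le_sum_list[OF that] rs(1) that by (force simp: n_def)+
  have cpos: "c r > 0" if "r \<in> set rs" for r
    using log_convex_growth[of ?a, OF lc rn(2)[OF that]] by (simp add: c_def)
  have bmd: "bdd_borel d" unfolding d_def using K by (intro bdd_borel_kop_iter psd_bdd_borel bdd_borel_const)
  have d0: "0 \<le> d x" for x unfolding d_def by (rule kop_iter_nonneg) (rule K)
  have d2: "(\<integral>x. (d x)\<^sup>2 \<partial>unif) = ?a (2 * n)"
    using ip_iter_moment[OF K(1) bdd_borel_const, of n 1 n] by (simp add: d_def ip_def power2_eq_square mult_2)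
  have P: "0 < prod_list (map c rs)" using cpos by (rule prod_list_pos_real)
  have "dominates (theta_kernel rs K) (\<lambda>x. prod_list (map (\<lambda>r. d x / sqrt (c r)) rs))"
    unfolding theta_kernel_def c_def d_def
    using rn cpos rs(1) unfolding c_def by (intro dominates_prod_list kpow_dominates K bdd_borel_const) auto
  then have "(\<integral>x. d x ^ length rs / sqrt (prod_list (map c rs)) \<partial>unif)\<^sup>2 \<le> (\<integral>z. theta_kernel rs K z \<partial>unif2)"
    unfolding prod_list_divide prod_list_sqrt by (rule dominates_integral)
  also have "(\<integral>x. d x ^ length rs / sqrt (prod_list (map c rs)) \<partial>unif)\<^sup>2 = (\<integral>x. d x ^ length rs \<partial>unif)\<^sup>2 / prod_list (map c rs)"
    using P by (simp add: power_divide)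
  finally have *: "(\<integral>x. d x ^ length rs \<partial>unif)\<^sup>2 / prod_list (map c rs) \<le> (\<integral>z. theta_kernel rs K z \<partial>unif2)" .
  have "(?a 2 / ?a 1) ^ sum_list rs = prod_list (map (\<lambda>r. (?a 2 / ?a 1) ^ r) rs)" by (simp add: prod_list_power)
  also have "\<dots> \<le> prod_list (map (\<lambda>r. ?a (2 * n) / c r) rs)"
  proof (rule conjunct2[OF prod_list_mono_real], intro conjI)
    fix r assume r: "r \<in> set rs"
    show "0 \<le> (?a 2 / ?a 1) ^ r" using lc(1)[of 2] p by simp
    have "(?a 2 / ?a 1) ^ r * ?a (2 * n - r) \<le> ?a (2 * n - r + r)"
      by (rule log_convex_power[of ?a, OF lc rn(2)[OF r]])
    then show "(?a 2 / ?a 1) ^ r \<le> ?a (2 * n) / c r" using rn(1)[OF r] cpos[OF r] by (simp add: c_def le_divide_eq)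
  qed
  also have "\<dots> = ?a (2 * n) ^ length rs / prod_list (map c rs)" by (rule prod_list_divide)
  also have "\<dots> \<le> (\<integral>x. d x ^ length rs \<partial>unif)\<^sup>2 / prod_list (map c rs)"
    using power_mean_integral[OF bmd d0 rs(2)] P unfolding d2 by (intro divide_right_mono) auto
  also note *
  finally show ?thesis .
qed

lemma moment_ratio_ge: assumes "psd K" "moment K (\<lambda>_. 1) 1 > 0"
  shows "moment K (\<lambda>_. 1) 1 \<le> moment K (\<lambda>_. 1) 2 / moment K (\<lambda>_. 1) 1"
  using moment_log_convex[OF assms(1) bdd_borel_const[of 1], of 0] assms(2)
  by (simp add: moment_1 le_divide_eq power2_eq_square numeral_2_eq_2)

lemma integral_theta_kernel_ge:
  fixes K :: "real \<times> real \<Rightarrow> real"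
  assumes K: "psd K" "\<And>z. 0 \<le> K z" and rs: "\<forall>r\<in>set rs. r \<ge> 1" "rs \<noteq> []"
  shows "(\<integral>z. K z \<partial>unif2) ^ sum_list rs \<le> (\<integral>z. theta_kernel rs K z \<partial>unif2)"
proof (cases "moment K (\<lambda>_. 1) 1 = 0")
  case True
  have "sum_list rs > 0" using rs by (cases rs) auto
  then show ?thesis using True psd_integral_nonneg[OF psd_theta_kernel[OF K(1) rs(1)]]
    by (simp add: integral_kernel psd_bdd_borel K zero_power del: sum_list_eq_0_iff)
next
  case False
  let ?a = "moment K (\<lambda>_. 1)"
  have p: "?a 1 > 0" using False moment_nonneg[OF K(1) bdd_borel_const[of 1], of 1] by simp
  note lc = moment_nonneg[OF K(1) bdd_borel_const, of 1] moment_log_convex[OF K(1) bdd_borel_const, of 1] p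
  note ratio = moment_ratio_ge[OF K(1) p]
  have "?a 1 ^ sum_list rs \<le> (\<integral>z. theta_kernel rs K z \<partial>unif2)"
  proof (cases "length rs \<ge> 2")
    case True
    have "?a 1 ^ sum_list rs \<le> (?a 2 / ?a 1) ^ sum_list rs" using ratio p by (intro power_mono) auto
    also have "\<dots> \<le> (\<integral>z. theta_kernel rs K z \<partial>unif2)" by (rule integral_theta_kernel_ge_ratio[OF K p rs(1) True])
    finally show ?thesis .
  next
    case False
    obtain r rs' where "rs = r # rs'" using rs(2) by (cases rs) auto
    with False have r: "rs = [r]" by (cases rs') auto
    have "?a 1 ^ r = ?a 1 ^ (r - 1) * ?a 1" using rs(1) r by (simp add: power_eq_if)
    also have "\<dots> \<le> (?a 2 / ?a 1) ^ (r - 1) * ?a 1" using ratio p by (intro mult_right_mono power_mono) auto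
    also have "\<dots> \<le> ?a (1 + (r - 1))" by (rule log_convex_power[of ?a, OF lc]) simp
    finally show ?thesis using rs r K by (simp add: theta_kernel_def integral_kpow psd_bdd_borel)
  qed
  then show ?thesis by (simp add: integral_kernel psd_bdd_borel K)
qed

section \<open>Regular kernels and the equality case\<close>

definition degree_regular :: "real \<Rightarrow> (real \<times> real \<Rightarrow> real) \<Rightarrow> bool" where
  "degree_regular p K \<longleftrightarrow> (AE x in unif. kop K (\<lambda>_. 1) x = p)"

lemma ip_one_left: "ip (\<lambda>_. 1) f = (\<integral>x. f x \<partial>unif)" by (simp add: ip_def)
lemma ip_one_right: "ip f (\<lambda>_. 1) = (\<integral>x. f x \<partial>unif)" by (simp add: ip_def)

lemma regular_ip_one:
  assumes "bdd_borel K" "degree_regular p K" "bdd_borel f" shows "ip f (kop K (\<lambda>_. 1)) = p * (\<integral>x. f x \<partial>unif)"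
proof -
  have "ip f (kop K (\<lambda>_. 1)) = ip (kop K (\<lambda>_. 1)) f" by (rule ip_commute)
  also have "\<dots> = ip (\<lambda>_. p) f"
    using assms by (intro ip_cong_AE) (auto simp: degree_regular_def)
  also have "\<dots> = p * (\<integral>x. f x \<partial>unif)" by (simp add: ip_def)
  finally show ?thesis .
qed

lemma regular_integral_kop:
  assumes "bdd_borel K" "sym_kernel K" "degree_regular p K" "bdd_borel f"
  shows "(\<integral>x. kop K f x \<partial>unif) = p * (\<integral>x. f x \<partial>unif)"
  using regular_ip_one[OF assms(1,3,4)] ip_kop_sym[OF assms(1,2,4) bdd_borel_const[of 1]]
  by (simp add: ip_one_right)

lemma regular_integral_iter:
  assumes "bdd_borel K" "sym_kernel K" "degree_regular p K" "bdd_borel f"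
  shows "(\<integral>x. (kop K ^^ n) f x \<partial>unif) = p ^ n * (\<integral>x. f x \<partial>unif)"
  by (induction n) (auto simp: regular_integral_kop[OF assms(1-3)] bdd_borel_kop_iter assms)

lemma regular_moment: assumes "bdd_borel K" "sym_kernel K" "degree_regular p K"
  shows "moment K (\<lambda>_. 1) n = p ^ n"
  using regular_integral_iter[OF assms bdd_borel_const[of 1], of n] unif.prob_space
  by (simp add: moment_def ip_one_left)

lemma integral_minus_mean: "bdd_borel f \<Longrightarrow> (\<integral>x. f x - (\<integral>x. f x \<partial>unif) \<partial>unif) = 0"
  using unif.prob_space by simp

text \<open>Constant functions are eigenfunctions of a regular kernel, so the form splits into a mean-zero part and a constant
part.\<close>

lemma regular_quadratic_form:
  assumes K: "bdd_borel K" "sym_kernel K" "degree_regular p K" and f: "bdd_borel f"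
  defines "\<mu> \<equiv> \<integral>x. f x \<partial>unif"
  shows "ip f ((kop K ^^ r) f) = ip (\<lambda>x. f x - \<mu>) ((kop K ^^ r) (\<lambda>x. f x - \<mu>)) + p ^ r * \<mu>\<^sup>2"
proof -
  let ?T = "\<lambda>f. (kop K ^^ r) f" and ?g = "\<lambda>x. f x - \<mu>"
  have g: "bdd_borel ?g" using f by (intro bdd_borel_intros)
  have g0: "(\<integral>x. ?g x \<partial>unif) = 0" unfolding \<mu>_def by (rule integral_minus_mean[OF f])
  have lin: "?T (\<lambda>x. u x + c * w x) = (\<lambda>x. ?T u x + c * ?T w x)" if "bdd_borel u" "bdd_borel w" for u w c
    using that K by (induction r) (auto simp: kop_add kop_scale bdd_borel_kop_iter bdd_borel_mult)
  have "?T f = ?T (\<lambda>x. ?g x + \<mu> * 1)" by simp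
  also have "\<dots> = (\<lambda>x. ?T ?g x + \<mu> * ?T (\<lambda>_. 1) x)" by (rule lin[OF g bdd_borel_const])
  finally have "ip f (?T f) = ip (\<lambda>x. ?g x + \<mu> * 1) (\<lambda>x. ?T ?g x + \<mu> * ?T (\<lambda>_. 1) x)" by simp
  also have "\<dots> = ip ?g (?T ?g) + \<mu> * ip ?g (?T (\<lambda>_. 1)) + (\<mu> * ip (\<lambda>_. 1) (?T ?g) + \<mu> * (\<mu> * ip (\<lambda>_. 1) (?T (\<lambda>_. 1))))"
    using g K by (simp only: ip_simps bdd_borel_intros bdd_borel_kop_iter) (simp add: distrib_left)
  finally have e: "ip f (?T f) = ip ?g (?T ?g) + \<mu> * ip ?g (?T (\<lambda>_. 1)) + (\<mu> * ip (\<lambda>_. 1) (?T ?g) + \<mu> * (\<mu> * ip (\<lambda>_. 1) (?T (\<lambda>_. 1))))" .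
  have 1: "ip (\<lambda>_. 1) (?T ?g) = 0" "ip (\<lambda>_. 1) (?T (\<lambda>_. 1)) = p ^ r"
    using regular_integral_iter[OF K g] regular_integral_iter[OF K bdd_borel_const[of 1]] g0 unif.prob_space
    by (auto simp: ip_one_left)
  have 2: "ip ?g (?T (\<lambda>_. 1)) = 0"
    using ip_kop_iter[OF K(1,2) g bdd_borel_const, of r 1] regular_integral_iter[OF K g] g0 by (simp add: ip_one_right)
  show ?thesis unfolding e 1 2 by (simp add: power2_eq_square mult_ac)
qed

lemma regular_kpow_dominates_const:
  assumes "psd K" "degree_regular p K" "p \<ge> 0" "r \<ge> 1"
  shows "dominates (kpow K r) (\<lambda>_. sqrt (p ^ r))"
proof (rule dominatesI)
  have K: "bdd_borel K" "sym_kernel K" using assms by (auto simp: psd_def)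
  show "bdd_borel (kpow K r)" "sym_kernel (kpow K r)" using K by (auto intro: bdd_borel_kpow sym_kernel_kpow)
  fix f :: "real \<Rightarrow> real" assume f: "bdd_borel f"
  let ?\<mu> = "\<integral>x. f x \<partial>unif"
  have g: "bdd_borel (\<lambda>x. f x - ?\<mu>)" using f by (intro bdd_borel_intros)
  have "0 \<le> ip (\<lambda>x. f x - ?\<mu>) (kop (kpow K r) (\<lambda>x. f x - ?\<mu>))"
    by (rule psd_nonneg[OF psd_kpow[OF assms(1,4)] g])
  then show "(ip f (\<lambda>_. sqrt (p ^ r)))\<^sup>2 \<le> ip f (kop (kpow K r) f)"
    using regular_quadratic_form[OF K assms(2) f, of r] K f g assms(3,4)
    by (simp add: kop_kpow ip_def[of f "\<lambda>_. _"] power_mult_distrib mult.commute)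
qed simp

text \<open>For mean-zero \<open>u\<close> the function \<open>K\<^sup>n u\<close> is orthogonal to the constants, so the minorant of
\<open>K\<^sup>r\<close> given by \<open>u\<close> survives the subtraction of the constant part.\<close>

lemma regular_kpow_minus_const_dominates:
  assumes "psd K" "degree_regular p K" "bdd_borel u" "(\<integral>x. u x \<partial>unif) = 0" "1 \<le> r" "r \<le> n"
    and c: "moment K u (2 * n - r) > 0"
  shows "dominates (\<lambda>z. kpow K r z - p ^ r) (\<lambda>x. (kop K ^^ n) u x / sqrt (moment K u (2 * n - r)))"
proof (rule dominatesI)
  have K: "bdd_borel K" "sym_kernel K" using assms by (auto simp: psd_def)
  let ?v = "(kop K ^^ n) u" and ?c = "moment K u (2 * n - r)"
  have v: "bdd_borel ?v" using K assms by (intro bdd_borel_kop_iter)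
  have v0: "(\<integral>x. ?v x \<partial>unif) = 0" using regular_integral_iter[OF K assms(2,3)] assms(4) by simp
  show "bdd_borel (\<lambda>z. kpow K r z - p ^ r)" using K by (intro bdd_borel_intros bdd_borel_kpow)
  show "sym_kernel (\<lambda>z. kpow K r z - p ^ r)" using sym_kernel_kpow[OF K, of r] unfolding sym_kernel_def by (auto simp del: split_paired_All)
  show "bdd_borel (\<lambda>x. ?v x / sqrt ?c)" using v by (intro bdd_borel_intros)
  fix f :: "real \<Rightarrow> real" assume f: "bdd_borel f"
  let ?\<mu> = "\<integral>x. f x \<partial>unif"
  let ?g = "\<lambda>x. f x - ?\<mu>"
  have g: "bdd_borel ?g" using f by (intro bdd_borel_intros)
  have "dominates (kpow K r) (\<lambda>x. ?v x / sqrt ?c)"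
    by (rule kpow_dominates) (use assms in auto)
  then have "0 \<le> ip ?g (kop (\<lambda>z. kpow K r z - (?v (fst z) / sqrt ?c) * (?v (snd z) / sqrt ?c)) ?g)"
    using g by (simp add: dominates_def psd_def)
  also have "\<dots> = ip ?g ((kop K ^^ r) ?g) - (ip ?g (\<lambda>x. ?v x / sqrt ?c))\<^sup>2"
  proof -
    have b: "bdd_borel (\<lambda>z::real\<times>real. (?v (fst z) / sqrt ?c) * (?v (snd z) / sqrt ?c))" "bdd_borel (kpow K r)"
      using bdd_borel_kpow[OF K(1)] by (auto intro!: bdd_borel_intros v)
    show ?thesis
      unfolding kop_diff[OF b(2,1) g] ip_diff_right[OF bdd_borel_kop[OF b(2) g] bdd_borel_kop[OF b(1) g] g] ip_kop_rank_one[of ?g "\<lambda>x. ?v x / sqrt ?c"]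
      using assms(5) K g by (simp add: kop_kpow ip_commute[of "\<lambda>x. ?v x / sqrt ?c"] power2_eq_square)
  qed
  also have "ip ?g (\<lambda>x. ?v x / sqrt ?c) = ip f (\<lambda>x. ?v x / sqrt ?c)"
    using bdd_borel_mult[OF f v] v v0 by (simp add: ip_def left_diff_distrib bdd_borel_divide)
  finally have 1: "(ip f (\<lambda>x. ?v x / sqrt ?c))\<^sup>2 \<le> ip ?g ((kop K ^^ r) ?g)" by simp
  have "ip f (kop (\<lambda>z. kpow K r z - p ^ r) f) = ip f ((kop K ^^ r) f) - p ^ r * ?\<mu>\<^sup>2"
  proof -
    have "kop (\<lambda>z. p ^ r) f = (\<lambda>x. p ^ r * ?\<mu>)" by (simp add: kop_def fun_eq_iff)
    then have "ip f (kop (\<lambda>z. p ^ r) f) = p ^ r * ?\<mu>\<^sup>2" using f by (simp add: ip_def power2_eq_square mult_ac)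
    then show ?thesis using f K assms(5)
      by (simp add: kop_diff[OF bdd_borel_kpow[OF K(1)] bdd_borel_const f] ip_diff_right bdd_borel_kop bdd_borel_kpow kop_kpow bdd_borel_kop_iter)
  qed
  then show "(ip f (\<lambda>x. ?v x / sqrt ?c))\<^sup>2 \<le> ip f (kop (\<lambda>z. kpow K r z - p ^ r) f)"
    using 1 regular_quadratic_form[OF K assms(2) f, of r] by simp
qed

text \<open>By Cauchy--Schwarz, \<open>K\<^bsup>n+2\<^esup> u = 0\<close> implies \<open>\<langle>K\<^bsup>n+1\<^esup> u, K\<^bsup>n+1\<^esup> u\<rangle> = \<langle>K\<^sup>n u, K\<^bsup>n+2\<^esup> u\<rangle> = 0\<close>.\<close>

lemma moment_eq_zero_descend:
  assumes "psd K" "bdd_borel u" shows "moment K u (2 * Suc n) = 0 \<Longrightarrow> moment K u 2 = 0"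
proof (induction n)
  case (Suc n)
  have b: "bdd_borel ((kop K ^^ i) u)" for i using assms by (auto simp: psd_def intro: bdd_borel_kop_iter)
  have "(ip ((kop K ^^ n) u) ((kop K ^^ (n + 2)) u))\<^sup>2
      \<le> ip ((kop K ^^ n) u) ((kop K ^^ n) u) * ip ((kop K ^^ (n + 2)) u) ((kop K ^^ (n + 2)) u)"
    by (rule ip_Cauchy_Schwarz[OF b b])
  also have "\<dots> = 0" using Suc.prems unfolding ip_iter_moment[OF assms] by (simp add: mult_2)
  finally have "ip ((kop K ^^ n) u) ((kop K ^^ (n + 2)) u) = 0" by simp
  then have "moment K u (2 * Suc n) = 0" unfolding ip_iter_moment[OF assms] by (simp add: mult_2)
  then show ?case by (rule Suc.IH)
qed (simp add: numeral_2_eq_2)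

text \<open>\<open>F\<close> has the same cell masses as the zero function on every grid, so the integral of \<open>F F\<close> is arbitrarily
small.\<close>

lemma kernel_zero_if_tests_zero:
  assumes F: "bdd_borel F" and "\<And>f g. bdd_borel f \<Longrightarrow> bdd_borel g \<Longrightarrow> (\<integral>z. F z * (f (fst z) * g (snd z)) \<partial>unif2) = 0"
  shows "AE z in unif2. F z = (0::real)"
proof -
  obtain D where D: "D > 0" "\<And>z. \<bar>F z\<bar> \<le> D" by (rule bdd_borel_bound[OF F], rule that)
  have "(\<integral>z. F z * F z \<partial>unif2) \<le> 0"
  proof (rule field_le_epsilon)
    fix \<delta> :: real assume "\<delta> > 0"
    obtain N where N: "N > 0" and test:
    "\<And>G G'. bdd_borel G \<Longrightarrow> bdd_borel G' \<Longrightarrow> (\<And>z. \<bar>G z\<bar> \<le> D) \<Longrightarrow> (\<And>z. \<bar>G' z\<bar> \<le> D) \<Longrightarrow>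
      same_cell_masses N G G' \<Longrightarrow>
      \<bar>(\<integral>z. G z * F z \<partial>unif2) - (\<integral>z. G' z * F z \<partial>unif2)\<bar> \<le> \<delta>"
      by (rule cell_test[OF F \<open>\<delta> > 0\<close>, of D]) (use D in auto)
    have "\<bar>(\<integral>z. F z * F z \<partial>unif2) - (\<integral>z. 0 * F z \<partial>unif2)\<bar> \<le> \<delta>"
    proof (rule test[OF F bdd_borel_const D(2)])
      show "\<bar>0::real\<bar> \<le> D" using D by simp
      show "same_cell_masses N F (\<lambda>_. 0)"
        unfolding same_cell_masses_def using assms(2)[OF bdd_borel_cell_ind bdd_borel_cell_ind] by simp
    qed
    then show "(\<integral>z. F z * F z \<partial>unif2) \<le> 0 + \<delta>" by simp
  qed
  moreover have "(\<integral>z. F z * F z \<partial>unif2) \<ge> 0" by simp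
  ultimately have "(\<integral>z. F z * F z \<partial>unif2) = 0" by simp
  then have "AE z in unif2. F z * F z = 0"
    using integral_nonneg_eq_0_iff_AE[of "unif2" "\<lambda>z. F z * F z"] bdd_borel_mult[OF F F] by auto
  then show ?thesis by simp
qed

lemma regular_const_if_second_moments_zero:
  assumes K: "psd K" "degree_regular p K"
    and zero: "\<And>u. bdd_borel u \<Longrightarrow> (\<integral>x. u x \<partial>unif) = 0 \<Longrightarrow> moment K u 2 = 0"
  shows "AE z in unif2. K z = p"
proof -
  have bmK: "bdd_borel K" using K by (auto simp: psd_def)
  have "AE z in unif2. K z - p = 0"
  proof (rule kernel_zero_if_tests_zero)
    show "bdd_borel (\<lambda>z. K z - p)" using bmK by (intro bdd_borel_intros)
    fix f g :: "real \<Rightarrow> real" assume f: "bdd_borel f" and g: "bdd_borel g"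
    define \<mu> where "\<mu> = (\<integral>x. g x \<partial>unif)"
    let ?u = "\<lambda>x. g x - \<mu>"
    have u: "bdd_borel ?u" using g by (intro bdd_borel_intros)
    have "moment K ?u 2 = 0" using zero[OF u] integral_minus_mean[OF g] by (simp add: \<mu>_def)
    then have "ip (kop K ?u) (kop K ?u) = 0"
      using ip_iter_moment[OF K(1) u, of 1 1] by (simp add: numeral_2_eq_2)
    then have "(ip f (kop K ?u))\<^sup>2 \<le> 0" using ip_Cauchy_Schwarz[OF f bdd_borel_kop[OF bmK u]] by simp
    then have 0: "ip f (kop K ?u) = 0" by simp
    have "kop K g = kop K (\<lambda>x. ?u x + \<mu> * 1)" by simp
    also have "\<dots> = (\<lambda>x. kop K ?u x + \<mu> * kop K (\<lambda>_. 1) x)"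
      using kop_add[OF bmK u bdd_borel_const[of "\<mu> * 1"]] kop_scale[of K \<mu> "\<lambda>_. 1"] by simp
    finally have "ip f (kop K g) = ip f (kop K ?u) + \<mu> * ip f (kop K (\<lambda>_. 1))"
      using f u bmK by (simp add: ip_add_right ip_scale_right bdd_borel_kop bdd_borel_mult)
    also have "\<dots> = \<mu> * (p * (\<integral>x. f x \<partial>unif))" using 0 regular_ip_one[OF bmK K(2) f] by simp
    finally have e: "(\<integral>z. f (fst z) * K z * g (snd z) \<partial>unif2) = p * ((\<integral>x. f x \<partial>unif) * (\<integral>x. g x \<partial>unif))"
      unfolding ip_kop[OF bmK f g] \<mu>_def by (simp add: mult_ac)
    have i: "bdd_borel (\<lambda>z. f (fst z) * K z * g (snd z))" "bdd_borel (\<lambda>z::real\<times>real. f (fst z) * g (snd z))"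
      by (intro bdd_borel_intros f g bmK)+
    have "(\<integral>z. (K z - p) * (f (fst z) * g (snd z)) \<partial>unif2)
        = (\<integral>z. f (fst z) * K z * g (snd z) - p * (f (fst z) * g (snd z)) \<partial>unif2)"
      by (simp add: algebra_simps)
    also have "\<dots> = 0"
      using i integrable_bdd_borel2[OF i(1)] integrable_bdd_borel2[OF i(2)] by (simp add: e integral_tensor f g)
    finally show "(\<integral>z. (K z - p) * (f (fst z) * g (snd z)) \<partial>unif2) = 0" .
  qed
  then show ?thesis by simp
qed

text \<open>The variance of the degree function is \<open>a\<^sub>2 - a\<^sub>1\<^sup>2\<close>.\<close>

lemma regular_if_second_moment_le:
  assumes "psd K" "moment K (\<lambda>_. 1) 2 \<le> p\<^sup>2" "moment K (\<lambda>_. 1) 1 = p"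
  shows "degree_regular p K"
proof -
  have bmK: "bdd_borel K" using assms by (auto simp: psd_def)
  let ?d = "kop K (\<lambda>_. 1)"
  have d: "bdd_borel ?d" using bmK by auto
  have dd: "(\<integral>x. ?d x * ?d x \<partial>unif) = moment K (\<lambda>_. 1) 2" "(\<integral>x. ?d x \<partial>unif) = p"
    using ip_iter_moment[OF assms(1) bdd_borel_const[of 1], of 1 1] assms(3)
    by (simp_all add: ip_def numeral_2_eq_2 moment_def)
  have "ip (\<lambda>x. ?d x - p) (\<lambda>x. ?d x - p) = (\<integral>x. ?d x * ?d x - 2 * p * ?d x + p\<^sup>2 \<partial>unif)"
    unfolding ip_def by (intro Bochner_Integration.integral_cong) (auto simp: algebra_simps power2_eq_square)
  also have "\<dots> = moment K (\<lambda>_. 1) 2 - p\<^sup>2"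
    using d bdd_borel_mult[OF d d] unif.prob_space by (simp add: dd power2_eq_square)
  finally have "ip (\<lambda>x. ?d x - p) (\<lambda>x. ?d x - p) = 0"
    using assms(2) ip_self_nonneg[of "\<lambda>x. ?d x - p"] by simp
  from ip_self_zero[OF bdd_borel_diff[OF d bdd_borel_const] this] show ?thesis
    by (simp add: degree_regular_def)
qed

text \<open>Write the first two branches as \<open>p\<^sup>r\<^sup>1 + A\<close> and \<open>p\<^sup>r\<^sup>2 + B\<close>. The integrals of \<open>A\<close> and \<open>B\<close>
vanish, while both kernels dominate multiples of the rank-one kernel of \<open>v = K\<^sup>n u\<close>; so the product \<open>A B\<close> contributes at least a positive
multiple of \<open>(\<integral> v\<^sup>2)\<^sup>2\<close>. The remaining branches dominate constants and cannot lose this gain.\<close>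

lemma regular_integral_theta_kernel_strict:
  assumes K: "psd K" "degree_regular p K" "p > 0" and rs: "\<forall>r\<in>set rs. r \<ge> 1" "length rs \<ge> 2"
    and u: "bdd_borel u" "(\<integral>x. u x \<partial>unif) = 0" "moment K u (2 * sum_list rs) > 0"
  shows "p ^ sum_list rs < (\<integral>z. theta_kernel rs K z \<partial>unif2)"
proof -
  obtain r1 r2 rest where r: "rs = r1 # r2 # rest" using rs(2)
    by (cases rs; cases "tl rs") auto
  define n where "n = sum_list rs"
  have bk: "bdd_borel K" "sym_kernel K" using K by (auto simp: psd_def)
  have rn: "1 \<le> r1" "r1 \<le> n" "1 \<le> r2" "r2 \<le> n" using rs(1) r by (auto simp: n_def)
  let ?v = "(kop K ^^ n) u" and ?c = "\<lambda>r. moment K u (2 * n - r)"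
  have v: "bdd_borel ?v" using bk u by (intro bdd_borel_kop_iter)
  \<comment> \<open>otherwise Cauchy--Schwarz would make the moment of order \<open>2 * n\<close> vanish\<close>
  have cpos: "?c r > 0" if "r \<le> n" for r
  proof -
    have "(ip ?v ((kop K ^^ r) ((kop K ^^ (n - r)) u)))\<^sup>2 \<le> ip ?v ((kop K ^^ r) ?v) * ip ((kop K ^^ (n - r)) u) ((kop K ^^ r) ((kop K ^^ (n - r)) u))"
      using bk u by (intro kop_iter_Cauchy_Schwarz K bdd_borel_kop_iter)
    also have "(kop K ^^ r) ((kop K ^^ (n - r)) u) = ?v"
      using that by (metis funpow_add le_add_diff_inverse comp_apply)
    finally have "(moment K u (2 * n))\<^sup>2 \<le> ip ?v ((kop K ^^ r) ?v) * ?c r"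
      using that by (simp add: ip_iter_moment[OF K(1) u(1)] mult_2)
    then have "?c r \<noteq> 0" using u(3) by (auto simp: n_def)
    then show ?thesis using moment_nonneg[OF K(1) u(1), of "2 * n - r"] by simp
  qed
  let ?A = "\<lambda>z. kpow K r1 z - p ^ r1" and ?B = "\<lambda>z. kpow K r2 z - p ^ r2"
  have "dominates (\<lambda>z. ?A z * ?B z) (\<lambda>x. ?v x / sqrt (?c r1) * (?v x / sqrt (?c r2)))"
    by (intro dominates_mult regular_kpow_minus_const_dominates K u rn cpos)
  from dominates_integral[OF this]
  have le: "(\<integral>x. ?v x / sqrt (?c r1) * (?v x / sqrt (?c r2)) \<partial>unif)\<^sup>2 \<le> (\<integral>z. ?A z * ?B z \<partial>unif2)" .
  have eq: "(\<integral>x. ?v x / sqrt (?c r1) * (?v x / sqrt (?c r2)) \<partial>unif) = moment K u (2 * n) / (sqrt (?c r1) * sqrt (?c r2))"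
    using ip_iter_moment[OF K(1) u(1), of n n] by (simp add: ip_def mult_2)
  have pos: "0 < (moment K u (2 * n) / (sqrt (?c r1) * sqrt (?c r2)))\<^sup>2"
    using u(3) cpos[OF rn(2)] cpos[OF rn(4)] by (intro zero_less_power divide_pos_pos mult_pos_pos) (auto simp: n_def)
  have AB: "(\<integral>z. ?A z * ?B z \<partial>unif2) > 0"
    using pos le unfolding eq by (rule less_le_trans)
  have bA: "bdd_borel (kpow K r)" for r using bk by (intro bdd_borel_kpow)
  have int: "(\<integral>z. kpow K r z \<partial>unif2) = p ^ r" if "r \<ge> 1" for r
    using that bk K by (simp add: integral_kpow regular_moment)
  have "(\<integral>z. ?A z * ?B z \<partial>unif2) = (\<integral>z. kpow K r1 z * kpow K r2 z - p ^ r2 * kpow K r1 z - p ^ r1 * kpow K r2 z + p ^ r1 * p ^ r2 \<partial>unif2)"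
    by (rule Bochner_Integration.integral_cong[OF refl]) (simp only: algebra_simps)
  also have "\<dots> = (\<integral>z. kpow K r1 z * kpow K r2 z \<partial>unif2) - p ^ r1 * p ^ r2"
    using bA[of r1] bA[of r2] bdd_borel_mult[OF bA[of r1] bA[of r2]] unif2.P.prob_space rn
    by (simp add: int)
  finally have gt: "p ^ r1 * p ^ r2 < (\<integral>z. kpow K r1 z * kpow K r2 z \<partial>unif2)" using AB by simp
  \<comment> \<open>the other branches together dominate the constant \<open>q\<close>\<close>
  define q where "q = p ^ sum_list rest"
  have "dominates (theta_kernel rest K) (\<lambda>x. prod_list (map (\<lambda>r. sqrt (p ^ r)) rest))"
    unfolding theta_kernel_def using K rs(1) r by (intro dominates_prod_list regular_kpow_dominates_const) auto
  then have "psd (\<lambda>z. theta_kernel rest K z - q)"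
    using K(3) by (simp add: dominates_def prod_list_sqrt prod_list_power q_def)
  moreover have "psd (\<lambda>z. kpow K r1 z * kpow K r2 z)" using K rn by (intro psd_mult psd_kpow)
  ultimately have "psd (\<lambda>z. (kpow K r1 z * kpow K r2 z) * (theta_kernel rest K z - q))" by (rule psd_mult[rotated])
  from psd_integral_nonneg[OF this]
  have "0 \<le> (\<integral>z. theta_kernel rs K z - q * (kpow K r1 z * kpow K r2 z) \<partial>unif2)"
    by (simp add: theta_kernel_def r algebra_simps)
  also have "\<dots> = (\<integral>z. theta_kernel rs K z \<partial>unif2) - q * (\<integral>z. kpow K r1 z * kpow K r2 z \<partial>unif2)"
    using bdd_borel_theta_kernel[OF bk(1), of rs] bdd_borel_mult[OF bA[of r1] bA[of r2]] by simp
  finally have "q * (\<integral>z. kpow K r1 z * kpow K r2 z \<partial>unif2) \<le> (\<integral>z. theta_kernel rs K z \<partial>unif2)" by simp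
  moreover have "q * (p ^ r1 * p ^ r2) < q * (\<integral>z. kpow K r1 z * kpow K r2 z \<partial>unif2)"
    using gt K(3) by (simp add: q_def)
  moreover have "q * (p ^ r1 * p ^ r2) = p ^ sum_list rs" by (simp add: r q_def power_add mult_ac)
  ultimately show ?thesis by linarith
qed

text \<open>Equality first forces regularity through the second moment; then the strict bound leaves no mean-zero
\<open>u\<close> with \<open>K\<^sup>n u \<noteq> 0\<close>.\<close>

lemma const_if_integral_theta_kernel_le:
  fixes K :: "real \<times> real \<Rightarrow> real"
  assumes K: "psd K" "\<And>z. 0 \<le> K z" and p: "p > 0" "(\<integral>z. K z \<partial>unif2) = p"
    and rs: "\<forall>r\<in>set rs. r \<ge> 1" "length rs \<ge> 2"
    and le: "(\<integral>z. theta_kernel rs K z \<partial>unif2) \<le> p ^ sum_list rs"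
  shows "AE z in unif2. K z = p"
proof -
  let ?a = "moment K (\<lambda>_. 1)"
  have a1: "?a 1 = p" using p integral_kernel[OF psd_bdd_borel[OF K(1)]] by simp
  have pos: "sum_list rs > 0" using rs by (cases rs) auto
  have "(?a 2 / p) ^ sum_list rs \<le> p ^ sum_list rs"
    using integral_theta_kernel_ge_ratio[of K, OF K _ rs] le p a1 by simp
  moreover obtain m where "sum_list rs = Suc m" using pos gr0_implies_Suc by blast
  ultimately have "?a 2 / p \<le> p" using p(1) power_le_imp_le_base[of "?a 2 / p" m p] by simp
  then have "?a 2 \<le> p\<^sup>2" using p(1) by (simp add: divide_le_eq power2_eq_square)
  then have reg: "degree_regular p K" by (rule regular_if_second_moment_le[OF K(1) _ a1])
  show ?thesis
  proof (rule regular_const_if_second_moments_zero[OF K(1) reg])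
    fix u :: "real \<Rightarrow> real" assume u: "bdd_borel u" "(\<integral>x. u x \<partial>unif) = 0"
    have "\<not> moment K u (2 * sum_list rs) > 0"
      using regular_integral_theta_kernel_strict[OF K(1) reg p(1) rs u] le by linarith
    then have "moment K u (2 * sum_list rs) = 0" using moment_nonneg[OF K(1) u(1), of "2 * sum_list rs"] by simp
    then show "moment K u 2 = 0" using moment_eq_zero_descend[OF K(1) u(1), of "sum_list rs - 1"] pos by simp
  qed
qed

text \<open>This replaces the preceding lemma for patterns with a single branch, where the integral of \<open>K\<^sup>r\<close> alone does not
determine \<open>K\<close>.\<close>

lemma const_if_kpow_const:
  fixes K :: "real \<times> real \<Rightarrow> real"
  assumes K: "psd K" and p: "p > 0" "(\<integral>z. K z \<partial>unif2) = p"
    and r: "r \<ge> 1" and const: "AE z in unif2. kpow K r z = p ^ r"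
  shows "AE z in unif2. K z = p"
proof (cases "r = 1")
  case True
  then show ?thesis using const by simp
next
  case False
  then have r2: "r \<ge> 2" using r by simp
  let ?a = "moment K (\<lambda>_. 1)"
  have bk: "bdd_borel K" "sym_kernel K" using K by (auto simp: psd_def)
  have a1: "?a 1 = p" using p integral_kernel[OF bk(1)] by simp
  have kc: "(\<integral>z. F z * kpow K r z \<partial>unif2) = p ^ r * (\<integral>z. F z \<partial>unif2)" if "bdd_borel F" for F
  proof -
    have "(\<integral>z. F z * kpow K r z \<partial>unif2) = (\<integral>z. F z * p ^ r \<partial>unif2)"
    proof (rule integral_cong_AE)
      show "(\<lambda>z. F z * kpow K r z) \<in> borel_measurable unif2" "(\<lambda>z. F z * p ^ r) \<in> borel_measurable unif2"
        using bdd_borel_measurable[OF bdd_borel_mult[OF that bdd_borel_kpow[OF bk(1), of r]]] bdd_borel_measurable[OF bdd_borel_mult[OF that bdd_borel_const[of "p ^ r"]]] by simp_all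
      show "AE z in unif2. F z * kpow K r z = F z * p ^ r" using const by eventually_elim simp
    qed
    then show ?thesis by simp
  qed
  have ar: "?a r = p ^ r" using kc[of "\<lambda>_. 1"] integral_kpow[OF bk(1) r] unif2.P.prob_space by simp
  note lc = moment_nonneg[OF K bdd_borel_const, of 1] moment_log_convex[OF K bdd_borel_const, of 1]
  have "(?a 2 / p) ^ (r - 1) * p \<le> ?a (1 + (r - 1))"
    using log_convex_power[of ?a, OF lc, of 1 "r - 1"] a1 p by simp
  also have "\<dots> = p ^ (r - 1) * p" using ar r by (simp add: power_eq_if)
  finally have "(?a 2 / p) ^ (r - 1) \<le> p ^ (r - 1)" using p(1) by simp
  moreover have "r - 1 = Suc (r - 2)" using r2 by simp
  ultimately have "?a 2 / p \<le> p" using p(1) power_le_imp_le_base[of "?a 2 / p" "r - 2" p] by simp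
  then have "?a 2 \<le> p\<^sup>2" using p(1) by (simp add: divide_le_eq power2_eq_square)
  then have reg: "degree_regular p K" by (rule regular_if_second_moment_le[OF K _ a1])
  show ?thesis
  proof (rule regular_const_if_second_moments_zero[OF K reg])
    fix u :: "real \<Rightarrow> real" assume u: "bdd_borel u" "(\<integral>x. u x \<partial>unif) = 0"
    let ?w = "(kop K ^^ r) u"
    have w: "bdd_borel ?w" using bk u by (intro bdd_borel_kop_iter)
    have "moment K u (2 * r) = ip ?w (kop (kpow K r) u)"
      using ip_iter_moment[OF K u(1), of r r] r u bk by (simp add: kop_kpow mult_2)
    also have "\<dots> = (\<integral>z. (?w (fst z) * u (snd z)) * kpow K r z \<partial>unif2)"
      unfolding ip_kop[OF bdd_borel_kpow[OF bk(1)] w u(1)] by (simp add: mult_ac)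
    also have "\<dots> = 0" using kc[OF bdd_borel_tensor[OF w u(1)]] integral_tensor[OF w u(1)] u(2) by simp
    finally show "moment K u 2 = 0" using moment_eq_zero_descend[OF K u(1), of "r - 1"] r by simp
  qed
qed

section \<open>Regular locally dense kernels\<close>

text \<open>An affine map turns a bounded function into a weight with values in \<open>[0, 1]\<close>, to which local density applies.
By regularity the form of \<open>W\<close> minus \<open>\<rho>\<close> times the squared mean depends on the mean-zero part of the function only, so the inequality for
the weight is one for the original function.\<close>

lemma psd_if_locally_dense_regular:
  fixes W :: "real \<times> real \<Rightarrow> real"
  assumes W: "bdd_borel W" "sym_kernel W" and reg: "degree_regular \<rho> W"
    and dense: "\<And>S. S \<in> sets borel \<Longrightarrow> \<rho> * (\<integral>x. indicator S x \<partial>unif)\<^sup>2 \<le> (\<integral>z. indicator S (fst z) * W z * indicator S (snd z) \<partial>unif2)"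
    and "\<rho> \<ge> 0"
  shows "psd W"
  unfolding psd_def
proof (intro conjI allI impI W)
  fix f :: "real \<Rightarrow> real" assume f: "bdd_borel f"
  obtain C where C: "C > 0" "\<And>x. \<bar>f x\<bar> \<le> C" by (rule bdd_borel_bound[OF f], rule that)
  \<comment> \<open>an affine image of \<open>f\<close> with values in \<open>[0, 1]\<close>\<close>
  define g where "g = (\<lambda>x. (f x + C) / (2 * C))"
  have bg: "bdd_borel g" unfolding g_def using f by (intro bdd_borel_intros)
  have g01: "0 \<le> g x" "g x \<le> 1" for x using C(1) C(2)[of x] by (auto simp: g_def abs_le_iff divide_le_eq)
  have "\<rho> * (\<integral>x. g x \<partial>unif)\<^sup>2 \<le> ip g (kop W g)"
    by (rule locally_dense_functions[OF W(1) dense bg g01])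
  also have "\<dots> = ip (\<lambda>x. g x - (\<integral>x. g x \<partial>unif)) (kop W (\<lambda>x. g x - (\<integral>x. g x \<partial>unif))) + \<rho> * (\<integral>x. g x \<partial>unif)\<^sup>2"
    using regular_quadratic_form[OF W reg bg, of 1] by simp
  finally have 0: "0 \<le> ip (\<lambda>x. g x - (\<integral>x. g x \<partial>unif)) (kop W (\<lambda>x. g x - (\<integral>x. g x \<partial>unif)))" by simp
  have mg: "(\<integral>x. g x \<partial>unif) = ((\<integral>x. f x \<partial>unif) + C) / (2 * C)"
    using f unif.prob_space by (simp add: g_def)
  have alg: "(a + C) / (2 * C) - (b + C) / (2 * C) = inverse (2 * C) * (a - b)" for a b
    by (simp only: divide_inverse ring_distribs) (simp add: mult.commute)
  have "(\<lambda>x. g x - (\<integral>x. g x \<partial>unif)) = (\<lambda>x. inverse (2 * C) * (f x - (\<integral>x. f x \<partial>unif)))"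
    unfolding mg alg[symmetric] by (simp only: g_def)
  then have "ip (\<lambda>x. g x - (\<integral>x. g x \<partial>unif)) (kop W (\<lambda>x. g x - (\<integral>x. g x \<partial>unif)))
     = (inverse (2 * C))\<^sup>2 * ip (\<lambda>x. f x - (\<integral>x. f x \<partial>unif)) (kop W (\<lambda>x. f x - (\<integral>x. f x \<partial>unif)))"
    by (simp only: kop_scale ip_scale_left ip_scale_right power2_eq_square mult.assoc)
  with 0 C(1) have "0 \<le> ip (\<lambda>x. f x - (\<integral>x. f x \<partial>unif)) (kop W (\<lambda>x. f x - (\<integral>x. f x \<partial>unif)))"
    by (simp add: zero_le_mult_iff)
  then show "0 \<le> ip f (kop W f)"
    using regular_quadratic_form[OF W reg f, of 1] assms(5) by simp
qed

text \<open>Each branch dominates the constant \<open>p\<^sup>r\<close>, hence the product of the branches dominates the product of the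
constants.\<close>

lemma theta_kernel_locally_dense:
  assumes K: "psd K" "degree_regular p K" "p \<ge> 0" and rs: "\<forall>r\<in>set rs. r \<ge> 1" and f: "bdd_borel f"
  shows "p ^ sum_list rs * (\<integral>x. f x \<partial>unif)\<^sup>2 \<le> ip f (kop (theta_kernel rs K) f)"
proof -
  have "dominates (theta_kernel rs K) (\<lambda>x. prod_list (map (\<lambda>r. sqrt (p ^ r)) rs))"
    unfolding theta_kernel_def using K rs by (intro dominates_prod_list regular_kpow_dominates_const) auto
  then have "psd (\<lambda>z. theta_kernel rs K z - p ^ sum_list rs)"
    using K(3) by (simp add: dominates_def prod_list_sqrt prod_list_power)
  then have nonneg: "0 \<le> ip f (kop (\<lambda>z. theta_kernel rs K z - p ^ sum_list rs) f)" by (rule psd_nonneg[OF _ f])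
  show ?thesis
  proof -
    have "kop (\<lambda>z. p ^ sum_list rs) f = (\<lambda>x. p ^ sum_list rs * (\<integral>x. f x \<partial>unif))" by (simp add: kop_def fun_eq_iff)
    then have "ip f (kop (\<lambda>z. p ^ sum_list rs) f) = p ^ sum_list rs * (\<integral>x. f x \<partial>unif)\<^sup>2"
      using f by (simp add: ip_def power2_eq_square mult_ac)
    moreover have "ip f (kop (\<lambda>z. theta_kernel rs K z - p ^ sum_list rs) f)
        = ip f (kop (theta_kernel rs K) f) - ip f (kop (\<lambda>z. p ^ sum_list rs) f)"
      using bdd_borel_theta_kernel[OF psd_bdd_borel[OF K(1)], of rs] f
      by (simp only: kop_diff bdd_borel_const ip_diff_right bdd_borel_kop)
    ultimately show ?thesis using nonneg by linarith
  qed
qed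

section \<open>From Lebesgue measurable to Borel kernels\<close>

lemma square_lebesgue: "unit_square \<in> sets lebesgue"
  by (intro lborelD sets_completionI_sets) (auto intro: borel_closed closed_Times)

lemma AE_lebesgue_square: "(AE z in lebesgue_on unit_square. P z) \<longleftrightarrow> (AE z in unif2. P z)"
  using square_lebesgue by (simp add: AE_restrict_space_iff AE_completion_iff AE_unif2_iff)

lemma AE_lebesgue_interval: "(AE x in lebesgue_on {0..1}. P x) \<longleftrightarrow> (AE x in unif. P x)"
  by (simp add: AE_restrict_space_iff AE_completion_iff AE_unif_iff)

lemma measurable_completion_cong_AE:
  assumes g: "g \<in> measurable (completion M) N" and eq: "AE x in completion M. f x = g x"
    and f: "f \<in> space M \<rightarrow> space N"
  shows "f \<in> measurable (completion M) N"
proof (rule measurableI)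
  fix A assume "A \<in> sets N"
  then have A: "g -` A \<inter> space (completion M) \<in> sets (completion M)" using g by (rule measurable_sets[rotated])
  have ae: "AE x in completion M. (x \<in> g -` A \<inter> space (completion M)) = (x \<in> f -` A \<inter> space (completion M))"
    using eq by eventually_elim simp
  show "f -` A \<inter> space (completion M) \<in> sets (completion M)"
    by (rule completion.in_sets_AE[OF ae A]) simp
qed (use f in auto)

lemma measurable_lebesgue_on_cong_AE:
  fixes f g :: "'a::euclidean_space \<Rightarrow> real"
  assumes S: "S \<in> sets lebesgue" and g: "g \<in> borel_measurable borel"
    and eq: "AE x in lebesgue_on S. f x = g x"
  shows "f \<in> borel_measurable (lebesgue_on S)"
proof (rule borel_measurable_if_D)
  have g': "(\<lambda>x. if x \<in> S then g x else 0) \<in> borel_measurable lebesgue"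
  proof (rule measurable_If_set)
    show "g \<in> borel_measurable lebesgue" by (rule measurable_completion) (simp add: g)
  qed (use S in simp_all)
  show "(\<lambda>x. if x \<in> S then f x else 0) \<in> borel_measurable lebesgue"
  proof (rule measurable_completion_cong_AE[OF g'])
    have "AE x in lebesgue. x \<in> S \<longrightarrow> f x = g x" using eq S by (simp add: AE_restrict_space_iff)
    then show "AE x in lebesgue. (if x \<in> S then f x else 0) = (if x \<in> S then g x else 0)"
      by eventually_elim auto
  qed simp
qed

lemma integral_lebesgue_on:
  fixes f g :: "'a::euclidean_space \<Rightarrow> real"
  assumes S: "S \<in> sets borel" and g: "g \<in> borel_measurable borel"
    and eq: "AE x in lebesgue_on S. f x = g x"
  shows "(\<integral>x. f x \<partial>lebesgue_on S) = (\<integral>x. g x \<partial>density lborel (indicator S))"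
proof -
  have S': "S \<in> sets lebesgue" using S by simp
  have gm: "g \<in> borel_measurable (lebesgue_on S)"
    by (rule measurable_lebesgue_on_cong_AE[OF S' g]) simp
  have "(\<integral>x. f x \<partial>lebesgue_on S) = (\<integral>x. g x \<partial>lebesgue_on S)"
    by (rule integral_cong_AE[OF measurable_lebesgue_on_cong_AE[OF S' g eq] gm eq])
  also have "\<dots> = (\<integral>x. indicator S x * g x \<partial>lebesgue)"
    using S' by (subst integral_restrict_space) auto
  also have "\<dots> = (\<integral>x. indicator S x * g x \<partial>lborel)"
    by (rule integral_completion) (use g S in auto)
  also have "\<dots> = (\<integral>x. g x \<partial>density lborel (\<lambda>x. ennreal (indicator S x)))"
    by (subst integral_density) (use g S in auto)
  finally show ?thesis by (simp add: ennreal_indicator)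
qed

lemma integral_lebesgue_square:
  fixes f g :: "real \<times> real \<Rightarrow> real"
  assumes "g \<in> borel_measurable borel" and "AE z in unif2. f z = g z"
  shows "(\<integral>z. f z \<partial>lebesgue_on unit_square) = (\<integral>z. g z \<partial>unif2)"
  unfolding unif2_eq_density
  by (rule integral_lebesgue_on) (use assms in \<open>auto simp: AE_lebesgue_square intro: borel_closed closed_Times\<close>)

lemma integral_lebesgue_interval:
  fixes f g :: "real \<Rightarrow> real"
  assumes "g \<in> borel_measurable borel" and "AE z in unif. f z = g z"
  shows "(\<integral>z. f z \<partial>lebesgue_on {0..1}) = (\<integral>z. g z \<partial>unif)"
  unfolding unif_def
  by (rule integral_lebesgue_on) (use assms in \<open>auto simp: AE_lebesgue_interval\<close>)

lemma lebesgue_on_borel_version: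
  fixes f :: "'a::euclidean_space \<Rightarrow> real"
  assumes f: "f \<in> borel_measurable (lebesgue_on S)" and S: "S \<in> sets lebesgue"
  obtains g where "g \<in> borel_measurable borel" "AE x in lebesgue_on S. f x = g x"
proof -
  have "(\<lambda>x. if x \<in> S then f x else 0) \<in> borel_measurable (completion lborel)"
    using borel_measurable_if_I[OF f S] .
  then obtain g where g: "g \<in> borel_measurable lborel" and eq: "AE x in lborel. (if x \<in> S then f x else 0) = g x"
    using completion_ex_borel_measurable_real by blast
  have "AE x in lborel. x \<in> S \<longrightarrow> f x = g x" using eq by eventually_elim auto
  then have "AE x in lebesgue_on S. f x = g x" using S by (simp add: AE_restrict_space_iff AE_completion_iff)
  then show ?thesis using that[of g] g by simp
qed

lemma bdd_borel_clip:
  assumes "g \<in> borel_measurable borel" shows "bdd_borel (\<lambda>x. max lo (min hi (g x)) :: real)"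
  by (rule bdd_borelI[where C="\<bar>lo\<bar> + \<bar>hi\<bar>"]) (use assms in auto)

lemma AE_unif2_swap:
  assumes "AE z in unif2. P z" shows "AE z in unif2. P (snd z, fst z)"
proof -
  have "AE z in distr unif2 unif2 (\<lambda>(x, y). (y, x)). P z"
    by (subst unif2.distr_pair_swap[symmetric]) (rule assms)
  from AE_distrD[OF measurable_pair_swap' this] show ?thesis by (simp add: case_prod_beta)
qed

lemma AE_unif2_fst:
  assumes "AE x in unif. P x" shows "AE z in unif2. P (fst z)"
proof -
  obtain N where N: "{x \<in> space unif. \<not> P x} \<subseteq> N" "N \<in> null_sets unif"
    using assms by (auto simp: eventually_ae_filter)
  have "N \<times> UNIV \<in> null_sets unif2"
  proof (rule null_setsI)
    have [simp]: "N \<in> sets borel" using N(2) by auto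
    show "N \<times> UNIV \<in> sets unif2" by (rule pair_measureI) auto
    show "emeasure unif2 (N \<times> UNIV) = 0"
      using N(2) by (subst unif.emeasure_pair_measure_Times) auto
  qed
  then show ?thesis by (rule AE_I') (use N(1) in auto)
qed

lemma AE_unif2_snd: "AE x in unif. P x \<Longrightarrow> AE z in unif2. P (snd z)"
  using AE_unif2_swap[OF AE_unif2_fst] by fastforce

text \<open>Clipping and symmetrising a Borel version of \<open>K\<close> makes the bounds and the symmetry hold everywhere; neither
changes it almost everywhere.\<close>

lemma kernel_borel_version:
  fixes K :: "real \<times> real \<Rightarrow> real"
  assumes K: "K \<in> borel_measurable (lebesgue_on unit_square)"
    and sym: "\<forall>x\<in>{0..1}. \<forall>y\<in>{0..1}. K (x, y) = K (y, x)"
    and bounds: "AE z in lebesgue_on unit_square. lo \<le> K z \<and> K z \<le> hi" and "lo \<le> hi"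
  obtains K' where "bdd_borel K'" "sym_kernel K'" "\<And>z. lo \<le> K' z" "\<And>z. K' z \<le> hi" "AE z in unif2. K z = K' z"
proof -
  obtain g where g: "g \<in> borel_measurable borel" "AE z in lebesgue_on unit_square. K z = g z"
    by (rule lebesgue_on_borel_version[OF K square_lebesgue], rule that)
  define h where "h = (\<lambda>z. max lo (min hi (g z)))"
  have bmh: "bdd_borel h" unfolding h_def by (rule bdd_borel_clip[OF g(1)])
  have h: "lo \<le> h z" "h z \<le> hi" for z using \<open>lo \<le> hi\<close> by (auto simp: h_def)
  have AE1: "AE z in unif2. K z = h z"
    using g(2) bounds unfolding AE_lebesgue_square by eventually_elim (auto simp: h_def)
  \<comment> \<open>the symmetrised version agrees with \<open>K\<close> because \<open>K\<close> is symmetric on the square\<close>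
  define K' where "K' = (\<lambda>z. (h z + h (snd z, fst z)) / 2)"
  have 1: "bdd_borel K'" unfolding K'_def using bmh bdd_borel_swap[OF bmh] by (intro bdd_borel_divide bdd_borel_add)
  have 2: "sym_kernel K'" by (simp add: sym_kernel_def K'_def)
  have 3: "lo \<le> K' z" "K' z \<le> hi" for z using h(1)[of z] h(1)[of "(snd z, fst z)"] h(2)[of z] h(2)[of "(snd z, fst z)"]
    by (auto simp: K'_def)
  have 4: "AE z in unif2. K z = K' z"
    using AE1 AE_unif2_swap[OF AE1] AE_unif2_in
  proof eventually_elim
    case (elim z)
    have "K (snd z, fst z) = K z" using sym elim(3) by (cases z) auto
    then show ?case using elim by (simp add: K'_def)
  qed
  show ?thesis by (rule that[OF 1 2 3 4])
qed

lemma borel_measurable_lebesgue_on: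
  assumes "S \<in> sets lebesgue" "g \<in> borel_measurable borel"
  shows "(g :: 'a::euclidean_space \<Rightarrow> real) \<in> borel_measurable (lebesgue_on S)"
  by (rule measurable_lebesgue_on_cong_AE[OF assms]) simp

lemma bounded_function_borel_version:
  fixes f :: "real \<Rightarrow> real"
  assumes "f \<in> borel_measurable (lebesgue_on {0..1})" "bounded (f ` {0..1})"
  obtains f' where "bdd_borel f'" "AE x in unif. f x = f' x"
proof -
  obtain C where C: "\<forall>x\<in>{0..1}. \<bar>f x\<bar> \<le> C" using assms(2) by (auto simp: bounded_iff)
  obtain g where g: "g \<in> borel_measurable borel" "AE z in lebesgue_on {0..1}. f z = g z"
    by (rule lebesgue_on_borel_version[OF assms(1)], simp, rule that)
  have "AE x in unif. f x = max (-C) (min C (g x))"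
    using g(2) AE_unif_in unfolding AE_lebesgue_interval
  proof eventually_elim
    case (elim x)
    then show ?case using bspec[OF C elim(2)] by auto
  qed
  then show ?thesis using that[OF bdd_borel_clip[OF g(1)]] by blast
qed

lemma doubly_nonnegative_borel_version:
  assumes "doubly_nonnegative K"
  obtains K' where "psd K'" "\<And>z. 0 \<le> K' z" "AE z in unif2. K z = K' z"
proof -
  have K: "kernel K" and nonneg: "AE z in lebesgue_on unit_square. 0 \<le> K z"
    and form: "\<And>f. f \<in> borel_measurable (lebesgue_on {0..1}) \<Longrightarrow> bounded (f ` {0..1}) \<Longrightarrow>
        0 \<le> (\<integral>(x, y). f x * K (x, y) * f y \<partial>lebesgue_on unit_square)"
    using assms unfolding doubly_nonnegative_def by blast+
  obtain C where C: "\<forall>z\<in>unit_square. \<bar>K z\<bar> \<le> C"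
    using K by (auto simp: kernel_def bounded_iff simp del: split_paired_Ball_Sigma)
  have C0: "C \<ge> 0" using bspec[OF C, of "(0,0)"] by auto
  have bnd: "AE z in lebesgue_on unit_square. 0 \<le> K z \<and> K z \<le> C"
    using nonneg AE_unif2_in unfolding AE_lebesgue_square
  proof eventually_elim
    case (elim z)
    then show ?case using bspec[OF C elim(2)] by simp
  qed
  have meas: "K \<in> borel_measurable (lebesgue_on unit_square)"
    and sym: "\<forall>x\<in>{0..1}. \<forall>y\<in>{0..1}. K (x, y) = K (y, x)" using K unfolding kernel_def by blast+
  obtain K' where K': "bdd_borel K'" "sym_kernel K'" "\<And>z. 0 \<le> K' z" "AE z in unif2. K z = K' z"
    by (rule kernel_borel_version[OF meas sym bnd C0], rule that)
  have "psd K'"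
    unfolding psd_def
  proof (intro conjI allI impI K')
    fix f :: "real \<Rightarrow> real" assume f: "bdd_borel f"
    have b: "bdd_borel (\<lambda>z. f (fst z) * K' z * f (snd z))" using f K'(1) by (intro bdd_borel_intros)
    have "0 \<le> (\<integral>(x, y). f x * K (x, y) * f y \<partial>lebesgue_on unit_square)"
    proof (rule form)
      show "f \<in> borel_measurable (lebesgue_on {0..1})"
        using f by (intro borel_measurable_lebesgue_on bdd_borel_measurable) auto
      show "bounded (f ` {0..1})" using f by (auto simp: bdd_borel_def bounded_iff)
    qed
    also have "\<dots> = (\<integral>z. f (fst z) * K' z * f (snd z) \<partial>unif2)"
    proof (rule integral_lebesgue_square[OF bdd_borel_measurable[OF b]])
      show "AE z in unif2. (case z of (x, y) \<Rightarrow> f x * K (x, y) * f y) = f (fst z) * K' z * f (snd z)"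
        using K'(4) by eventually_elim (simp add: case_prod_beta)
    qed
    finally show "0 \<le> ip f (kop K' f)" by (simp add: ip_kop K'(1) f)
  qed
  then show ?thesis using that K'(3,4) by blast
qed

lemma kernel_if_bdd_borel:
  assumes "bdd_borel M" "sym_kernel M" shows "kernel M"
  unfolding kernel_def
proof (intro conjI)
  show "M \<in> borel_measurable (lebesgue_on unit_square)"
    using assms by (intro borel_measurable_lebesgue_on bdd_borel_measurable square_lebesgue)
  obtain C where "\<And>z. \<bar>M z\<bar> \<le> C" using assms(1) by (auto simp: bdd_borel_def)
  then show "bounded (M ` unit_square)" by (auto simp: bounded_iff)
  show "\<forall>x\<in>{0..1}. \<forall>y\<in>{0..1}. M (x, y) = M (y, x)" using assms(2) unfolding sym_kernel_def by blast
qed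

lemma graphon_if_bdd_borel:
  assumes "bdd_borel M" "sym_kernel M" "\<And>z. 0 \<le> M z" "\<And>z. M z \<le> 1" shows "graphon M"
  using kernel_if_bdd_borel[OF assms(1,2)] assms(3,4) unfolding graphon_def kernel_def by blast

lemma doubly_nonnegative_if_psd:
  assumes "psd M" "\<And>z. 0 \<le> M z" shows "doubly_nonnegative M"
  unfolding doubly_nonnegative_def
proof (intro conjI allI impI)
  have M: "bdd_borel M" using assms by (auto simp: psd_def)
  show "kernel M" using assms by (intro kernel_if_bdd_borel) (auto simp: psd_def)
  show "AE z in lebesgue_on unit_square. 0 \<le> M z" by (rule AE_I2) (rule assms(2))
  fix f :: "real \<Rightarrow> real" assume "f \<in> borel_measurable (lebesgue_on {0..1}) \<and> bounded (f ` {0..1})"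
  then have f: "f \<in> borel_measurable (lebesgue_on {0..1})" "bounded (f ` {0..1})" by auto
  obtain g where g: "bdd_borel g" "AE x in unif. f x = g x"
    by (rule bounded_function_borel_version[OF f], rule that)
  have b: "bdd_borel (\<lambda>z. g (fst z) * M z * g (snd z))" using g M by (intro bdd_borel_intros)
  have "(\<integral>(x, y). f x * M (x, y) * f y \<partial>lebesgue_on unit_square) = (\<integral>z. g (fst z) * M z * g (snd z) \<partial>unif2)"
  proof (rule integral_lebesgue_square[OF bdd_borel_measurable[OF b]])
    show "AE z in unif2. (case z of (x, y) \<Rightarrow> f x * M (x, y) * f y) = g (fst z) * M z * g (snd z)"
      using AE_unif2_fst[OF g(2)] AE_unif2_snd[OF g(2)] by eventually_elim (simp add: case_prod_beta)
  qed
  also have "\<dots> = ip g (kop M g)" by (simp add: ip_kop M g)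
  also have "\<dots> \<ge> 0" using assms(1) g(1) by (rule psd_nonneg)
  finally show "0 \<le> (\<integral>(x, y). f x * M (x, y) * f y \<partial>lebesgue_on unit_square)" .
qed

lemma kernel_norm1_eq:
  assumes "bdd_borel K'" "AE z in unif2. K z = K' z"
  shows "kernel_norm1 K = (\<integral>z. K' z \<partial>unif2)"
  unfolding kernel_norm1_def by (rule integral_lebesgue_square[OF bdd_borel_measurable[OF assms(1)] assms(2)])

lemma ae_const_iff:
  assumes "AE z in unif2. K z = K' z"
  shows "ae_const K c \<longleftrightarrow> (AE z in unif2. K' z = c)"
  unfolding ae_const_def AE_lebesgue_square
proof
  assume "AE z in unif2. K z = c"
  with assms show "AE z in unif2. K' z = c" by eventually_elim simp
next
  assume "AE z in unif2. K' z = c"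
  with assms show "AE z in unif2. K z = c" by eventually_elim simp
qed

text \<open>The two quantities compared in the definition of local density, in terms of a Borel version \<open>f\<close> of the indicator of
\<open>S\<close>.\<close>

lemma set_integral_square:
  assumes S: "S \<in> sets lebesgue" "S \<subseteq> {0..1}" and f: "bdd_borel f" "AE x in unif. indicator S x = f x"
    and M: "bdd_borel M" "AE z in unif2. W z = M z"
  shows "(\<integral>z\<in>S \<times> S. W z \<partial>lebesgue) = ip f (kop M f)" "measure lebesgue S = (\<integral>x. f x \<partial>unif)"
proof -
  have b: "bdd_borel (\<lambda>z. f (fst z) * M z * f (snd z))" using f M by (intro bdd_borel_intros)
  have "(\<integral>z\<in>S \<times> S. W z \<partial>lebesgue) = (\<integral>z. indicator unit_square z *\<^sub>R (indicator (S \<times> S) z * W z) \<partial>lebesgue)"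
    unfolding set_lebesgue_integral_def using S(2)
    by (intro Bochner_Integration.integral_cong) (auto simp: indicator_def)
  also have "\<dots> = (\<integral>z. indicator (S \<times> S) z * W z \<partial>lebesgue_on unit_square)"
    using square_lebesgue by (subst integral_restrict_space) auto
  also have "\<dots> = (\<integral>z. f (fst z) * M z * f (snd z) \<partial>unif2)"
  proof (rule integral_lebesgue_square[OF bdd_borel_measurable[OF b]])
    show "AE z in unif2. indicator (S \<times> S) z * W z = f (fst z) * M z * f (snd z)"
      using AE_unif2_fst[OF f(2)] AE_unif2_snd[OF f(2)] M(2)
      by eventually_elim (auto simp: indicator_times)
  qed
  finally show "(\<integral>z\<in>S \<times> S. W z \<partial>lebesgue) = ip f (kop M f)" by (simp add: ip_kop f M)
  have "measure lebesgue S = (\<integral>x. indicator S x \<partial>lebesgue)"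
    using S by (simp add: integral_indicator)
  also have "\<dots> = (\<integral>x. indicator {0..1} x *\<^sub>R indicator S x \<partial>lebesgue)"
    using S(2) by (intro Bochner_Integration.integral_cong) (auto simp: indicator_def)
  also have "\<dots> = (\<integral>x. indicator S x \<partial>lebesgue_on {0..1})"
    by (subst integral_restrict_space) auto
  also have "\<dots> = (\<integral>x. f x \<partial>unif)"
    by (rule integral_lebesgue_interval[OF bdd_borel_measurable[OF f(1)] f(2)])
  finally show "measure lebesgue S = (\<integral>x. f x \<partial>unif)" .
qed

lemma locally_dense_borel:
  assumes W: "bdd_borel M" "AE z in unif2. W z = M z" and "locally_dense \<rho> W" and S: "S \<in> sets borel"
  shows "\<rho> * (\<integral>x. indicator S x \<partial>unif)\<^sup>2 \<le> (\<integral>z. indicator S (fst z) * M z * indicator S (snd z) \<partial>unif2)"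
proof -
  let ?S = "S \<inter> {0..1}" and ?f = "indicator S :: real \<Rightarrow> real"
  have S': "?S \<in> sets lebesgue" "?S \<subseteq> {0..1}" using S by auto
  have f: "bdd_borel ?f" using S by (rule bdd_borel_indicator)
  have AE: "AE x in unif. indicator ?S x = ?f x" using AE_unif_in by eventually_elim (simp add: indicator_def)
  have "\<rho> * (measure lebesgue ?S)\<^sup>2 \<le> (\<integral>z\<in>?S \<times> ?S. W z \<partial>lebesgue)"
    using assms(3) S' unfolding locally_dense_def by blast
  then show ?thesis
    unfolding set_integral_square[OF S' f AE W] ip_kop[OF W(1) f f] .
qed

lemma locally_dense_if_form:
  assumes "bdd_borel M" "\<And>f. bdd_borel f \<Longrightarrow> \<sigma> * (\<integral>x. f x \<partial>unif)\<^sup>2 \<le> ip f (kop M f)"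
  shows "locally_dense \<sigma> M"
  unfolding locally_dense_def
proof (intro allI impI)
  fix S :: "real set" assume "S \<in> sets lebesgue \<and> S \<subseteq> {0..1}"
  then have S: "S \<in> sets lebesgue" "S \<subseteq> {0..1}" by auto
  have "indicator S \<in> borel_measurable lebesgue" using S by simp
  then have m: "(indicator S :: real \<Rightarrow> real) \<in> borel_measurable (lebesgue_on {0..1})"
    by (rule measurable_restrict_space1)
  have b: "bounded ((indicator S :: real \<Rightarrow> real) ` {0..1})" by (auto simp: bounded_iff indicator_def intro!: exI[of _ 1])
  obtain f where f: "bdd_borel f" "AE x in unif. indicator S x = f x"
    by (rule bounded_function_borel_version[OF m b], rule that)
  show "\<sigma> * (measure lebesgue S)\<^sup>2 \<le> (\<integral>z\<in>S \<times> S. M z \<partial>lebesgue)"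
    using assms(2)[OF f(1)] set_integral_square[OF S f assms(1), of M] by simp
qed

lemma degree_regular_if_regular_graphon:
  assumes M: "bdd_borel M" "AE z in unif2. W z = M z" and reg: "regular_graphon \<rho> W"
  shows "degree_regular \<rho> M"
proof -
  have "AE x in unif. AE y in unif. W (x, y) = M (x, y)"
  proof -
    obtain N where N: "{z \<in> space unif2. \<not> W z = M z} \<subseteq> N" "N \<in> null_sets unif2"
      using M(2) by (auto simp: eventually_ae_filter)
    have "AE z in unif2. z \<notin> N" using N(2) by (rule AE_not_in)
    then have "AE x in unif. AE y in unif. (x, y) \<notin> N" by (rule unif2.AE_pair)
    then show ?thesis
    proof eventually_elim
      case (elim x)
      then show ?case by eventually_elim (use N(1) in auto)
    qed
  qed
  moreover have "AE x in unif. (\<integral>y. W (x, y) \<partial>lebesgue_on {0..1}) = \<rho>"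
    using reg by (simp add: regular_graphon_def AE_lebesgue_interval)
  ultimately show ?thesis unfolding degree_regular_def
  proof eventually_elim
    case (elim x)
    have "(\<integral>y. W (x, y) \<partial>lebesgue_on {0..1}) = (\<integral>y. M (x, y) \<partial>unif)"
      by (rule integral_lebesgue_interval[OF bdd_borel_measurable[OF bdd_borel_section[OF M(1)]] elim(1)])
    then show ?case using elim(2) by (simp add: kop_def)
  qed
qed

section \<open>Integrating out the inner vertices\<close>

interpretation unifP: product_sigma_finite "\<lambda>_::'i. unif"
  by (simp add: product_sigma_finite_def unif.sigma_finite_measure_axioms)

abbreviation unifPi :: "'i set \<Rightarrow> ('i \<Rightarrow> real) measure" where
  "unifPi I \<equiv> Pi\<^sub>M I (\<lambda>_. unif)"

lemma prob_space_unifPi: "prob_space (unifPi I)"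
  by (rule prob_space_PiM) (rule prob_space_unif)

lemma integrable_unifPi:
  assumes "f \<in> borel_measurable (unifPi I)" "\<And>x. \<bar>f x\<bar> \<le> (C::real)"
  shows "integrable (unifPi I) f"
proof -
  interpret prob_space "unifPi I" by (rule prob_space_unifPi)
  show ?thesis using assms by (intro integrable_const_bound[where B=C]) auto
qed

lemma measurable_coordinate [measurable (raw)]: "p \<in> I \<Longrightarrow> (\<lambda>x. x p) \<in> borel_measurable (unifPi I)"
  using measurable_component_singleton[of p I "\<lambda>_. unif"] by simp

lemma measurable_kernel_of:
  fixes K :: "real \<times> real \<Rightarrow> real"
  assumes "bdd_borel K" "f \<in> borel_measurable M" "g \<in> borel_measurable M"
  shows "(\<lambda>x. K (f x, g x)) \<in> borel_measurable M"
proof -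
  have [measurable]: "K \<in> borel_measurable (borel \<Otimes>\<^sub>M borel)" unfolding borel_prod using assms(1) by (rule bdd_borel_measurable)
  note [measurable] = assms(2,3)
  show ?thesis by measurable
qed

lemma prod_bounded:
  assumes "\<And>t. \<bar>f t\<bar> \<le> (C t :: real)" shows "\<bar>\<Prod>t\<in>T. f t\<bar> \<le> (\<Prod>t\<in>T. C t)"
  unfolding abs_prod using assms by (intro prod_mono) auto

text \<open>The value at the \<open>j\<close>-th vertex of a path of length \<open>r\<close> whose ends carry \<open>a\<close> and \<open>b\<close> and whose inner vertices are the
coordinates \<open>w 1, \<dots>, w (r - 1)\<close> of \<open>x\<close>.\<close>

definition path_point :: "real \<Rightarrow> real \<Rightarrow> nat \<Rightarrow> (nat \<Rightarrow> 'i) \<Rightarrow> ('i \<Rightarrow> real) \<Rightarrow> nat \<Rightarrow> real" where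
  "path_point a b r w x j = (if j = 0 then a else if j = r then b else x (w j))"

definition path_weight :: "(real \<times> real \<Rightarrow> real) \<Rightarrow> real \<Rightarrow> real \<Rightarrow> nat \<Rightarrow> (nat \<Rightarrow> 'i) \<Rightarrow> ('i \<Rightarrow> real) \<Rightarrow> real" where
  "path_weight K a b r w x = (\<Prod>j<r. K (path_point a b r w x j, path_point a b r w x (Suc j)))"

lemma path_weight_measurable:
  assumes "bdd_borel K" "w ` {1..<r} \<subseteq> I"
  shows "path_weight K a b r w \<in> borel_measurable (unifPi I)"
proof -
  have p: "(\<lambda>x. path_point a b r w x j) \<in> borel_measurable (unifPi I)" if "j \<le> r" for j
  proof (cases "j = 0 \<or> j = r")
    case False
    then have "w j \<in> I" using assms(2) that by auto
    then show ?thesis using False by (simp add: path_point_def measurable_coordinate)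
  next
    case True
    then show ?thesis by (cases "j = 0") (auto simp: path_point_def)
  qed
  show ?thesis unfolding path_weight_def[abs_def]
    by (intro borel_measurable_prod measurable_kernel_of assms(1) p) auto
qed

lemma path_weight_bounded:
  assumes "\<And>z. \<bar>K z\<bar> \<le> C" shows "\<bar>path_weight K a b r w x\<bar> \<le> C ^ r"
  unfolding path_weight_def using prod_bounded[of _ "\<lambda>_. C" "{..<r}"] assms by simp

text \<open>Induction on the length: the first inner vertex becomes the start of a shorter path.\<close>

lemma path_integral:
  assumes K: "bdd_borel K" and "r \<ge> 1" and "inj_on w {1..<r}"
  shows "(\<integral>x. path_weight K a b r w x \<partial>unifPi (w ` {1..<r})) = kpow K r (a, b)"
  using assms(2,3)
proof (induction r arbitrary: a w rule: dec_induct)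
  case base
  interpret prob_space "unifPi (w ` {1..<1})" by (rule prob_space_unifPi)
  show ?case using prob_space by (simp add: path_weight_def path_point_def)
next
  case (step n)
  obtain C where C: "\<And>z. \<bar>K z\<bar> \<le> C" using K by (auto simp: bdd_borel_def)
  define w' where "w' = (\<lambda>j. w (Suc j))"
  let ?J = "w' ` {1..<n}"
  have n: "n \<ge> 1" by fact
  have ivl: "{1..<Suc n} = insert 1 (Suc ` {1..<n})" using n by (auto simp: image_Suc_atLeastLessThan)
  have J: "w ` {1..<Suc n} = {w 1} \<union> ?J"
    unfolding ivl w'_def image_insert image_image by simp
  have inj': "inj_on w' {1..<n}"
  proof (rule inj_onI)
    fix i j assume ij: "i \<in> {1..<n}" "j \<in> {1..<n}" "w' i = w' j"
    have "Suc i = Suc j"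
      by (rule inj_onD[OF step.prems ij(3)[unfolded w'_def]]) (use ij in auto)
    then show "i = j" by simp
  qed
  have notin: "w 1 \<notin> ?J"
  proof
    assume "w 1 \<in> ?J"
    then obtain j where j: "1 \<le> j" "j < n" "w 1 = w (Suc j)" by (auto simp: w'_def)
    have "1 = Suc j" by (rule inj_onD[OF step.prems j(3)]) (use j n in auto)
    with j show False by simp
  qed
  have disj: "{w 1} \<inter> ?J = {}" using notin by simp
  have pp: "path_point a b (Suc n) w (merge {w 1} ?J (x, y)) (Suc j) = path_point (x (w 1)) b n w' y j"
    if "j \<le> n" for x y j
  proof (cases "j = 0 \<or> j = n")
    case True
    then show ?thesis using n by (auto simp: path_point_def merge_def)
  next
    case False
    then have "w (Suc j) \<in> ?J" using that by (auto simp: w'_def)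
    then show ?thesis using False notin by (auto simp: path_point_def merge_def w'_def)
  qed
  have pw: "path_weight K a b (Suc n) w (merge {w 1} ?J (x, y)) = K (a, x (w 1)) * path_weight K (x (w 1)) b n w' y" for x y
  proof -
    have "path_weight K a b (Suc n) w (merge {w 1} ?J (x, y))
       = K (a, path_point (x (w 1)) b n w' y 0) * (\<Prod>j<n. K (path_point (x (w 1)) b n w' y j, path_point (x (w 1)) b n w' y (Suc j)))"
      unfolding path_weight_def prod.lessThan_Suc_shift
    proof (intro arg_cong2[where f="(*)"] prod.cong refl)
      show "K (path_point a b (Suc n) w (merge {w 1} ?J (x, y)) 0, path_point a b (Suc n) w (merge {w 1} ?J (x, y)) (Suc 0))
          = K (a, path_point (x (w 1)) b n w' y 0)"
        by (subst pp) (auto simp: path_point_def)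
      fix j assume "j \<in> {..<n}"
      then have "j \<le> n" "Suc j \<le> n" by auto
      then show "K (path_point a b (Suc n) w (merge {w 1} ?J (x, y)) (Suc j), path_point a b (Suc n) w (merge {w 1} ?J (x, y)) (Suc (Suc j)))
          = K (path_point (x (w 1)) b n w' y j, path_point (x (w 1)) b n w' y (Suc j))"
        by (simp only: pp)
    qed
    then show ?thesis by (simp add: path_weight_def path_point_def[of _ b n w' y 0])
  qed
  have "(\<integral>x. path_weight K a b (Suc n) w x \<partial>unifPi (w ` {1..<Suc n}))
     = (\<integral>x. (\<integral>y. path_weight K a b (Suc n) w (merge {w 1} ?J (x, y)) \<partial>unifPi ?J) \<partial>unifPi {w 1})"
    unfolding J
  proof (rule unifP.product_integral_fold[OF disj])
    show "integrable (unifPi ({w 1} \<union> ?J)) (path_weight K a b (Suc n) w)"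
      by (rule integrable_unifPi[OF path_weight_measurable[OF K] path_weight_bounded[OF C]]) (rule equalityD1[OF J])
  qed auto
  also have "\<dots> = (\<integral>x. K (a, x (w 1)) * kpow K n (x (w 1), b) \<partial>unifPi {w 1})"
    unfolding pw using step.IH[OF inj'] by simp
  also have "\<dots> = (\<integral>z. K (a, z) * kpow K n (z, b) \<partial>unif)"
    by (rule unifP.product_integral_singleton[of "\<lambda>z. K (a, z) * kpow K n (z, b)"])
       (use bdd_borel_measurable[OF bdd_borel_mult[OF bdd_borel_section[OF K, of a] bdd_borel_section'[OF bdd_borel_kpow[OF K, of n], of b]]] in simp)
  also have "\<dots> = kpow K (Suc n) (a, b)"
    using n by (cases n) (auto simp: kcomp_def kop_def)
  finally show ?case .
qed

text \<open>Fubini for a product of factors that use disjoint blocks of coordinates.\<close>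

lemma prod_blocks_integral:
  fixes f :: "'b \<Rightarrow> ('i \<Rightarrow> real) \<Rightarrow> real"
  assumes "finite B" "\<And>b. b \<in> B \<Longrightarrow> finite (J b)" "disjoint_family_on J B"
    and "\<And>b. b \<in> B \<Longrightarrow> f b \<in> borel_measurable (unifPi (J b))" and C: "\<And>b x. \<bar>f b x\<bar> \<le> C b"
  shows "(\<integral>x. (\<Prod>b\<in>B. f b (restrict x (J b))) \<partial>unifPi (\<Union>b\<in>B. J b)) = (\<Prod>b\<in>B. \<integral>x. f b x \<partial>unifPi (J b))"
  using assms(1-4)
proof (induction B rule: finite_induct)
  case empty
  interpret prob_space "unifPi {} :: ('i \<Rightarrow> real) measure" by (rule prob_space_unifPi)
  show ?case using prob_space by simp
next
  case (insert b B)
  let ?U = "\<Union>b\<in>B. J b"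
  have disj: "J b \<inter> ?U = {}" using insert.prems(2) insert.hyps by (fastforce simp: disjoint_family_on_def)
  have U: "(\<Union>b\<in>insert b B. J b) = J b \<union> ?U" by auto
  have meas: "(\<lambda>x. \<Prod>b\<in>insert b B. f b (restrict x (J b))) \<in> borel_measurable (unifPi (J b \<union> ?U))"
  proof (rule borel_measurable_prod)
    fix c assume c: "c \<in> insert b B"
    then have "J c \<subseteq> J b \<union> ?U" by auto
    from measurable_compose[OF measurable_restrict_subset[OF this] insert.prems(3)[OF c]]
    show "(\<lambda>x. f c (restrict x (J c))) \<in> borel_measurable (unifPi (J b \<union> ?U))" .
  qed
  have "(\<integral>x. (\<Prod>b\<in>insert b B. f b (restrict x (J b))) \<partial>unifPi (J b \<union> ?U))
      = (\<integral>x. (\<integral>y. (\<Prod>c\<in>insert b B. f c (restrict (merge (J b) ?U (x, y)) (J c))) \<partial>unifPi ?U) \<partial>unifPi (J b))"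
  proof (rule unifP.product_integral_fold[OF disj])
    show "integrable (unifPi (J b \<union> ?U)) (\<lambda>x. \<Prod>b\<in>insert b B. f b (restrict x (J b)))"
      by (rule integrable_unifPi[OF meas prod_bounded[OF C]])
  qed (use insert in auto)
  also have "\<dots> = (\<integral>x. (\<integral>y. f b x * (\<Prod>c\<in>B. f c (restrict y (J c))) \<partial>unifPi ?U) \<partial>unifPi (J b))"
  proof (intro Bochner_Integration.integral_cong refl)
    fix x y assume x: "x \<in> space (unifPi (J b))"
    have "restrict (merge (J b) ?U (x, y)) (J b) = x"
      using x by (auto simp: space_PiM PiE_def extensional_def merge_def restrict_def fun_eq_iff)
    moreover have "restrict (merge (J b) ?U (x, y)) (J c) = restrict y (J c)" if "c \<in> B" for c
      using disj that by (auto simp: merge_def restrict_def fun_eq_iff)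
    ultimately show "(\<Prod>c\<in>insert b B. f c (restrict (merge (J b) ?U (x, y)) (J c))) = f b x * (\<Prod>c\<in>B. f c (restrict y (J c)))"
      using insert.hyps by simp
  qed
  also have "\<dots> = (\<integral>x. f b x \<partial>unifPi (J b)) * (\<Prod>c\<in>B. \<integral>x. f c x \<partial>unifPi (J c))"
  proof -
    have "(\<integral>x. (\<Prod>b\<in>B. f b (restrict x (J b))) \<partial>unifPi ?U) = (\<Prod>b\<in>B. \<integral>x. f b x \<partial>unifPi (J b))"
      using insert.prems by (intro insert.IH) (auto simp: disjoint_family_on_def)
    then show ?thesis by simp
  qed
  also have "\<dots> = (\<Prod>c\<in>insert b B. \<integral>x. f c x \<partial>unifPi (J c))" using insert.hyps by simp
  finally show ?case unfolding U .
qed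

text \<open>The homomorphism density, with the Borel uniform measure in place of completed Lebesgue measure.\<close>

definition unif_density :: "('v, 'e) mgraph \<Rightarrow> (real \<times> real \<Rightarrow> real) \<Rightarrow> real" where
  "unif_density G K = (\<integral>x. (\<Prod>e\<in>edges G. edge_value K x (ends G e)) \<partial>unifPi (verts G))"

lemma edge_value_pair:
  assumes "sym_kernel K" shows "edge_value K x {u, v} = K (x u, x v)"
proof -
  have "{u, v} = {fst (ordered_ends {u, v}), snd (ordered_ends {u, v})}"
    unfolding ordered_ends_def by (rule someI[of _ "(u, v)"]) simp
  then show ?thesis using assms
    by (auto simp: edge_value_def doubleton_eq_iff sym_kernel_def case_prod_beta)
qed

lemma edge_value_ordered: "edge_value K x A = K (x (fst (ordered_ends A)), x (snd (ordered_ends A)))"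
  by (simp add: edge_value_def case_prod_beta)

context multigraph
begin

lemma ordered_ends_in:
  assumes "e \<in> edges H"
  shows "fst (ordered_ends (ends H e)) \<in> verts H" "snd (ordered_ends (ends H e)) \<in> verts H"
    "fst (ordered_ends (ends H e)) \<noteq> snd (ordered_ends (ends H e))"
proof -
  note eq = ordered_ends[OF card_ends[OF assms]]
  show "fst (ordered_ends (ends H e)) \<in> verts H" "snd (ordered_ends (ends H e)) \<in> verts H"
    using ends_subset[OF assms] eq by auto
  show "fst (ordered_ends (ends H e)) \<noteq> snd (ordered_ends (ends H e))"
    using card_ends[OF assms] eq by (metis card_1_singleton_iff insert_absorb2 numeral_eq_one_iff semiring_norm(85) One_nat_def)
qed

lemma verts_theta_subdivision:
  "verts (theta_subdivision H rs) = Inl ` verts H \<union>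
     (\<Union>b\<in>edges H \<times> {..<length rs}. (\<lambda>j. Inr (fst b, snd b, j)) ` {1..<rs ! snd b})"
  (is "_ = _ \<union> ?U")
proof
  show "verts (theta_subdivision H rs) \<subseteq> Inl ` verts H \<union> ?U"
  proof
    fix v assume "v \<in> verts (theta_subdivision H rs)"
    then consider "v \<in> Inl ` verts H" | e t where "e \<in> edges H" "t \<in> verts (theta_pattern rs)" "v = glue H e t"
      by (auto simp: theta_subdivision_def)
    then show "v \<in> Inl ` verts H \<union> ?U"
    proof cases
      case 2
      show ?thesis
      proof (cases t)
        case (Inner i j)
        then have "i < length rs" "0 < j" "j < rs ! i" using 2(2) by (auto simp: theta_pattern_def)
        then have "(e, i) \<in> edges H \<times> {..<length rs}" "j \<in> {1..<rs ! i}" using 2(1) by auto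
        then show ?thesis unfolding 2(3) Inner by force
      qed (use 2 ordered_ends_in in auto)
    qed auto
  qed
  show "Inl ` verts H \<union> ?U \<subseteq> verts (theta_subdivision H rs)"
  proof
    fix v assume "v \<in> Inl ` verts H \<union> ?U"
    then consider "v \<in> Inl ` verts H" | e i j where "e \<in> edges H" "i < length rs" "1 \<le> j" "j < rs ! i" "v = Inr (e, i, j)"
      by fastforce
    then show "v \<in> verts (theta_subdivision H rs)"
    proof cases
      case 2
      then have "Inner i j \<in> verts (theta_pattern rs)" "v = glue H e (Inner i j)" by (auto simp: theta_pattern_def)
      then have "v \<in> glue H e ` verts (theta_pattern rs)" by (metis imageI)
      then show ?thesis using 2(1) unfolding theta_subdivision_def by (auto simp del: glue.simps)
    qed (auto simp: theta_subdivision_def)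
  qed
qed

lemma num_edges_theta_subdivision: "num_edges (theta_subdivision H rs) = sum_list rs * num_edges H"
proof -
  have "edges (theta_pattern rs) = (SIGMA i:{..<length rs}. {..<rs ! i})" by (auto simp: theta_pattern_def)
  then have "card (edges (theta_pattern rs)) = sum_list rs"
    by (simp add: sum_list_sum_nth atLeast0LessThan)
  then show ?thesis by (simp add: num_edges_def theta_subdivision_def card_cartesian_product)
qed

text \<open>For fixed values at the vertices of \<open>H\<close>, the branches of all copies of \<open>\<Theta>\<close> use disjoint blocks of inner
vertices, so the inner integral is the product of the path integrals.\<close>

lemma unif_density_theta_subdivision:
  assumes K: "bdd_borel K" "sym_kernel K" and rs: "\<forall>r\<in>set rs. r \<ge> 1"
  shows "unif_density (theta_subdivision H rs) K = unif_density H (theta_kernel rs K)"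
proof -
  let ?G = "theta_subdivision H rs"
  obtain C where C: "\<And>z. \<bar>K z\<bar> \<le> C" using K by (auto simp: bdd_borel_def)
  let ?u = "\<lambda>e. fst (ordered_ends (ends H e))" and ?v = "\<lambda>e. snd (ordered_ends (ends H e))"
  define B where "B = edges H \<times> {..<length rs}"
  define w :: "'e \<times> nat \<Rightarrow> nat \<Rightarrow> 'v + 'e \<times> nat \<times> nat" where "w = (\<lambda>b j. Inr (fst b, snd b, j))"
  define J where "J = (\<lambda>b. w b ` {1..<rs ! snd b})"
  define U where "U = (\<Union>b\<in>B. J b)"
  let ?V = "Inl ` verts H :: ('v + 'e \<times> nat \<times> nat) set"
  have V: "verts ?G = ?V \<union> U"
    unfolding verts_theta_subdivision U_def J_def w_def B_def ..
  define F where "F = (\<lambda>x. \<Prod>e\<in>edges ?G. edge_value K x (ends ?G e))"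
  define f where "f = (\<lambda>(x :: 'v + 'e \<times> nat \<times> nat \<Rightarrow> real) b. path_weight K (x (Inl (?u (fst b)))) (x (Inl (?v (fst b)))) (rs ! snd b) (w b))"
  have finB: "finite B" by (simp add: B_def finite_edges)
  have F: "F x = (\<Prod>b\<in>B. f x b x)" for x
  proof -
    let ?g = "\<lambda>e i j. K (path_point (x (Inl (?u e))) (x (Inl (?v e))) (rs ! i) (w (e, i)) x j,
                         path_point (x (Inl (?u e))) (x (Inl (?v e))) (rs ! i) (w (e, i)) x (Suc j))"
    have g: "edge_value K x (ends ?G (e, i, j)) = ?g e i j" for e i j
    proof -
      have gl: "x (glue H e (branch_vertex rs i k)) = path_point (x (Inl (?u e))) (x (Inl (?v e))) (rs ! i) (w (e, i)) x k" for k
        by (simp add: branch_vertex_def path_point_def w_def)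
      have "ends ?G (e, i, j) = {glue H e (branch_vertex rs i j), glue H e (branch_vertex rs i (Suc j))}"
        by (simp add: theta_subdivision_def theta_pattern_def)
      then show ?thesis by (simp only: edge_value_pair[OF K(2)] gl)
    qed
    have P: "edges (theta_pattern rs) = (SIGMA i:{..<length rs}. {..<rs ! i})" by (auto simp: theta_pattern_def)
    have "F x = (\<Prod>(e, p)\<in>edges H \<times> edges (theta_pattern rs). case p of (i, j) \<Rightarrow> ?g e i j)"
      unfolding F_def
    proof (rule prod.cong)
      show "edges ?G = edges H \<times> edges (theta_pattern rs)"
        by (simp add: theta_subdivision_def)
      fix t assume "t \<in> edges H \<times> edges (theta_pattern rs)"
      obtain e i j where "t = (e, i, j)" by (cases t) auto
      then show "edge_value K x (ends ?G t) = (case t of (e, p) \<Rightarrow> case p of (i, j) \<Rightarrow> ?g e i j)"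
        by (simp only: g prod.case)
    qed
    also have "\<dots> = (\<Prod>e\<in>edges H. \<Prod>i<length rs. \<Prod>j<rs ! i. ?g e i j)"
      unfolding P by (simp add: prod.cartesian_product[symmetric] prod.Sigma[symmetric])
    also have "\<dots> = (\<Prod>b\<in>B. f x b x)"
      unfolding B_def f_def path_weight_def by (simp add: prod.cartesian_product case_prod_beta)
    finally show ?thesis .
  qed
  have disj: "?V \<inter> U = {}" by (auto simp: U_def J_def w_def)
  have wU: "w b ` {1..<rs ! snd b} \<subseteq> ?V \<union> U" if "b \<in> B" for b using that by (auto simp: U_def J_def)
  have Fmeas: "F \<in> borel_measurable (unifPi (?V \<union> U))"
  proof -
    interpret T: multigraph "?G" by (rule multigraph_theta_subdivision)
    show ?thesis
      unfolding F_def edge_value_ordered V[symmetric]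
      by (intro borel_measurable_prod measurable_kernel_of K(1) measurable_coordinate T.ordered_ends_in)
  qed
  have fb: "\<bar>f x b y\<bar> \<le> C ^ (rs ! snd b)" for x b y unfolding f_def by (rule path_weight_bounded[OF C])
  have Fint: "integrable (unifPi (?V \<union> U)) F"
    by (rule integrable_unifPi[OF Fmeas, where C="\<Prod>b\<in>B. C ^ (rs ! snd b)"]) (simp only: F prod_bounded[OF fb])
  have finU: "finite U" by (simp add: U_def J_def finB)
  have "unif_density ?G K = (\<integral>x. (\<integral>y. F (merge ?V U (x, y)) \<partial>unifPi U) \<partial>unifPi ?V)"
    unfolding unif_density_def F_def[symmetric] V
    by (rule unifP.product_integral_fold[OF disj _ finU Fint]) (simp add: finite_verts)
  also have "\<dots> = (\<integral>x. (\<Prod>b\<in>B. kpow K (rs ! snd b) (x (Inl (?u (fst b))), x (Inl (?v (fst b))))) \<partial>unifPi ?V)"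
  proof (intro Bochner_Integration.integral_cong refl)
    fix x :: "'v + 'e \<times> nat \<times> nat \<Rightarrow> real"
    have "F (merge ?V U (x, y)) = (\<Prod>b\<in>B. f x b (restrict y (J b)))" for y
      unfolding F
    proof (rule prod.cong[OF refl])
      fix b assume b: "b \<in> B"
      then have e: "fst b \<in> edges H" by (auto simp: B_def)
      have "path_point a a' (rs ! snd b) (w b) (merge ?V U (x, y)) j = path_point a a' (rs ! snd b) (w b) (restrict y (J b)) j"
        if "j \<le> rs ! snd b" for a a' j
      proof (cases "j = 0 \<or> j = rs ! snd b")
        case False
        then have "w b j \<in> J b" using that by (auto simp: J_def)
        moreover from this have "w b j \<in> U" using b by (auto simp: U_def)
        moreover have "w b j \<notin> ?V" by (auto simp: w_def)
        ultimately show ?thesis using False by (simp add: path_point_def merge_def)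
      qed (auto simp: path_point_def)
      then show "f (merge ?V U (x, y)) b (merge ?V U (x, y)) = f x b (restrict y (J b))"
        unfolding f_def path_weight_def using ordered_ends_in[OF e]
        by (intro prod.cong refl) (simp add: merge_def)
    qed
    then have "(\<integral>y. F (merge ?V U (x, y)) \<partial>unifPi U) = (\<integral>y. (\<Prod>b\<in>B. f x b (restrict y (J b))) \<partial>unifPi (\<Union>b\<in>B. J b))"
      by (simp add: U_def)
    also have "\<dots> = (\<Prod>b\<in>B. \<integral>y. f x b y \<partial>unifPi (J b))"
    proof (rule prod_blocks_integral[OF finB _ _ _ fb])
      show "finite (J b)" for b by (simp add: J_def)
      show "disjoint_family_on J B" by (auto simp: disjoint_family_on_def J_def w_def)
      show "f x b \<in> borel_measurable (unifPi (J b))" for b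
        unfolding f_def J_def by (rule path_weight_measurable[OF K(1)]) simp
    qed
    also have "\<dots> = (\<Prod>b\<in>B. kpow K (rs ! snd b) (x (Inl (?u (fst b))), x (Inl (?v (fst b)))))"
    proof (rule prod.cong[OF refl])
      fix b assume "b \<in> B"
      then have "rs ! snd b \<ge> 1" using rs by (auto simp: B_def)
      moreover have "inj_on (w b) {1..<rs ! snd b}" by (auto simp: inj_on_def w_def)
      ultimately show "(\<integral>y. f x b y \<partial>unifPi (J b)) = kpow K (rs ! snd b) (x (Inl (?u (fst b))), x (Inl (?v (fst b))))"
        unfolding f_def J_def by (rule path_integral[OF K(1)])
    qed
    finally show "(\<integral>y. F (merge ?V U (x, y)) \<partial>unifPi U) = (\<Prod>b\<in>B. kpow K (rs ! snd b) (x (Inl (?u (fst b))), x (Inl (?v (fst b)))))" .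
  qed
  also have "\<dots> = (\<integral>x. (\<Prod>e\<in>edges H. theta_kernel rs K (x (Inl (?u e)), x (Inl (?v e)))) \<partial>unifPi ?V)"
    unfolding B_def theta_kernel_def prod.list_conv_set_nth
    by (simp add: prod.cartesian_product case_prod_beta atLeast0LessThan)
  also have "\<dots> = (\<integral>x. (\<Prod>e\<in>edges H. theta_kernel rs K (x (?u e), x (?v e))) \<partial>unifPi (verts H))"
  proof -
    let ?t = "\<lambda>\<omega>. \<lambda>n\<in>verts H. \<omega> (Inl n :: 'v + 'e \<times> nat \<times> nat)"
    have d: "distr (unifPi ?V) (unifPi (verts H)) ?t = unifPi (verts H)"
      by (rule distr_PiM_reindex[where f=Inl and M="\<lambda>_. unif"]) (auto intro: prob_space_unif)
    have tm: "?t \<in> measurable (unifPi ?V) (unifPi (verts H))"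
      by (rule measurable_restrict) (auto intro: measurable_coordinate)
    have m: "(\<lambda>x. \<Prod>e\<in>edges H. theta_kernel rs K (x (?u e), x (?v e))) \<in> borel_measurable (unifPi (verts H))"
      by (intro borel_measurable_prod measurable_kernel_of bdd_borel_theta_kernel K(1) measurable_coordinate ordered_ends_in)
    have "(\<integral>x. (\<Prod>e\<in>edges H. theta_kernel rs K (x (?u e), x (?v e))) \<partial>unifPi (verts H))
      = (\<integral>x. (\<Prod>e\<in>edges H. theta_kernel rs K (?t x (?u e), ?t x (?v e))) \<partial>unifPi ?V)"
      by (subst d[symmetric], rule integral_distr[OF tm m])
    also have "\<dots> = (\<integral>x. (\<Prod>e\<in>edges H. theta_kernel rs K (x (Inl (?u e)), x (Inl (?v e)))) \<partial>unifPi ?V)"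
      using ordered_ends_in by (intro Bochner_Integration.integral_cong prod.cong refl) auto
    finally show ?thesis by simp
  qed
  also have "\<dots> = unif_density H (theta_kernel rs K)"
    by (simp add: unif_density_def edge_value_ordered)
  finally show ?thesis .
qed

end

section \<open>Homomorphism densities under theta-subdivision\<close>

text \<open>Two different coordinates are independent; this is why null sets of the square stay null when a kernel is
evaluated at the ends of an edge, and where looplessness enters.\<close>

lemma distr_unifPi_pair:
  assumes "finite V" "u \<in> V" "v \<in> V" "u \<noteq> v"
  shows "distr (unifPi V) unif2 (\<lambda>x. (x u, x v)) = unif2"
proof (rule pair_measure_eqI[symmetric])
  show "sigma_finite_measure unif" "sigma_finite_measure unif" by (rule unif.sigma_finite_measure_axioms)+
  have m: "(\<lambda>x. (x u, x v)) \<in> measurable (unifPi V) unif2"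
    by (rule measurable_Pair) (rule measurable_component_singleton, fact)+
  fix A B assume A: "A \<in> sets unif" and B: "B \<in> sets unif"
  let ?E = "\<lambda>i. if i = u then A else if i = v then B else UNIV"
  have E: "?E i \<in> sets unif" for i using A B by simp
  have "emeasure (distr (unifPi V) unif2 (\<lambda>x. (x u, x v))) (A \<times> B)
      = emeasure (unifPi V) ((\<lambda>x. (x u, x v)) -` (A \<times> B) \<inter> space (unifPi V))"
    using A B by (intro emeasure_distr m pair_measureI)
  also have "(\<lambda>x. (x u, x v)) -` (A \<times> B) \<inter> space (unifPi V) = Pi\<^sub>E V ?E"
    using assms by (auto simp: space_PiM PiE_iff split: if_splits)
  also have "emeasure (unifPi V) (Pi\<^sub>E V ?E) = (\<Prod>i\<in>V. emeasure unif (?E i))"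
    by (rule unifP.emeasure_PiM[OF assms(1)]) (rule E)
  also have "\<dots> = emeasure unif A * (emeasure unif B * (\<Prod>i\<in>V - {u} - {v}. emeasure unif (?E i)))"
    using assms by (simp add: prod.remove[of V u] prod.remove[of "V - {u}" v])
  also have "(\<Prod>i\<in>V - {u} - {v}. emeasure unif (?E i)) = 1"
    using unif.emeasure_space_1 by (intro prod.neutral) auto
  finally show "emeasure unif A * emeasure unif B = emeasure (distr (unifPi V) unif2 (\<lambda>x. (x u, x v))) (A \<times> B)"
    by simp
qed simp_all

lemma distr_lebesgue_unif: "distr (lebesgue_on {0..1}) unif (\<lambda>x. x) = unif"
proof (rule measure_eqI)
  have m: "(\<lambda>x. x) \<in> measurable (lebesgue_on {0..1::real}) unif"
    by (rule measurable_restrict_space1) (simp add: measurable_completion)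
  fix A assume "A \<in> sets (distr (lebesgue_on {0..1}) unif (\<lambda>x. x))"
  then have A: "A \<in> sets borel" by simp
  have "emeasure (distr (lebesgue_on {0..1}) unif (\<lambda>x. x)) A = emeasure (lebesgue_on {0..1}) (A \<inter> {0..1})"
    using A m by (simp add: emeasure_distr)
  also have "\<dots> = emeasure lborel (A \<inter> {0..1})"
    using A by (subst emeasure_restrict_space) auto
  also have "\<dots> = emeasure unif A"
    using A by (simp add: unif_def emeasure_density indicator_inter_arith[symmetric] Int_commute)
  finally show "emeasure (distr (lebesgue_on {0..1}) unif (\<lambda>x. x)) A = emeasure unif A" .
qed simp

lemma prob_space_lebesgue_interval: "prob_space (lebesgue_on {0..1::real})"
  by (rule prob_spaceI) (simp add: emeasure_restrict_space)

lemma distr_lebesgue_unifPi: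
  assumes "finite V"
  defines "L \<equiv> lebesgue_on {0..1::real}"
  shows "(\<lambda>x. \<lambda>i\<in>V. x i) \<in> measurable (Pi\<^sub>M V (\<lambda>_. L)) (unifPi V)"
    and "distr (Pi\<^sub>M V (\<lambda>_. L)) (unifPi V) (\<lambda>x. \<lambda>i\<in>V. x i) = unifPi V"
proof -
  have m: "(\<lambda>x. x) \<in> measurable L unif"
    unfolding L_def by (rule measurable_restrict_space1) (simp add: measurable_completion)
  show "(\<lambda>x. \<lambda>i\<in>V. x i) \<in> measurable (Pi\<^sub>M V (\<lambda>_. L)) (unifPi V)"
  proof (rule measurable_restrict)
    fix i assume "i \<in> V"
    from measurable_compose[OF measurable_component_singleton[OF this] m]
    show "(\<lambda>x. x i) \<in> measurable (Pi\<^sub>M V (\<lambda>_. L)) unif" .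
  qed
  have "distr (Pi\<^sub>M V (\<lambda>_. L)) (unifPi V) (compose V (\<lambda>x. x)) = Pi\<^sub>M V (\<lambda>_. distr L unif (\<lambda>x. x))"
    by (rule distr_PiM_finite_prob_space'[OF assms(1)])
       (use m in \<open>auto simp: L_def prob_space_lebesgue_interval prob_space_unif\<close>)
  then show "distr (Pi\<^sub>M V (\<lambda>_. L)) (unifPi V) (\<lambda>x. \<lambda>i\<in>V. x i) = unifPi V"
    by (simp add: compose_def[abs_def] L_def distr_lebesgue_unif)
qed

text \<open>The integrand for \<open>K\<close> agrees almost everywhere with the Borel measurable one for \<open>K'\<close>, so it is measurable
for the completed product measure and has the same integral.\<close>

lemma hom_density_eq_unif_density:
  assumes "multigraph G" and K: "bdd_borel K'" "AE z in unif2. K z = K' z"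
  shows "hom_density G K = unif_density G K'"
proof -
  interpret multigraph G by fact
  let ?V = "verts G" and ?P = "Pi\<^sub>M (verts G) (\<lambda>_. lebesgue_on {0..1::real})"
  let ?u = "\<lambda>e. fst (ordered_ends (ends G e))" and ?v = "\<lambda>e. snd (ordered_ends (ends G e))"
  let ?T = "\<lambda>x. \<lambda>i\<in>?V. x i :: real"
  let ?F = "\<lambda>K x. \<Prod>e\<in>edges G. edge_value K x (ends G e)"
  note T = distr_lebesgue_unifPi[OF finite_verts]
  have in_V: "?u e \<in> ?V" "?v e \<in> ?V"
    "?u e \<noteq> ?v e" if "e \<in> edges G" for e
    using ordered_ends_in[OF that] by auto
  have meas: "?F K' \<in> borel_measurable (unifPi ?V)"
    unfolding edge_value_ordered by (intro borel_measurable_prod measurable_kernel_of K(1) measurable_coordinate in_V)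
  have "AE x in unifPi ?V. K (x (?u e), x (?v e))
      = K' (x (?u e), x (?v e))" if "e \<in> edges G" for e
  proof -
    note d = distr_unifPi_pair[OF finite_verts in_V[OF that]]
    have m: "(\<lambda>x. (x (?u e), x (?v e))) \<in> measurable (unifPi ?V) unif2"
      by (rule measurable_Pair) (rule measurable_component_singleton, rule in_V[OF that])+
    show ?thesis by (rule AE_distrD[OF m]) (simp only: d K(2))
  qed
  then have "AE x in unifPi ?V. \<forall>e\<in>edges G. K (x (?u e), x (?v e))
      = K' (x (?u e), x (?v e))"
    by (rule AE_finite_allI[OF finite_edges])
  then have "AE x in unifPi ?V. ?F K x = ?F K' x"
    by eventually_elim (simp add: edge_value_ordered)
  then have "AE x in distr ?P (unifPi ?V) ?T. ?F K x = ?F K' x" by (simp only: T(2))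
  from AE_distrD[OF T(1) this] have "AE x in ?P. ?F K (?T x) = ?F K' (?T x)" .
  moreover have FT: "?F K (?T x) = ?F K x" for x
    using in_V by (simp add: edge_value_ordered)
  ultimately have AE: "AE x in completion ?P. ?F K x = ?F K' (?T x)"
    by (simp only: AE_completion_iff)
  have mT: "(\<lambda>x. ?F K' (?T x)) \<in> borel_measurable ?P" by (rule measurable_compose[OF T(1) meas])
  have mc: "(\<lambda>x. ?F K' (?T x)) \<in> borel_measurable (completion ?P)" by (rule measurable_completion[OF mT])
  have "hom_density G K = (\<integral>x. ?F K' (?T x) \<partial>completion ?P)"
    unfolding hom_density_def
    by (rule integral_cong_AE[OF measurable_completion_cong_AE[OF mc AE] mc AE]) simp
  also have "\<dots> = (\<integral>x. ?F K' (?T x) \<partial>?P)" by (rule integral_completion[OF mT])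
  also have "\<dots> = (\<integral>x. ?F K' x \<partial>distr ?P (unifPi ?V) ?T)"
    by (rule integral_distr[OF T(1) meas, symmetric])
  finally show ?thesis by (simp only: T(2) unif_density_def)
qed

lemma (in multigraph) hom_density_theta_subdivision:
  assumes K: "bdd_borel K'" "sym_kernel K'" "AE z in unif2. K z = K' z" and rs: "\<forall>r\<in>set rs. r \<ge> 1"
  shows "hom_density (theta_subdivision H rs) K = hom_density H (theta_kernel rs K')"
proof -
  have "hom_density (theta_subdivision H rs) K = unif_density (theta_subdivision H rs) K'"
    by (rule hom_density_eq_unif_density[OF multigraph_theta_subdivision K(1,3)])
  also have "\<dots> = unif_density H (theta_kernel rs K')"
    by (rule unif_density_theta_subdivision[OF K(1,2) rs])
  also have "\<dots> = hom_density H (theta_kernel rs K')"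
    by (rule hom_density_eq_unif_density[symmetric, OF multigraph_axioms bdd_borel_theta_kernel[OF K(1)]]) simp
  finally show ?thesis .
qed

lemma (in multigraph) hom_density_const:
  assumes "AE z in unif2. K z = c" shows "hom_density H K = c ^ num_edges H"
proof -
  interpret P: prob_space "unifPi (verts H)" by (rule prob_space_unifPi)
  have "hom_density H K = unif_density H (\<lambda>_. c)"
    by (rule hom_density_eq_unif_density[OF multigraph_axioms bdd_borel_const assms])
  also have "\<dots> = c ^ num_edges H"
    using P.prob_space by (simp add: unif_density_def edge_value_ordered num_edges_def)
  finally show ?thesis .
qed

lemma theta_lengthsD:
  assumes "theta_lengths rs" shows "\<forall>r\<in>set rs. r \<ge> 1" "rs \<noteq> []" "sum_list rs > 0"
proof -
  show 1: "\<forall>r\<in>set rs. r \<ge> 1" "rs \<noteq> []" using assms by (auto simp: theta_lengths_def)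
  then show "sum_list rs > 0" by (cases rs) auto
qed

lemma const_if_theta_kernel_const:
  fixes K :: "real \<times> real \<Rightarrow> real"
  assumes K: "psd K" "\<And>z. 0 \<le> K z" and p: "p > 0" "(\<integral>z. K z \<partial>unif2) = p"
    and rs: "theta_lengths rs"
    and const: "AE z in unif2. theta_kernel rs K z = p ^ sum_list rs"
  shows "AE z in unif2. K z = p"
proof (cases "length rs \<ge> 2")
  case True
  have "(\<integral>z. theta_kernel rs K z \<partial>unif2) = (\<integral>z. p ^ sum_list rs \<partial>unif2)"
    using const bdd_borel_measurable[OF bdd_borel_theta_kernel[OF psd_bdd_borel[OF K(1)]]] by (intro integral_cong_AE) auto
  then show ?thesis
    using const_if_integral_theta_kernel_le[of K, OF K p theta_lengthsD(1)[OF rs] True] unif2.P.prob_space by simp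
next
  case False
  obtain r rs' where "rs = r # rs'" using theta_lengthsD(2)[OF rs] by (cases rs) auto
  with False have r: "rs = [r]" by (cases rs') auto
  show ?thesis
    using const_if_kpow_const[OF K(1) p, of r] const theta_lengthsD(1)[OF rs] by (simp add: r theta_kernel_def)
qed

theorem theorem1p5:
  fixes H :: "('v, 'e) mgraph" and rs :: "nat list"
  assumes "multigraph H" and "num_edges H > 0" and "theta_lengths rs"
  shows
    "(Sidorenko_good H \<longrightarrow>
        Sidorenko_good (theta_subdivision H rs) \<and>
        (Sidorenko_good_forcing H \<or> length rs \<ge> 2 \<longrightarrow>
          (\<forall>K. doubly_nonnegative K \<and> kernel_norm1 K > 0 \<longrightarrow>
            (hom_density (theta_subdivision H rs) K
               = kernel_norm1 K ^ num_edges (theta_subdivision H rs)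
             \<longleftrightarrow> ae_const K (kernel_norm1 K))))) \<and>
     (KNRS H \<longrightarrow>
        regular_KNRS (theta_subdivision H rs) \<and>
        (KNRS_forcing H \<longrightarrow>
          (\<forall>\<rho> W. 0 < \<rho> \<and> \<rho> < 1 \<and> graphon W \<and> locally_dense \<rho> W \<and> regular_graphon \<rho> W \<longrightarrow>
            (hom_density (theta_subdivision H rs) W
               = \<rho> ^ num_edges (theta_subdivision H rs)
             \<longleftrightarrow> ae_const W \<rho>))))"
proof -
  interpret multigraph H by fact
  let ?G = "theta_subdivision H rs"
  interpret T: multigraph ?G by (rule multigraph_theta_subdivision)
  note rs = theta_lengthsD[OF assms(3)]
  let ?s = "sum_list rs" and ?e = "num_edges H"
  have edges: "x ^ num_edges ?G = (x ^ ?s) ^ ?e" for x :: real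
    by (simp add: num_edges_theta_subdivision power_mult)
  have const: "hom_density ?G K = c ^ num_edges ?G" if "ae_const K c" for K c
    using that unfolding ae_const_def AE_lebesgue_square by (rule T.hom_density_const)

  have good: "kernel_norm1 K ^ num_edges ?G \<le> hom_density ?G K \<and>
      (kernel_norm1 K > 0 \<and> (Sidorenko_good_forcing H \<or> length rs \<ge> 2) \<and>
       hom_density ?G K = kernel_norm1 K ^ num_edges ?G
        \<longrightarrow> ae_const K (kernel_norm1 K))"
    if H: "Sidorenko_good H" and K: "doubly_nonnegative K" for K
  proof -
    obtain K' where K': "psd K'" "\<And>z. 0 \<le> K' z" "AE z in unif2. K z = K' z"
      by (rule doubly_nonnegative_borel_version[OF K], rule that)
    have b: "bdd_borel K'" "sym_kernel K'" using K' by (auto simp: psd_def)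
    let ?M = "theta_kernel rs K'" and ?p = "kernel_norm1 K"
    have p: "?p = (\<integral>z. K' z \<partial>unif2)" by (rule kernel_norm1_eq[OF b(1) K'(3)])
    have p0: "?p \<ge> 0" unfolding p using K'(2) by simp
    have M: "psd ?M" by (rule psd_theta_kernel[OF K'(1) rs(1)])
    have dnM: "doubly_nonnegative ?M" by (rule doubly_nonnegative_if_psd[OF M theta_kernel_nonneg]) (rule K'(2))
    have normM: "kernel_norm1 ?M = (\<integral>z. ?M z \<partial>unif2)" by (rule kernel_norm1_eq[OF psd_bdd_borel[OF M]]) simp
    have ge: "?p ^ ?s \<le> kernel_norm1 ?M"
      unfolding p normM by (rule integral_theta_kernel_ge[of K', OF K'(1,2) rs(1,2)])
    have hd: "hom_density ?G K = hom_density H ?M"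
      by (rule hom_density_theta_subdivision[OF b K'(3) rs(1)])
    have HM: "kernel_norm1 ?M ^ ?e \<le> hom_density H ?M" using H dnM by (simp add: Sidorenko_good_def)
    have le: "(?p ^ ?s) ^ ?e \<le> kernel_norm1 ?M ^ ?e" using ge p0 by (intro power_mono) auto
    have "ae_const K ?p"
      if pos: "?p > 0" and forc: "Sidorenko_good_forcing H \<or> length rs \<ge> 2"
        and eq: "hom_density H ?M = (?p ^ ?s) ^ ?e"
    proof -
      have powers: "kernel_norm1 ?M ^ ?e = (?p ^ ?s) ^ ?e" using le HM eq by linarith
      have norm0: "kernel_norm1 ?M \<ge> 0" by (rule order_trans[OF zero_le_power[OF p0] ge])
      have nM: "kernel_norm1 ?M = ?p ^ ?s"
        by (rule power_eq_imp_eq_base[OF powers norm0 zero_le_power[OF p0] assms(2)])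
      have "AE z in unif2. K' z = ?p"
      proof (cases "length rs \<ge> 2")
        case True
        show ?thesis
          by (rule const_if_integral_theta_kernel_le[of K', OF K'(1,2) pos p[symmetric] rs(1) True])
             (use nM normM in simp)
      next
        case False
        then have "Sidorenko_good_forcing H" using forc by simp
        moreover have "kernel_norm1 ?M > 0" using nM pos by simp
        ultimately have "ae_const ?M (?p ^ ?s)"
          using dnM eq nM unfolding Sidorenko_good_forcing_def by metis
        then have "AE z in unif2. ?M z = ?p ^ ?s" by (simp only: ae_const_def AE_lebesgue_square)
        then show ?thesis
          by (rule const_if_theta_kernel_const[of K', OF K'(1,2) pos p[symmetric] assms(3)])
      qed
      then show ?thesis by (simp only: ae_const_iff[OF K'(3)])
    qed
    then show ?thesis using HM le unfolding hd edges by auto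
  qed

  have knrs: "\<rho> ^ num_edges ?G \<le> hom_density ?G W \<and>
      (0 < \<rho> \<and> \<rho> < 1 \<and> KNRS_forcing H \<and>
       hom_density ?G W = \<rho> ^ num_edges ?G \<longrightarrow> ae_const W \<rho>)"
    if H: "KNRS H" and \<rho>: "0 \<le> \<rho>" "\<rho> \<le> 1" and W: "graphon W" "locally_dense \<rho> W" "regular_graphon \<rho> W" for \<rho> W
  proof -
    have meas: "W \<in> borel_measurable (lebesgue_on unit_square)"
      and bnd: "\<forall>z\<in>unit_square. 0 \<le> W z \<and> W z \<le> 1"
      and sym: "\<forall>x\<in>{0..1}. \<forall>y\<in>{0..1}. W (x, y) = W (y, x)"
      using W(1) unfolding graphon_def by blast+
    have AE_bnd: "AE z in lebesgue_on unit_square. 0 \<le> W z \<and> W z \<le> 1"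
      using AE_unif2_in unfolding AE_lebesgue_square by eventually_elim (use bnd in blast)
    obtain W' where W': "bdd_borel W'" "sym_kernel W'" "\<And>z. 0 \<le> W' z" "\<And>z. W' z \<le> 1" "AE z in unif2. W z = W' z"
      by (rule kernel_borel_version[OF meas sym AE_bnd zero_le_one], rule that)
    have reg: "degree_regular \<rho> W'" by (rule degree_regular_if_regular_graphon[OF W'(1,5) W(3)])
    have psd: "psd W'"
      by (rule psd_if_locally_dense_regular[OF W'(1,2) reg locally_dense_borel[OF W'(1,5) W(2)] \<rho>(1)])
    let ?M = "theta_kernel rs W'"
    have gM: "graphon ?M"
      by (rule graphon_if_bdd_borel[OF bdd_borel_theta_kernel[OF W'(1)] sym_kernel_theta_kernel[OF W'(1,2)]
            theta_kernel_nonneg[of W', OF W'(3)] theta_kernel_le_1[of W', OF W'(1,3,4)]])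
    have dM: "locally_dense (\<rho> ^ ?s) ?M"
      by (rule locally_dense_if_form[OF bdd_borel_theta_kernel[OF W'(1)]
            theta_kernel_locally_dense[OF psd reg \<rho>(1) rs(1)]])
    have hd: "hom_density ?G W = hom_density H ?M"
      by (rule hom_density_theta_subdivision[OF W'(1,2,5) rs(1)])
    have \<sigma>: "0 \<le> \<rho> ^ ?s" "\<rho> ^ ?s \<le> 1" using \<rho> by (auto intro: power_le_one)
    have HM: "(\<rho> ^ ?s) ^ ?e \<le> hom_density H ?M" using H \<sigma> gM dM by (simp add: KNRS_def)
    have "ae_const W \<rho>" if \<rho>': "0 < \<rho>" "\<rho> < 1" and forc: "KNRS_forcing H" and eq: "hom_density H ?M = (\<rho> ^ ?s) ^ ?e"
    proof -
      have "0 < \<rho> ^ ?s" "\<rho> ^ ?s < 1" using \<rho>' rs(3) by (auto intro: power_Suc_less_one simp: power_less_one_iff)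
      then have "ae_const ?M (\<rho> ^ ?s)" using forc gM dM eq unfolding KNRS_forcing_def by metis
      then have "AE z in unif2. ?M z = \<rho> ^ ?s" by (simp only: ae_const_def AE_lebesgue_square)
      moreover have "(\<integral>z. W' z \<partial>unif2) = \<rho>"
        using integral_kernel[OF W'(1)] regular_moment[OF W'(1,2) reg, of 1] by simp
      ultimately have "AE z in unif2. W' z = \<rho>"
        using const_if_theta_kernel_const[of W', OF psd W'(3) \<rho>'(1) _ assms(3)] by blast
      then show ?thesis by (simp only: ae_const_iff[OF W'(5)])
    qed
    then show ?thesis using HM unfolding hd edges by auto
  qed

  show ?thesis
  proof (intro conjI impI allI)
    assume H: "Sidorenko_good H"
    show "Sidorenko_good ?G"
      unfolding Sidorenko_good_def using good[OF H] by blast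
    fix K assume "Sidorenko_good_forcing H \<or> length rs \<ge> 2" "doubly_nonnegative K \<and> 0 < kernel_norm1 K"
    then show "hom_density ?G K = kernel_norm1 K ^ num_edges ?G
        \<longleftrightarrow> ae_const K (kernel_norm1 K)"
      using good[OF H] const by blast
  next
    assume H: "KNRS H"
    show "regular_KNRS ?G"
      unfolding regular_KNRS_def using knrs[OF H] by blast
    fix \<rho> W assume "KNRS_forcing H" "0 < \<rho> \<and> \<rho> < 1 \<and> graphon W \<and> locally_dense \<rho> W \<and> regular_graphon \<rho> W"
    then show "hom_density ?G W = \<rho> ^ num_edges ?G \<longleftrightarrow> ae_const W \<rho>"
      using knrs[OF H, of \<rho> W] const by auto
  qed
qed

end
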